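(* Let $k$ be a field of characteristic zero, $R=k[x_0,\ldots,x_n]$ (standard graded), and let $f\in R$ be the determinant of the generic sub-Hankel matrix of order $n$. Let $J$ denote the gradient ideal of $f$. Then the minimal graded resolution of $R/J$ has the form $$0\to R(-(2n-1))\to R(-n)^n\oplus R(-2(n-1))\to R(-(n-1))^{n+1}\to R.$$ In particular, $R/J$ is strictly almost Cohen--Macaulay.
   Context: The generic sub-Hankel matrix of order $n$ on the variables $x_0,\ldots,x_n$ is the $n\times n$ matrix whose $(i,j)$ entry ($0\le i,j\le n-1$) is $x_{i+j}$ if $i+j\le n$ and $0$ if $i+j>n$. The gradient ideal of $f$ is the ideal generated by $\partial f/\partial x_0,\ldots,\partial f/\partial x_n$. Strictly almost Cohen--Macaulay means that the depth of $R/J$ equals $\dim R/J-1$.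
   Formalization: The resolution is stated for n ≥ 2 and strict almost Cohen–Macaulayness for n ≥ 3: for n = 1, J = R and the displayed complex is not minimal; for n = 2, J = (x_0,x_1,x_2), so R/J = k has depth = dimension = 0. *)

theory Defs
  imports
    "HOL-Library.Poly_Mapping"
    "HOL-Library.Extended_Nat"
    "HOL-Algebra.QuotRing"
    "Jordan_Normal_Form.Determinant"
begin

section \<open>The polynomial ring in the variables x_0, ..., x_n\<close>

text \<open>
  A monomial is its exponent function. The type has variables indexed by all natural
  numbers; the ring k[x_0, ..., x_n] is carved out below as a carrier set.
\<close>

type_synonym 'k mpol = "(nat \<Rightarrow>\<^sub>0 nat) \<Rightarrow>\<^sub>0 'k"

definition mvar :: "nat \<Rightarrow> 'k::field mpol" where
  "mvar i = Poly_Mapping.single (Poly_Mapping.single i 1) 1"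

definition mpoly_ring :: "nat \<Rightarrow> 'k::field mpol ring" where
  "mpoly_ring n =
     \<lparr>carrier = {p. \<forall>m\<in>Poly_Mapping.keys p. Poly_Mapping.keys m \<subseteq> {..n}},
      monoid.mult = (*), one = 1, zero = 0, add = (+)\<rparr>"

lemma cring_mpoly_ring: "cring (mpoly_ring n :: 'k::field mpol ring)"
proof -
  have keys_mult: "Poly_Mapping.keys m \<subseteq> {..n}"
    if pq: "p \<in> carrier (mpoly_ring n)" "q \<in> carrier (mpoly_ring n)" "m \<in> Poly_Mapping.keys (p * q)"
    for p q :: "'k mpol" and m
  proof -
    obtain a b where "m = a + b" "a \<in> Poly_Mapping.keys p" "b \<in> Poly_Mapping.keys q"
      using pq(3) Poly_Mapping.keys_mult[of p q] by blast
    with pq(1,2) show ?thesis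
      using Poly_Mapping.keys_add[of a b] by (fastforce simp: mpoly_ring_def)
  qed
  have keys_add: "Poly_Mapping.keys m \<subseteq> {..n}"
    if "p \<in> carrier (mpoly_ring n)" "q \<in> carrier (mpoly_ring n)" "m \<in> Poly_Mapping.keys (p + q)"
    for p q :: "'k mpol" and m
    using that Poly_Mapping.keys_add[of p q] by (auto simp: mpoly_ring_def)
  show ?thesis
  proof (rule cringI)
    show "abelian_group (mpoly_ring n :: 'k mpol ring)"
    proof (rule abelian_groupI)
      fix p :: "'k mpol" assume p: "p \<in> carrier (mpoly_ring n)"
      then show "\<exists>q\<in>carrier (mpoly_ring n). q \<oplus>\<^bsub>mpoly_ring n\<^esub> p = \<zero>\<^bsub>mpoly_ring n\<^esub>"
        by (intro bexI[of _ "- p"]) (simp_all add: mpoly_ring_def)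
    next
      fix p q :: "'k mpol" assume "p \<in> carrier (mpoly_ring n)" "q \<in> carrier (mpoly_ring n)"
      then have "p + q \<in> carrier (mpoly_ring n)"
        using keys_add[of p q] by (subst mpoly_ring_def) simp
      then show "p \<oplus>\<^bsub>mpoly_ring n\<^esub> q \<in> carrier (mpoly_ring n)"
        by (simp add: mpoly_ring_def)
    qed (simp_all add: mpoly_ring_def add.assoc add.commute)
    show "comm_monoid (mpoly_ring n :: 'k mpol ring)"
    proof (rule comm_monoidI)
      fix p q :: "'k mpol" assume "p \<in> carrier (mpoly_ring n)" "q \<in> carrier (mpoly_ring n)"
      then have "p * q \<in> carrier (mpoly_ring n)"
        using keys_mult[of p q] by (subst mpoly_ring_def) simp
      then show "p \<otimes>\<^bsub>mpoly_ring n\<^esub> q \<in> carrier (mpoly_ring n)"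
        by (simp add: mpoly_ring_def)
    qed (simp_all add: mpoly_ring_def mult.assoc mult.commute)
  qed (simp_all add: mpoly_ring_def distrib_right)
qed

definition mon_deg :: "(nat \<Rightarrow>\<^sub>0 nat) \<Rightarrow> nat" where
  "mon_deg m = (\<Sum>i\<in>Poly_Mapping.keys m. Poly_Mapping.lookup m i)"

text \<open>The zero polynomial is homogeneous of every degree, and the only one of negative degree.\<close>

definition homogeneous :: "int \<Rightarrow> 'k::field mpol \<Rightarrow> bool" where
  "homogeneous d p \<longleftrightarrow> (\<forall>m\<in>Poly_Mapping.keys p. int (mon_deg m) = d)"

definition partial_deriv :: "nat \<Rightarrow> 'k::field mpol \<Rightarrow> 'k mpol" where
  "partial_deriv i p =
     (\<Sum>m\<in>Poly_Mapping.keys p.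
        Poly_Mapping.single (m - Poly_Mapping.single i 1)
          (of_nat (Poly_Mapping.lookup m i) * Poly_Mapping.lookup p m))"

definition irrelevant_ideal :: "nat \<Rightarrow> 'k::field mpol set" where
  "irrelevant_ideal n = genideal (mpoly_ring n) (mvar ` {..n})"

definition gradient_ideal :: "nat \<Rightarrow> 'k::field mpol \<Rightarrow> 'k mpol set" where
  "gradient_ideal n f = genideal (mpoly_ring n) ((\<lambda>i. partial_deriv i f) ` {..n})"

definition sub_hankel :: "nat \<Rightarrow> 'k::field mpol mat" where
  "sub_hankel n = mat n n (\<lambda>(i, j). if i + j \<le> n then mvar (i + j) else 0)"

section \<open>Minimal graded free resolutions\<close>

definition free_module :: "nat \<Rightarrow> nat \<Rightarrow> 'k::field mpol vec set" where
  "free_module n r = {v \<in> carrier_vec r. \<forall>i<r. v $ i \<in> carrier (mpoly_ring n)}"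

text \<open>
  Lists of shifts \<open>a\<close>, \<open>b\<close> stand for the graded free modules with summands
  R(-a_i), R(-b_j). The j-th basis element of the source has degree b_j, so the matrix of a
  homogeneous map of degree zero has (i,j) entry homogeneous of degree b_j - a_i.
\<close>

definition graded_maps :: "nat \<Rightarrow> nat list \<Rightarrow> nat list \<Rightarrow> 'k::field mpol mat set" where
  "graded_maps n b a =
     {A \<in> carrier_mat (length a) (length b).
        \<forall>i<length a. \<forall>j<length b.
          A $$ (i, j) \<in> carrier (mpoly_ring n) \<and>
          homogeneous (int (b ! j) - int (a ! i)) (A $$ (i, j))}"

text \<open>
  The complex F_l \<open>\<rightarrow>\<close> ... \<open>\<rightarrow>\<close> F_1 \<open>\<rightarrow>\<close> F_0 = R
  with shifts \<open>a ! i\<close> of F_i and differential \<open>d ! i\<close> from F_(i+1) to F_i,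
  augmented by the projection from F_0 = R to R/J.
\<close>

definition cycles :: "nat \<Rightarrow> 'k::field mpol set \<Rightarrow> nat list list \<Rightarrow> 'k mpol mat list \<Rightarrow> nat
    \<Rightarrow> 'k mpol vec set" where
  "cycles n J a d i =
     (if i = 0 then {v \<in> free_module n (length (a ! 0)). v $ 0 \<in> J}
      else {v \<in> free_module n (length (a ! i)). (d ! (i - 1)) *\<^sub>v v = 0\<^sub>v (length (a ! (i - 1)))})"

definition boundaries :: "nat \<Rightarrow> nat list list \<Rightarrow> 'k::field mpol mat list \<Rightarrow> nat
    \<Rightarrow> 'k mpol vec set" where
  "boundaries n a d i =
     (if i < length d then (\<lambda>v. (d ! i) *\<^sub>v v) ` free_module n (length (a ! Suc i))
      else {0\<^sub>v (length (a ! i))})"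

definition graded_resolution :: "nat \<Rightarrow> 'k::field mpol set \<Rightarrow> nat list list \<Rightarrow> 'k mpol mat list
    \<Rightarrow> bool" where
  "graded_resolution n J a d \<longleftrightarrow>
     length a = Suc (length d) \<and> a ! 0 = [0] \<and>
     (\<forall>i<length d. d ! i \<in> graded_maps n (a ! Suc i) (a ! i)) \<and>
     (\<forall>i<length a. cycles n J a d i = boundaries n a d i)"

definition minimal_graded_resolution :: "nat \<Rightarrow> 'k::field mpol set \<Rightarrow> nat list list
    \<Rightarrow> 'k mpol mat list \<Rightarrow> bool" where
  "minimal_graded_resolution n J a d \<longleftrightarrow>
     graded_resolution n J a d \<and>
     (\<forall>A\<in>set d. \<forall>i<dim_row A. \<forall>j<dim_col A. A $$ (i, j) \<in> irrelevant_ideal n)"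

section \<open>Krull dimension, depth, and the strictly almost Cohen--Macaulay property\<close>

text \<open>For the zero ring both suprema are over the empty set, so both values are 0 there.\<close>

definition krull_dim :: "('a, 'b) ring_scheme \<Rightarrow> enat" where
  "krull_dim A =
     Sup {enat l | l. \<exists>P. (\<forall>i\<le>l. primeideal (P i) A) \<and> (\<forall>i<l. P i \<subset> P (Suc i))}"

definition regular_sequence :: "('a, 'b) ring_scheme \<Rightarrow> 'a list \<Rightarrow> bool" where
  "regular_sequence A as \<longleftrightarrow>
     set as \<subseteq> carrier A \<and> genideal A (set as) \<noteq> carrier A \<and>
     (\<forall>i<length as. \<forall>b\<in>carrier A.
        (as ! i) \<otimes>\<^bsub>A\<^esub> b \<in> genideal A (set (take i as)) \<longrightarrow> b \<in> genideal A (set (take i as)))"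

definition depth :: "('a, 'b) ring_scheme \<Rightarrow> 'a set \<Rightarrow> enat" where
  "depth A I = Sup {enat (length as) | as. set as \<subseteq> I \<and> regular_sequence A as}"

text \<open>
  The depth of R/J is taken with respect to the image of the irrelevant ideal;
  depth = dim - 1 is written additively to avoid truncated subtraction.
\<close>

definition strictly_almost_CM :: "nat \<Rightarrow> 'k::field mpol set \<Rightarrow> bool" where
  "strictly_almost_CM n J \<longleftrightarrow>
     depth (mpoly_ring n Quot J) ((\<lambda>p. J +>\<^bsub>mpoly_ring n\<^esub> p) ` irrelevant_ideal n) + 1
       = krull_dim (mpoly_ring n Quot J)"

end

theory Submission
  imports Defs "HOL-Computational_Algebra.Formal_Power_Series"
begin

text \<open>
  Put $y_i = x_{n-i}$ and $y(t) = \sum_i y_i t^i$.  Up to sign, the determinant $f$ is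
  $y_0^{n+1}$ times the coefficient of $t^n$ in $1 / y(t)$, and $\partial f / \partial y_i$ for
  $i \ge 1$ is $y_0^{n+1}$ times the coefficient of $t^{n-i}$ in $1 / y(t)^2$.  Differentiating
  $y^2 \cdot y^{-2} = 1$ gives $n - 1$ linear syzygies between these $n$ partial derivatives; the
  syzygy matrix is triangular with multiples of $y_0$ on its diagonal, and dividing by $y_0$
  repeatedly shows that it generates all syzygies.  With $I$ the ideal of these $n$ derivatives and
  $F$ the remaining one, the Euler relation and $H F \in I$ for $H = \partial f / \partial y_1$
  show $(y_0, H) \subseteq I : F$, and solving a triangular system modulo $y_0$ shows equality.
  The resolution is the mapping cone of the Koszul complex on $y_0, H$ and the
  resolution of $R / I$.

  The same exactness holds when some of $y_3, \dots, y_n$ are set to 0, hence $y_3, \dots, y_n$ is a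
  regular sequence on $R / J$.  Longer ones do not exist, because some homogeneous
  $z \notin J$ is killed by $y_0, y_1, y_2$: any $n - 1$ elements are algebraically dependent
  modulo these variables, and for large powers of a regular sequence of length $n - 1$ the lowest
  term of such a dependence forces $z$ into $J$ plus a high power of the irrelevant ideal.  The
  radical of $J$ is $(y_0, y_1)$, and the same argument with the lowest term bounds the length of
  chains of primes over $J$ by $n - 1$.
\<close>



text \<open>The Euler relation is the difference of two gradings: \<open>f\<close> has degree n, and
  also weight n if y_i has weight i. Giving y_i weight i - 1 therefore makes \<open>f\<close> of
  weight 0, so \<open>f\<close> itself drops out and y_0 F becomes a combination of the other
  derivatives. Exactness uses only a few divisibility properties of y_0, y_1, y_2. It is proved in
  an abstract domain and then applied to every specialisation. The price is that the coefficients
  found there may involve surplus variables and carry no degree information; both are repaired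
  afterwards, by setting variables to 0 and by taking homogeneous components. Depth and dimension
  are computed directly from regular sequences and chains of primes, not from the length of the
  resolution. Both upper bounds use one descent along increasing ideals V_i: for the dimension these
  are the primes of a chain, for the depth the colon ideals (J, first i elements) : z. The element z
  is y_0^(n-2), which lies outside J by degree and is killed by y_0 and y_1, multiplied by y_2 for
  as long as it stays outside J.\<close>

no_notation vec_index (infixl "$" 100)
unbundle fps_syntax


subsection \<open>The reciprocal power series\<close>

text \<open>For $y(t) = \sum_i y_i t^i$ this is $y(y_0 t) / y_0$, so that no division is needed and the
  reciprocal has polynomial coefficients.\<close>

definition dehom :: "(nat \<Rightarrow> 'a::comm_ring_1) \<Rightarrow> 'a fps" where
  "dehom y = Abs_fps (\<lambda>i. if i = 0 then 1 else y i * y 0 ^ (i - 1))"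

definition recip :: "(nat \<Rightarrow> 'a::comm_ring_1) \<Rightarrow> 'a fps" where
  "recip y = fps_right_inverse (dehom y) 1"

definition recip_sq :: "(nat \<Rightarrow> 'a::comm_ring_1) \<Rightarrow> 'a fps" where
  "recip_sq y = recip y * recip y"

lemma dehom_0 [simp]: "dehom y $ 0 = 1"
  by (simp add: dehom_def)

lemma dehom_nth: "i > 0 \<Longrightarrow> dehom y $ i = y i * y 0 ^ (i - 1)"
  by (simp add: dehom_def)

lemma dehom_recip: "dehom y * recip y = 1"
  unfolding recip_def by (rule fps_right_inverse) simp

lemma recip_0 [simp]: "recip y $ 0 = 1"
  by (simp add: recip_def)

lemma recip_sq_0 [simp]: "recip_sq y $ 0 = 1"
  by (simp add: recip_sq_def)

lemma recip_rec:
  assumes "m > 0"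
  shows "recip y $ m = - (\<Sum>i=1..m. y i * y 0 ^ (i - 1) * recip y $ (m - i))"
proof -
  have "0 = (dehom y * recip y) $ m"
    using assms by (simp add: dehom_recip)
  also have "\<dots> = (\<Sum>i=0..m. dehom y $ i * recip y $ (m - i))"
    by (simp add: fps_mult_nth)
  also have "\<dots> = recip y $ m + (\<Sum>i=1..m. dehom y $ i * recip y $ (m - i))"
    by (simp add: sum.atLeast_Suc_atMost)
  also have "(\<Sum>i=1..m. dehom y $ i * recip y $ (m - i))
      = (\<Sum>i=1..m. y i * y 0 ^ (i - 1) * recip y $ (m - i))"
    by (intro sum.cong) (auto simp: dehom_nth)
  finally show ?thesis
    by (simp add: eq_neg_iff_add_eq_0)
qed

lemma fps_X_deriv_nth: "(fps_X * fps_deriv f) $ m = of_nat m * (f $ m :: 'a::comm_ring_1)"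
  by (cases m) auto

text \<open>The relation comes from differentiating $Y^2 H = 1$.\<close>

lemma recip_sq_relation:
  "(\<Sum>i=0..m. of_nat (m + i) * (dehom y $ i * recip_sq y $ (m - i))) = 0"
proof -
  let ?Y = "dehom y" and ?G = "recip y" and ?H = "recip_sq y"
  define dY where "dY = fps_X * fps_deriv ?Y"
  define dH where "dH = fps_X * fps_deriv ?H"
  have nth: "dY $ i = of_nat i * ?Y $ i" "dH $ i = of_nat i * ?H $ i" for i
    by (simp_all only: dY_def dH_def fps_X_deriv_nth)
  have GY: "?G * ?Y = 1"
    using dehom_recip[of y] by (simp add: mult.commute)
  have "fps_deriv (?Y * ?Y * ?H) = fps_deriv (?Y * ?G * (?Y * ?G))"
    by (simp add: recip_sq_def mult_ac)
  also have "\<dots> = 0"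
    by (simp add: dehom_recip)
  finally have "?G * (fps_deriv ?Y * ?Y * ?H + ?Y * fps_deriv ?Y * ?H + ?Y * ?Y * fps_deriv ?H) = 0"
    by (simp add: algebra_simps)
  then have "(?G * ?Y) * (2 * (fps_deriv ?Y * ?H) + ?Y * fps_deriv ?H) = 0"
    by (simp add: algebra_simps)
  then have "2 * (fps_deriv ?Y * ?H) + ?Y * fps_deriv ?H = 0"
    by (simp add: GY)
  then have "fps_X * (2 * (fps_deriv ?Y * ?H) + ?Y * fps_deriv ?H) = 0"
    by (simp only: mult_zero_right)
  moreover have "fps_X * (2 * (fps_deriv ?Y * ?H) + ?Y * fps_deriv ?H) = dY * ?H + dY * ?H + ?Y * dH"
    unfolding dY_def dH_def mult_2 by (simp only: algebra_simps)
  ultimately have "0 = (dY * ?H + dY * ?H + ?Y * dH) $ m"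
    by (simp only: fps_zero_nth)
  also have "\<dots> = (\<Sum>i=0..m. of_nat i * ?Y $ i * ?H $ (m - i))
      + (\<Sum>i=0..m. of_nat i * ?Y $ i * ?H $ (m - i))
      + (\<Sum>i=0..m. ?Y $ i * (of_nat (m - i) * ?H $ (m - i)))"
    unfolding fps_add_nth fps_mult_nth[of dY ?H] fps_mult_nth[of ?Y dH] nth ..
  also have "\<dots> = (\<Sum>i=0..m. of_nat (m + i) * (?Y $ i * ?H $ (m - i)))"
    unfolding sum.distrib[symmetric]
  proof (intro sum.cong refl)
    fix i assume "i \<in> {0..m}"
    then have m: "m = i + (m - i)" by simp
    have of_nat_m: "of_nat (m + i) = of_nat i + of_nat i + (of_nat (m - i) :: 'a)"
      by (subst m) (simp only: of_nat_add add_ac)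
    show "of_nat i * ?Y $ i * ?H $ (m - i) + of_nat i * ?Y $ i * ?H $ (m - i)
        + ?Y $ i * (of_nat (m - i) * ?H $ (m - i)) = of_nat (m + i) * (?Y $ i * ?H $ (m - i))"
      unfolding of_nat_m by (simp only: algebra_simps)
  qed
  finally show ?thesis ..
qed

text \<open>Applied coefficientwise, \<open>D\<close> is a derivation of power series. It kills
  \<open>dehom y * recip y = 1\<close>, and multiplying by \<open>recip y\<close> solves for the
  derivative of the reciprocal. This is where the square of the reciprocal enters the
  gradient.\<close>

lemma recip_deriv:
  fixes D :: "'a::comm_ring_1 \<Rightarrow> 'a"
  assumes add: "\<And>a b. D (a + b) = D a + D b"
    and mult: "\<And>a b. D (a * b) = D a * b + a * D b"
  shows "D (recip y $ m) = - (\<Sum>i=0..m. D (dehom y $ i) * recip_sq y $ (m - i))"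
proof -
  have D0: "D 0 = 0" using add[of 0 0] by simp
  have D1: "D 1 = 0" using mult[of 1 1] by simp
  have Dsum: "D (sum f A) = (\<Sum>x\<in>A. D (f x))" for f :: "nat \<Rightarrow> 'a" and A
    by (induction A rule: infinite_finite_induct) (simp_all add: D0 add)
  define E where "E f = Abs_fps (\<lambda>i. D (f $ i))" for f
  have Emult: "E (f * g) = E f * g + f * E g" for f g
    by (rule fps_ext) (simp add: E_def fps_mult_nth Dsum mult sum.distrib)
  have "E (dehom y * recip y) = 0"
    by (rule fps_ext) (simp add: E_def dehom_recip fps_one_nth D0 D1)
  then have eq: "recip y * (E (dehom y) * recip y + dehom y * E (recip y)) = 0"
    by (simp add: Emult)
  have "recip y * (dehom y * E (recip y)) = E (recip y)"
    by (simp add: dehom_recip mult.assoc[symmetric] mult.commute[of "recip y"])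
  with eq have "E (recip y) = - (E (dehom y) * recip_sq y)"
    by (simp add: distrib_left recip_sq_def mult_ac eq_neg_iff_add_eq_0 add.commute)
  then have "E (recip y) $ m = - (E (dehom y) * recip_sq y) $ m"
    by simp
  then show ?thesis
    by (simp add: E_def fps_mult_nth)
qed

text \<open>Ring homomorphisms respect the recursion \<open>recip_rec\<close>. Applied to
  \<open>zap\<close>, this gives both the specialisations of the gradient and, through
  \<open>polys_iff_zap\<close>, membership in k[x_0, ..., x_n].\<close>

lemma recip_hom:
  fixes h :: "'a::comm_ring_1 \<Rightarrow> 'b::comm_ring_1"
  assumes add: "\<And>a b. h (a + b) = h a + h b"
    and mult: "\<And>a b. h (a * b) = h a * h b" and one: "h 1 = 1"
  shows "h (recip y $ m) = recip (\<lambda>i. h (y i)) $ m"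
    and "h (recip_sq y $ m) = recip_sq (\<lambda>i. h (y i)) $ m"
proof -
  have h0: "h 0 = 0" using add[of 0 0] by simp
  have hm: "h (- a) = - h a" for a using add[of a "- a"] h0 by (simp add: eq_neg_iff_add_eq_0 add.commute)
  have hsum: "h (sum f A) = (\<Sum>x\<in>A. h (f x))" for f :: "nat \<Rightarrow> 'a" and A
    by (induction A rule: infinite_finite_induct) (simp_all add: h0 add)
  have hpow: "h (a ^ k) = h a ^ k" for a k
    by (induction k) (simp_all add: one mult)
  show *: "h (recip y $ m) = recip (\<lambda>i. h (y i)) $ m" for m
  proof (induction m rule: less_induct)
    case (less m)
    show ?case
    proof (cases "m = 0")
      case False
      then show ?thesis
        using less by (simp add: recip_rec hm hsum mult hpow)
    qed (simp add: one)
  qed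
  show "h (recip_sq y $ m) = recip_sq (\<lambda>i. h (y i)) $ m"
    by (simp add: recip_sq_def fps_mult_nth hsum mult *)
qed

subsection \<open>Syzygies\<close>

text \<open>The generators \<open>hb_gen y N p\<close> for \<open>p \<le> N\<close> are, up to units, the maximal minors of the
  Hilbert--Burch matrix with columns \<open>hb_mat y m\<close> for \<open>1 \<le> m \<le> N\<close>.  The coefficients
  \<open>euler_coeff\<close> come from the Euler relation $\sum_i (i - 1)\, y_i\, \partial f / \partial y_i = 0$,
  where $y_i$ has weight $i - 1$.\<close>

definition hb_gen :: "(nat \<Rightarrow> 'a::comm_ring_1) \<Rightarrow> nat \<Rightarrow> nat \<Rightarrow> 'a" where
  "hb_gen y N p = y 0 ^ (N - p) * recip_sq y $ p"

definition hb_mat :: "(nat \<Rightarrow> 'a::comm_ring_1) \<Rightarrow> nat \<Rightarrow> nat \<Rightarrow> 'a" where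
  "hb_mat y m p = (if p \<le> m then of_nat (2 * m - p) * y (m - p) else 0)"

definition last_gen :: "(nat \<Rightarrow> 'a::comm_ring_1) \<Rightarrow> nat \<Rightarrow> 'a" where
  "last_gen y n = (\<Sum>p<n-1. of_nat (n - 1 - p) * y (n - p) * y 0 ^ (n - 2 - p) * recip_sq y $ p)"

definition euler_coeff :: "(nat \<Rightarrow> 'a::comm_ring_1) \<Rightarrow> nat \<Rightarrow> nat \<Rightarrow> 'a" where
  "euler_coeff y n p = of_nat (n - 1 - p) * y (n - p)"

text \<open>With \<open>p = m - i\<close> the factor \<open>2 * m - p\<close> becomes
  \<open>m + i\<close>, and the summands are those of \<open>recip_sq_relation\<close> times
  \<open>y 0 ^ (N - m + 1)\<close>.\<close>

lemma hb_relation_le: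
  assumes "m \<le> N"
  shows "(\<Sum>p\<le>m. hb_mat y m p * hb_gen y N p) = 0"
proof -
  have "(\<Sum>p\<le>m. hb_mat y m p * hb_gen y N p)
      = (\<Sum>i=0..m. hb_mat y m (m - i) * hb_gen y N (m - i))"
    by (rule sum.reindex_bij_witness[of _ "\<lambda>i. m - i" "\<lambda>i. m - i"]) auto
  also have "\<dots> = (\<Sum>i=0..m. y 0 * y 0 ^ (N - m) * (of_nat (m + i) * (dehom y $ i * recip_sq y $ (m - i))))"
  proof (rule sum.cong)
    fix i assume i: "i \<in> {0..m}"
    then have "2 * m - (m - i) = m + i" "m - (m - i) = i" "N - (m - i) = (N - m) + i"
      using assms by auto
    then have eqs: "hb_mat y m (m - i) = of_nat (m + i) * y i"
      "hb_gen y N (m - i) = y 0 ^ ((N - m) + i) * recip_sq y $ (m - i)"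
      by (simp_all add: hb_mat_def hb_gen_def)
    have "y i * y 0 ^ ((N - m) + i) = y 0 * y 0 ^ (N - m) * dehom y $ i"
      by (cases i) (auto simp: dehom_nth power_add mult_ac)
    then have "of_nat (m + i) * (y i * y 0 ^ ((N - m) + i)) * recip_sq y $ (m - i)
        = of_nat (m + i) * (y 0 * y 0 ^ (N - m) * dehom y $ i) * recip_sq y $ (m - i)"
      by (simp only:)
    then show "hb_mat y m (m - i) * hb_gen y N (m - i)
        = y 0 * y 0 ^ (N - m) * (of_nat (m + i) * (dehom y $ i * recip_sq y $ (m - i)))"
      unfolding eqs by (simp only: mult_ac)
  qed simp
  also have "\<dots> = 0"
    unfolding sum_distrib_left[symmetric] recip_sq_relation by simp
  finally show ?thesis .
qed

lemma hb_relation: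
  assumes "m \<le> N"
  shows "(\<Sum>p\<le>N. hb_mat y m p * hb_gen y N p) = 0"
proof -
  have "(\<Sum>p\<le>N. hb_mat y m p * hb_gen y N p) = (\<Sum>p\<le>m. hb_mat y m p * hb_gen y N p)"
    using assms by (intro sum.mono_neutral_right) (auto simp: hb_mat_def)
  also have "\<dots> = 0"
    by (rule hb_relation_le[OF assms])
  finally show ?thesis .
qed

text \<open>Each summand of \<open>last_gen\<close> is a summand on the right with one factor
  \<open>y 0\<close> removed. The summand \<open>p = n - 1\<close>, which offers no such factor, has
  coefficient 0.\<close>

lemma euler_relation:
  assumes "n \<ge> 2"
  shows "y 0 * last_gen y n = (\<Sum>p<n. euler_coeff y n p * hb_gen y (n - 1) p)"
proof -
  have "{..<n} = insert (n - 1) {..<n-1}" using assms by auto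
  then have "(\<Sum>p<n. euler_coeff y n p * hb_gen y (n - 1) p)
      = (\<Sum>p<n-1. euler_coeff y n p * hb_gen y (n - 1) p)"
    by (simp add: euler_coeff_def)
  also have "\<dots> = (\<Sum>p<n-1. y 0 * (of_nat (n - 1 - p) * y (n - p) * y 0 ^ (n - 2 - p) * recip_sq y $ p))"
  proof (rule sum.cong)
    fix p assume p: "p \<in> {..<n-1}"
    then have "n - 1 - p = Suc (n - 2 - p)" by auto
    then have "y 0 ^ (n - 1 - p) = y 0 * y 0 ^ (n - 2 - p)" by simp
    then show "euler_coeff y n p * hb_gen y (n - 1) p
        = y 0 * (of_nat (n - 1 - p) * y (n - p) * y 0 ^ (n - 2 - p) * recip_sq y $ p)"
      unfolding euler_coeff_def hb_gen_def by (simp only: mult_ac)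
  qed simp
  finally show ?thesis
    by (simp add: last_gen_def sum_distrib_left)
qed

section \<open>Reduction modulo y_0 and exactness over an integral domain\<close>

text \<open>Modulo \<open>y 0\<close> the series \<open>dehom y\<close> is 1 + y_1 t, whose
  reciprocal is geometric.\<close>

lemma recip_mod_y0:
  "y 0 dvd recip y $ m - (- y 1) ^ m"
proof (induction m)
  case 0
  then show ?case by simp
next
  case (Suc m)
  define S where "S = (\<Sum>i=2..Suc m. y i * y 0 ^ (i - 1) * recip y $ (Suc m - i))"
  have "recip y $ Suc m = - (\<Sum>i=1..Suc m. y i * y 0 ^ (i - 1) * recip y $ (Suc m - i))"
    by (simp add: recip_rec)
  also have "(\<Sum>i=1..Suc m. y i * y 0 ^ (i - 1) * recip y $ (Suc m - i)) = y 1 * recip y $ m + S"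
    by (simp add: S_def sum.atLeast_Suc_atMost numeral_2_eq_2)
  finally have *: "recip y $ Suc m - (- y 1) ^ Suc m = - y 1 * (recip y $ m - (- y 1) ^ m) - S"
    by (simp add: algebra_simps)
  have "y 0 dvd S"
    unfolding S_def by (intro dvd_sum dvd_mult2 dvd_mult dvd_power) auto
  then show ?case
    unfolding * by (rule dvd_diff[OF dvd_mult[OF Suc]])
qed

lemma recip_sq_mod_y0:
  "y 0 dvd recip_sq y $ m - of_nat (Suc m) * (- y 1) ^ m"
proof -
  have "recip_sq y $ m - of_nat (Suc m) * (- y 1) ^ m
      = (\<Sum>i=0..m. recip y $ i * recip y $ (m - i) - (- y 1) ^ i * (- y 1) ^ (m - i))"
    by (simp add: recip_sq_def fps_mult_nth sum_subtractf flip: power_add)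
  also have "\<dots> = (\<Sum>i=0..m. (recip y $ i - (- y 1) ^ i) * recip y $ (m - i)
       + (- y 1) ^ i * (recip y $ (m - i) - (- y 1) ^ (m - i)))"
    by (intro sum.cong) (simp_all add: algebra_simps)
  finally show ?thesis
    by (simp only:) (intro dvd_sum dvd_add dvd_mult dvd_mult2 recip_mod_y0)
qed

text \<open>The properties of three distinct variables of a polynomial ring in characteristic zero
  that exactness rests on: \<open>y 0\<close> is prime, and (y_0, y_1) is prime and omits
  \<open>y 2\<close>. Nothing is asked of the later \<open>y i\<close>, which may be 0; this is what
  allows specialisation.\<close>

locale prime_start =
  fixes y :: "nat \<Rightarrow> 'a::idom"
  assumes unit: "k > 0 \<Longrightarrow> of_nat k dvd (1::'a)"
    and y0_nz: "y 0 \<noteq> 0"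
    and y0_prime: "y 0 dvd a * b \<Longrightarrow> y 0 dvd a \<or> y 0 dvd b"
    and y0_y1: "\<not> y 0 dvd y 1"
    and y01_prime: "\<exists>u v. a * b = y 0 * u + y 1 * v \<Longrightarrow>
          (\<exists>u v. a = y 0 * u + y 1 * v) \<or> (\<exists>u v. b = y 0 * u + y 1 * v)"
    and y2: "\<nexists>u v. y 2 = y 0 * u + y 1 * v"
begin


lemma obtain_inverse:
  assumes "k > 0" obtains u :: 'a where "of_nat k * u = 1"
  using unit[OF assms] by (metis dvdE)

lemma y0_dvd_power_mult: "y 0 dvd y 1 ^ k * b \<Longrightarrow> y 0 dvd b"
  by (induction k) (use y0_prime y0_y1 in \<open>auto simp: mult.assoc\<close>)

text \<open>Modulo \<open>y 0\<close> it is (m + 1) (- y_1)^m, a unit times a power of an element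
  that the prime \<open>y 0\<close> does not divide.\<close>

lemma not_y0_dvd_recip_sq: "\<not> y 0 dvd recip_sq y $ m"
proof
  assume "y 0 dvd recip_sq y $ m"
  then have "y 0 dvd recip_sq y $ m - (recip_sq y $ m - of_nat (Suc m) * (- y 1) ^ m)"
    using recip_sq_mod_y0 by (rule dvd_diff)
  then have "y 0 dvd of_nat (Suc m) * (- y 1) ^ m"
    by simp
  then have "y 0 dvd u * (of_nat (Suc m) * (- y 1) ^ m)" for u
    by (rule dvd_mult)
  moreover obtain u :: 'a where u: "of_nat (Suc m) * u = 1"
    using obtain_inverse[of "Suc m"] by auto
  have "u * (of_nat (Suc m) * (- y 1) ^ m) = (of_nat (Suc m) * u) * (- y 1) ^ m"
    by (simp only: mult_ac)
  then have "u * (of_nat (Suc m) * (- y 1) ^ m) = (- y 1) ^ m"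
    unfolding u by simp
  ultimately have "y 0 dvd (- y 1) ^ m"
    by metis
  then have "y 0 dvd y 1 ^ m * 1"
    by (cases "even m") auto
  then have "y 0 dvd 1"
    by (rule y0_dvd_power_mult)
  then have "y 0 dvd 1 * y 1"
    by (rule dvd_mult2)
  with y0_y1 show False by simp
qed

text \<open>From N to N + 1 the old generators acquire a factor \<open>y 0\<close>, while the new
  one is not divisible by it. So the last coefficient is a multiple of \<open>y 0\<close>, a
  multiple of the last column removes it, and \<open>y 0\<close> cancels from what remains.\<close>

lemma hb_exact:
  assumes "(\<Sum>p\<le>N. b p * hb_gen y N p) = 0"
  shows "\<exists>c. \<forall>p\<le>N. b p = (\<Sum>m=1..N. c m * hb_mat y m p)"
  using assms
proof (induction N arbitrary: b)
  case 0
  then show ?case by (simp add: hb_gen_def)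
next
  case (Suc N)
  let ?S = "Suc N"
  have gen: "hb_gen y ?S p = y 0 * hb_gen y N p" if "p \<le> N" for p
    using that by (simp add: hb_gen_def Suc_diff_le)
  have gens: "(\<Sum>p\<le>N. b p * hb_gen y ?S p) = y 0 * (\<Sum>p\<le>N. b p * hb_gen y N p)" for b
    unfolding sum_distrib_left by (intro sum.cong) (auto simp: gen)
  have "y 0 * (\<Sum>p\<le>N. b p * hb_gen y N p) + b ?S * recip_sq y $ ?S = 0"
    using Suc.prems by (simp add: gens) (simp add: hb_gen_def)
  then have "b ?S * recip_sq y $ ?S = y 0 * - (\<Sum>p\<le>N. b p * hb_gen y N p)"
    by (simp add: add_eq_0_iff)
  then have "y 0 dvd b ?S * recip_sq y $ ?S"
    by (rule dvdI)
  then have "y 0 dvd b ?S"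
    using y0_prime not_y0_dvd_recip_sq by blast
  then obtain c' where c': "b ?S = y 0 * c'" ..
  obtain u :: 'a where u: "of_nat ?S * u = 1"
    using obtain_inverse[of ?S] by auto
  \<comment> \<open>The new column has bottom entry \<open>of_nat (Suc N) * y 0\<close>;
    \<open>u\<close> inverts the integer.\<close>
  define c0 where "c0 = u * c'"
  define b' where "b' p = b p - c0 * hb_mat y ?S p" for p
  have "c0 * hb_mat y ?S ?S = (of_nat ?S * u) * (y 0 * c')"
    unfolding c0_def hb_mat_def by (simp add: mult_ac)
  then have b'S: "b' ?S = 0"
    unfolding b'_def u c' by simp
  have "(\<Sum>p\<le>?S. b' p * hb_gen y ?S p)
      = (\<Sum>p\<le>?S. b p * hb_gen y ?S p) - c0 * (\<Sum>p\<le>?S. hb_mat y ?S p * hb_gen y ?S p)"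
    unfolding sum_distrib_left sum_subtractf[symmetric]
    by (intro sum.cong) (auto simp: b'_def algebra_simps)
  then have "(\<Sum>p\<le>?S. b' p * hb_gen y ?S p) = 0"
    using Suc.prems hb_relation[of ?S ?S y] by simp
  then have "y 0 * (\<Sum>p\<le>N. b' p * hb_gen y N p) = 0"
    by (simp add: b'S gens)
  then have "(\<Sum>p\<le>N. b' p * hb_gen y N p) = 0"
    using y0_nz by simp
  from Suc.IH[OF this] obtain c where c: "\<forall>p\<le>N. b' p = (\<Sum>m=1..N. c m * hb_mat y m p)"
    by blast
  have "b p = (\<Sum>m=1..?S. (c(?S := c0)) m * hb_mat y m p)" if "p \<le> ?S" for p
  proof -
    have "b' p = (\<Sum>m=1..N. c m * hb_mat y m p)"
    proof (cases "p = ?S")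
      case True
      then have "(\<Sum>m=1..N. c m * hb_mat y m p) = 0"
        by (intro sum.neutral) (auto simp: hb_mat_def)
      then show ?thesis using True b'S by simp
    qed (use c that in auto)
    moreover have "b p = b' p + c0 * hb_mat y ?S p"
      by (simp add: b'_def)
    ultimately show ?thesis
      by (simp add: fun_upd_def)
  qed
  then show ?case by blast
qed

text \<open>The matrix is triangular with nonzero diagonal entries m y_0.\<close>

lemma hb_inj:
  assumes "\<forall>p\<le>N. (\<Sum>m=1..N. c m * hb_mat y m p) = 0" "1 \<le> m" "m \<le> N"
  shows "c m = 0"
  using assms
proof (induction N arbitrary: m)
  case 0
  then show ?case by simp
next
  case (Suc N)
  have low: "(\<Sum>m=1..N. c m * hb_mat y m (Suc N)) = 0"
    by (intro sum.neutral) (auto simp: hb_mat_def)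
  have "(\<Sum>m=1..Suc N. c m * hb_mat y m (Suc N)) = 0"
    using Suc.prems(1) by blast
  then have "c (Suc N) * hb_mat y (Suc N) (Suc N) = 0"
    using low by simp
  moreover have "hb_mat y (Suc N) (Suc N) \<noteq> 0"
  proof -
    obtain u :: 'a where "of_nat (Suc N) * u = 1"
      by (rule obtain_inverse[OF zero_less_Suc])
    then have "of_nat (Suc N) \<noteq> (0::'a)" by (metis mult_zero_left zero_neq_one)
    moreover have "hb_mat y (Suc N) (Suc N) = of_nat (Suc N) * y 0"
      by (simp add: hb_mat_def)
    ultimately show ?thesis using y0_nz by (metis mult_eq_0_iff)
  qed
  ultimately have c0: "c (Suc N) = 0" by simp
  have sums: "\<forall>p\<le>N. (\<Sum>m=1..N. c m * hb_mat y m p) = 0"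
  proof (intro allI impI)
    fix p assume "p \<le> N"
    then have "p \<le> Suc N" by simp
    with Suc.prems(1) have "(\<Sum>m=1..Suc N. c m * hb_mat y m p) = 0"
      by blast
    then show "(\<Sum>m=1..N. c m * hb_mat y m p) = 0"
      using c0 by simp
  qed
  show ?case
  proof (cases "m = Suc N")
    case False
    then have "m \<le> N" using Suc.prems(3) by simp
    then show ?thesis
      by (rule Suc.IH[OF sums Suc.prems(2)])
  qed (simp add: c0)
qed

text \<open>In the quotient by \<open>y 0\<close>, the class of \<open>y 1\<close> is prime and does
  not divide \<open>P\<close>, so a power of \<open>y 1\<close> dividing \<open>P * a\<close> can be
  cancelled out of \<open>a\<close> one factor at a time.\<close>

lemma y1_power_dvd:
  assumes "y 0 dvd P * a - y 1 ^ k * X" and P: "\<nexists>u v. P = y 0 * u + y 1 * v"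
  shows "\<exists>u v. a = y 0 * u + y 1 ^ k * v"
  using assms(1)
proof (induction k arbitrary: a)
  case 0
  have "a = y 0 * 0 + y 1 ^ 0 * a" by simp
  then show ?case by blast
next
  case (Suc k)
  from Suc.prems obtain w where w: "P * a - y 1 ^ Suc k * X = y 0 * w" ..
  have "P * a = y 0 * w + y 1 * (y 1 ^ k * X)"
    using w by (simp add: algebra_simps)
  then obtain u v where a: "a = y 0 * u + y 1 * v"
    using y01_prime[of P a] P by blast
  have "y 1 ^ 1 * (P * v - y 1 ^ k * X) = y 0 * (w - P * u)"
    using w by (simp add: a algebra_simps)
  then have "y 0 dvd y 1 ^ 1 * (P * v - y 1 ^ k * X)"
    by (rule dvdI)
  then have "y 0 dvd P * v - y 1 ^ k * X"
    by (rule y0_dvd_power_mult)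
  from Suc.IH[OF this] obtain u' v' where "v = y 0 * u' + y 1 ^ k * v'"
    by blast
  then have "a = y 0 * (u + y 1 * u') + y 1 ^ Suc k * v'"
    by (simp add: a algebra_simps)
  then show ?case by blast
qed

text \<open>Modulo \<open>y 0\<close> the system is triangular with multiples of \<open>y 1\<close> on the diagonal, so that
  \<open>c (n - s)\<close> is \<open>a\<close> times a fraction with denominator \<open>y 1 ^ s\<close>; its numerator is
  a nonzero multiple of \<open>y 2 ^ s\<close> modulo \<open>y 1\<close>.\<close>

lemma euler_system_numerator:
  assumes sys: "\<And>p. p < n - 1 \<Longrightarrow>
      y 0 dvd euler_coeff y n p * a - (\<Sum>m=p+1..n-1. c m * hb_mat y m p)"
    and "1 \<le> s" "s \<le> n - 1"
  shows "\<exists>P. (\<nexists>u v. P = y 0 * u + y 1 * v) \<and> y 0 dvd P * a - y 1 ^ s * c (n - s)"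
  using assms(2,3)
proof (induction s rule: less_induct)
  case (less s)
  then have "\<forall>r. \<exists>P. r \<in> {1..<s} \<longrightarrow> (\<nexists>u v. P = y 0 * u + y 1 * v) \<and> y 0 dvd P * a - y 1 ^ r * c (n - r)"
    by (metis atLeastLessThan_iff less_imp_le_nat order_trans)
  then obtain P where P: "\<And>r. r \<in> {1..<s} \<Longrightarrow> \<nexists>u v. P r = y 0 * u + y 1 * v"
      "\<And>r. r \<in> {1..<s} \<Longrightarrow> y 0 dvd P r * a - y 1 ^ r * c (n - r)"
    by metis
  have "n + 1 - s > 0" using less.prems by simp
  then obtain w :: 'a where w: "of_nat (n + 1 - s) * w = 1"
    by (rule obtain_inverse)
  \<comment> \<open>With columns renamed \<open>m = n - r\<close>, row \<open>p = n - s - 1\<close>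
    reads s y_(s+1) a = sum of \<open>k r * c (n - r)\<close> over r = 1, ..., s. Multiplying by
    \<open>y 1 ^ (s - 1)\<close> lets the earlier results replace \<open>y 1 ^ r * c (n - r)\<close>
    by \<open>P r * a\<close>. \<open>Q\<close> is the numerator so obtained, up to the integer n +
    1 - s in \<open>k s\<close>.\<close>
  define k where "k r = (of_nat (n + s + 1 - 2 * r) * y (s + 1 - r) :: 'a)" for r
  define Q where "Q = of_nat s * y (s + 1) * y 1 ^ (s - 1) - (\<Sum>r=1..<s. k r * y 1 ^ (s - 1 - r) * P r)"
  let ?p = "n - s - 1"
  have p: "?p < n - 1" using less.prems by simp
  have "(\<Sum>m=?p+1..n-1. c m * hb_mat y m ?p) = (\<Sum>r=1..s. k r * c (n - r))"
  proof (rule sum.reindex_bij_witness[of _ "\<lambda>r. n - r" "\<lambda>r. n - r"])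
    fix m assume m: "m \<in> {?p+1..n-1}"
    have "2 * m - ?p = n + s + 1 - 2 * (n - m)" "m - ?p = s + 1 - (n - m)"
      using m less.prems by auto
    then show "k (n - m) * c (n - (n - m)) = c m * hb_mat y m ?p"
      using m by (simp add: k_def hb_mat_def mult_ac)
  qed (use less.prems in auto)
  also have "{1..s} = insert s {1..<s}"
    using less.prems by auto
  also have "(\<Sum>r\<in>insert s {1..<s}. k r * c (n - r)) = of_nat (n + 1 - s) * y 1 * c (n - s) + (\<Sum>r=1..<s. k r * c (n - r))"
  proof -
    have "n + s + 1 - 2 * s = n + 1 - s" by simp
    then show ?thesis by (simp add: k_def)
  qed
  finally have sum_eq: "(\<Sum>m=?p+1..n-1. c m * hb_mat y m ?p)
      = of_nat (n + 1 - s) * y 1 * c (n - s) + (\<Sum>r=1..<s. k r * c (n - r))" .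
  have coeff: "euler_coeff y n ?p = of_nat s * y (s + 1)"
    using less.prems by (simp add: euler_coeff_def)
  define T where "T = (\<Sum>r=1..<s. k r * y 1 ^ (s - 1 - r) * (P r * a - y 1 ^ r * c (n - r)))"
  have T: "y 0 dvd T"
    unfolding T_def by (intro dvd_sum dvd_mult P(2))
  have T_eq: "T = (\<Sum>r=1..<s. k r * y 1 ^ (s - 1 - r) * P r) * a - y 1 ^ (s - 1) * (\<Sum>r=1..<s. k r * c (n - r))"
    unfolding T_def sum_distrib_left sum_distrib_right sum_subtractf[symmetric]
  proof (intro sum.cong refl)
    fix r assume "r \<in> {1..<s}"
    then have "s - 1 = (s - 1 - r) + r" by auto
    then have "y 1 ^ (s - 1) = y 1 ^ (s - 1 - r) * y 1 ^ r"
      by (metis power_add)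
    then show "k r * y 1 ^ (s - 1 - r) * (P r * a - y 1 ^ r * c (n - r))
        = k r * y 1 ^ (s - 1 - r) * P r * a - y 1 ^ (s - 1) * (k r * c (n - r))"
      by (simp only: algebra_simps)
  qed
  have ys: "y 1 ^ s = y 1 ^ (s - 1) * y 1"
    using less.prems by (cases s) auto
  have "y 0 dvd y 1 ^ (s - 1) * (of_nat s * y (s + 1) * a
      - (of_nat (n + 1 - s) * y 1 * c (n - s) + (\<Sum>r=1..<s. k r * c (n - r)))) - T"
    by (rule dvd_diff[OF dvd_mult[OF sys[OF p, unfolded sum_eq coeff]] T])
  also have "\<dots> = Q * a - of_nat (n + 1 - s) * (y 1 ^ s * c (n - s))"
    unfolding T_eq Q_def ys by (simp add: algebra_simps)
  finally have "y 0 dvd w * (Q * a - of_nat (n + 1 - s) * (y 1 ^ s * c (n - s)))"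
    by (rule dvd_mult)
  also have "\<dots> = (w * Q) * a - (of_nat (n + 1 - s) * w) * (y 1 ^ s * c (n - s))"
    by (simp only: algebra_simps)
  finally have "y 0 dvd (w * Q) * a - y 1 ^ s * c (n - s)"
    by (simp only: w mult_1_left)
  moreover have "\<nexists>u v. w * Q = y 0 * u + y 1 * v"
  proof
    assume "\<exists>u v. w * Q = y 0 * u + y 1 * v"
    then obtain u v where uv: "w * Q = y 0 * u + y 1 * v" by blast
    have "Q = of_nat (n + 1 - s) * w * Q" by (simp only: w mult_1_left)
    also have "\<dots> = y 0 * (of_nat (n + 1 - s) * u) + y 1 * (of_nat (n + 1 - s) * v)"
      by (simp only: mult.assoc uv) (simp only: algebra_simps)
    finally have Q: "Q = y 0 * (of_nat (n + 1 - s) * u) + y 1 * (of_nat (n + 1 - s) * v)" .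
    show False
    proof (cases "s = 1")
      case True
      then have "Q = y 2" by (simp add: Q_def numeral_2_eq_2)
      with Q y2 show False by metis
    next
      case False
      then have "s = Suc (Suc (s - 2))" using less.prems by simp
      then obtain t where t: "s = Suc (Suc t)" ..
      \<comment> \<open>Only the summand \<open>r = s - 1\<close> of \<open>Q\<close> lacks a factor
        \<open>y 1\<close>. Modulo \<open>y 1\<close> the numerator is therefore a unit times
        \<open>y 2 * P (s - 1)\<close>, and primality of (y_0, y_1) applies.\<close>
      define R where "R = of_nat s * y (s + 1) * y 1 ^ t - (\<Sum>r=1..<Suc t. k r * y 1 ^ (t - r) * P r)"
      have "(\<Sum>r=1..<s. k r * y 1 ^ (s - 1 - r) * P r)
          = (\<Sum>r=1..<Suc t. k r * y 1 ^ (s - 1 - r) * P r) + k (Suc t) * P (Suc t)"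
        by (simp add: t)
      also have "(\<Sum>r=1..<Suc t. k r * y 1 ^ (s - 1 - r) * P r)
          = y 1 * (\<Sum>r=1..<Suc t. k r * y 1 ^ (t - r) * P r)"
        unfolding sum_distrib_left by (intro sum.cong) (auto simp: t Suc_diff_le)
      finally have "Q = y 1 * R - k (Suc t) * P (Suc t)"
        by (simp add: Q_def R_def t algebra_simps)
      then have kP: "k (Suc t) * P (Suc t) = y 0 * - (of_nat (n + 1 - s) * u) + y 1 * (R - of_nat (n + 1 - s) * v)"
        using Q by (simp add: algebra_simps)
      have kt: "k (Suc t) = of_nat (n + 1 - t) * y 2"
        by (simp add: k_def t numeral_2_eq_2)
      have "n + 1 - t > 0" using less.prems t by simp
      then obtain x :: 'a where x: "of_nat (n + 1 - t) * x = 1"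
        by (rule obtain_inverse)
      have "y 2 * P (Suc t) = (of_nat (n + 1 - t) * x) * (y 2 * P (Suc t))"
        unfolding x by simp
      also have "\<dots> = x * (k (Suc t) * P (Suc t))"
        unfolding kt by (simp only: mult_ac)
      also have "\<dots> = y 0 * (x * - (of_nat (n + 1 - s) * u)) + y 1 * (x * (R - of_nat (n + 1 - s) * v))"
        unfolding kP by (simp only: distrib_left mult.left_commute)
      finally have "(\<exists>u v. y 2 = y 0 * u + y 1 * v) \<or> (\<exists>u v. P (Suc t) = y 0 * u + y 1 * v)"
        by (intro y01_prime) blast
      with y2 P(1)[of "Suc t"] t show False by auto
    qed
  qed
  ultimately show ?case by blast
qed

text \<open>This computes the colon ideal I : F. Multiplying the syzygy by \<open>y 0\<close> and
  inserting the Euler relation gives a syzygy of the \<open>hb_gen\<close> alone, hence columns with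
  coefficients \<open>c\<close>; modulo \<open>y 0\<close> these satisfy the triangular system of
  \<open>euler_system_numerator\<close>.\<close>

lemma last_coeff:
  assumes n: "n \<ge> 2"
    and syz: "a * last_gen y n + (\<Sum>p<n. b p * hb_gen y (n - 1) p) = 0"
  shows "\<exists>u v. a = u * y 0 + v * hb_gen y (n - 1) (n - 1)"
proof -
  have le: "{..n-1} = {..<n}" using n by auto
  define b' where "b' p = euler_coeff y n p * a + y 0 * b p" for p
  have "(\<Sum>p\<le>n-1. b' p * hb_gen y (n - 1) p)
      = a * (y 0 * last_gen y n) + y 0 * (\<Sum>p<n. b p * hb_gen y (n - 1) p)"
    unfolding euler_relation[OF n] sum_distrib_left sum.distrib[symmetric] le
    by (intro sum.cong) (simp_all add: b'_def algebra_simps)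
  also have "\<dots> = y 0 * (a * last_gen y n + (\<Sum>p<n. b p * hb_gen y (n - 1) p))"
    by (simp only: algebra_simps)
  finally have "(\<Sum>p\<le>n-1. b' p * hb_gen y (n - 1) p) = 0"
    unfolding syz by simp
  from hb_exact[OF this] obtain c where c: "\<And>p. p \<le> n - 1 \<Longrightarrow> b' p = (\<Sum>m=1..n-1. c m * hb_mat y m p)"
    by blast
  \<comment> \<open>Modulo \<open>y 0\<close>, row \<open>p\<close> sees only the columns
    \<open>m > p\<close>: columns \<open>m < p\<close> have entry 0 there, and column
    \<open>p\<close> has the entry p y_0.\<close>
  have sys: "y 0 dvd euler_coeff y n p * a - (\<Sum>m=p+1..n-1. c m * hb_mat y m p)" if "p < n - 1" for p
  proof -
    have "{1..n-1} = {1..p} \<union> {p+1..n-1}" using that by auto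
    then have "(\<Sum>m=1..n-1. c m * hb_mat y m p)
        = (\<Sum>m=1..p. c m * hb_mat y m p) + (\<Sum>m=p+1..n-1. c m * hb_mat y m p)"
      by (simp add: sum.union_disjoint)
    moreover have "b' p = (\<Sum>m=1..n-1. c m * hb_mat y m p)"
      using c that by simp
    ultimately have "euler_coeff y n p * a - (\<Sum>m=p+1..n-1. c m * hb_mat y m p)
        = (\<Sum>m=1..p. c m * hb_mat y m p) - y 0 * b p"
      by (simp add: b'_def algebra_simps)
    also have "y 0 dvd \<dots>"
      by (intro dvd_diff dvd_sum dvd_mult dvd_triv_left) (auto simp: hb_mat_def)
    finally show ?thesis .
  qed
  obtain P where P: "\<nexists>u v. P = y 0 * u + y 1 * v" "y 0 dvd P * a - y 1 ^ (n - 1) * c (n - (n - 1))"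
    using euler_system_numerator[OF sys, where s = "n - 1"] n by force
  from y1_power_dvd[OF P(2,1)] obtain u v where a: "a = y 0 * u + y 1 ^ (n - 1) * v"
    by blast
  \<comment> \<open>Modulo \<open>y 0\<close> the last generator is n (- y_1)^(n-1), so it generates
    with \<open>y 0\<close> the same ideal as y_1^(n-1) does.\<close>
  obtain w :: 'a where w: "of_nat (Suc (n - 1)) * w = 1"
    by (rule obtain_inverse[OF zero_less_Suc])
  obtain d where d: "recip_sq y $ (n - 1) - of_nat (Suc (n - 1)) * (- y 1) ^ (n - 1) = y 0 * d"
    using recip_sq_mod_y0[of y "n - 1"] by (elim dvdE)
  have "(- 1) ^ (n - 1) * w * recip_sq y $ (n - 1)
      = (- 1) ^ (n - 1) * w * (y 0 * d + of_nat (Suc (n - 1)) * (- y 1) ^ (n - 1))"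
    unfolding d[symmetric] by simp
  also have "\<dots> = y 0 * ((- 1) ^ (n - 1) * w * d) + (of_nat (Suc (n - 1)) * w) * ((- 1) ^ (n - 1) * (- y 1) ^ (n - 1))"
    by (simp only: algebra_simps)
  also have "\<dots> = y 0 * ((- 1) ^ (n - 1) * w * d) + y 1 ^ (n - 1)"
    unfolding w by (simp flip: power_mult_distrib)
  finally have y1: "y 1 ^ (n - 1)
      = (- 1) ^ (n - 1) * w * hb_gen y (n - 1) (n - 1) - y 0 * ((- 1) ^ (n - 1) * w * d)"
    by (simp add: algebra_simps hb_gen_def)
  have "a = (u - (- 1) ^ (n - 1) * w * d * v) * y 0 + ((- 1) ^ (n - 1) * w * v) * hb_gen y (n - 1) (n - 1)"
    unfolding a y1 by (simp only: algebra_simps)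
  then show ?thesis by blast
qed

text \<open>Removing \<open>u\<close> times the Euler relation and \<open>v\<close> times the Koszul
  relation between \<open>last_gen\<close> and the last \<open>hb_gen\<close> leaves a syzygy of the
  \<open>hb_gen\<close> alone, to which \<open>hb_exact\<close> applies.\<close>

lemma syzygies_exact:
  assumes n: "n \<ge> 2"
    and syz: "a * last_gen y n + (\<Sum>p<n. b p * hb_gen y (n - 1) p) = 0"
  shows "\<exists>c u v. a = u * y 0 + v * hb_gen y (n - 1) (n - 1) \<and>
    (\<forall>p<n. b p = (\<Sum>m=1..n-1. c m * hb_mat y m p) - u * euler_coeff y n p
        - (if p = n - 1 then v * last_gen y n else 0))"
proof -
  obtain u v where a: "a = u * y 0 + v * hb_gen y (n - 1) (n - 1)"
    using last_coeff[OF n syz] by blast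
  have le: "{..n-1} = {..<n}" using n by auto
  define b' where "b' p = b p + u * euler_coeff y n p + (if p = n - 1 then v * last_gen y n else 0)" for p
  have delta: "(\<Sum>p<n. (if p = n - 1 then v * last_gen y n else 0) * hb_gen y (n - 1) p)
      = v * last_gen y n * hb_gen y (n - 1) (n - 1)"
    using n by (subst sum.remove[of _ "n - 1"]) (auto intro!: sum.neutral)
  have "(\<Sum>p\<le>n-1. b' p * hb_gen y (n - 1) p)
      = (\<Sum>p<n. b p * hb_gen y (n - 1) p) + u * (\<Sum>p<n. euler_coeff y n p * hb_gen y (n - 1) p)
        + (\<Sum>p<n. (if p = n - 1 then v * last_gen y n else 0) * hb_gen y (n - 1) p)"
    unfolding sum_distrib_left sum.distrib[symmetric] le
    by (intro sum.cong) (simp_all add: b'_def algebra_simps)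
  also have "\<dots> = a * last_gen y n + (\<Sum>p<n. b p * hb_gen y (n - 1) p)"
    unfolding delta a euler_relation[OF n, symmetric] by (simp only: algebra_simps)
  finally have "(\<Sum>p\<le>n-1. b' p * hb_gen y (n - 1) p) = 0"
    unfolding syz .
  from hb_exact[OF this] obtain c where c: "\<And>p. p \<le> n - 1 \<Longrightarrow> b' p = (\<Sum>m=1..n-1. c m * hb_mat y m p)"
    by blast
  have "b p = (\<Sum>m=1..n-1. c m * hb_mat y m p) - u * euler_coeff y n p
      - (if p = n - 1 then v * last_gen y n else 0)" if "p < n" for p
  proof -
    have "b p = b' p - u * euler_coeff y n p - (if p = n - 1 then v * last_gen y n else 0)"
      by (simp add: b'_def)
    then show ?thesis
      using c[of p] that by simp
  qed
  with a show ?thesis by blast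
qed

end


subsection \<open>Polynomials\<close>

abbreviation "mcoeff \<equiv> Poly_Mapping.lookup"
abbreviation "msupp \<equiv> Poly_Mapping.keys"
abbreviation "mterm \<equiv> Poly_Mapping.single"

lemma mpol_induct [case_names zero single add]:
  fixes p :: "'a \<Rightarrow>\<^sub>0 'b::comm_monoid_add"
  assumes zero: "P 0" and single: "\<And>m a. P (mterm m a)" and add: "\<And>p q. P p \<Longrightarrow> P q \<Longrightarrow> P (p + q)"
  shows "P p"
proof (induction p rule: update_induct)
  case const
  then show ?case by (rule zero)
next
  case (update f a b)
  have "Poly_Mapping.update a b f = f + mterm a b"
    using update by (intro poly_mapping_eqI) (auto simp: lookup_update lookup_add lookup_single when_def in_keys_iff)
  then show ?case using update single add by simp
qed

text \<open>Reduces multiplicativity of \<open>zap\<close>, the Leibniz rule and the degree rule for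
  \<open>hcomp\<close> to single terms.\<close>

lemma mult_additive_ext:
  fixes f g :: "'k::field mpol \<Rightarrow> 'k mpol \<Rightarrow> 'k mpol"
  assumes f: "\<And>p p' q. f (p + p') q = f p q + f p' q" "\<And>p q q'. f p (q + q') = f p q + f p q'"
    and g: "\<And>p p' q. g (p + p') q = g p q + g p' q" "\<And>p q q'. g p (q + q') = g p q + g p q'"
    and eq: "\<And>m a m' a'. f (mterm m a) (mterm m' a') = g (mterm m a) (mterm m' a')"
  shows "f p q = g p q"
proof -
  have z: "f 0 q = 0" "f p 0 = 0" "g 0 q = 0" "g p 0 = 0" for p q
    using f(1)[of 0 0 q] f(2)[of p 0 0] g(1)[of 0 0 q] g(2)[of p 0 0]
    by (simp_all only: add_0_left add_cancel_right_right)
  have "f (mterm m a) q = g (mterm m a) q" for m a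
    by (induction q rule: mpol_induct) (simp_all add: z f g eq)
  then show ?thesis
    by (induction p rule: mpol_induct) (simp_all add: z f g)
qed

text \<open>The common form of setting variables to 0 (\<open>zap\<close>) and taking a homogeneous
  component (\<open>hcomp\<close>).\<close>

definition mask :: "((nat \<Rightarrow>\<^sub>0 nat) \<Rightarrow> bool) \<Rightarrow> 'k::field mpol \<Rightarrow> 'k mpol" where
  "mask Q = Poly_Mapping.mapp (\<lambda>m c. if Q m then c else 0)"

lemma lookup_mask: "mcoeff (mask Q p) m = (if Q m then mcoeff p m else 0)"
  by (auto simp: mask_def lookup_mapp when_def in_keys_iff)

lemma keys_mask: "msupp (mask Q p) = {m \<in> msupp p. Q m}"
  by (auto simp: in_keys_iff lookup_mask split: if_splits)

lemma mask_add: "mask Q (p + q) = mask Q p + mask Q q"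
  by (rule poly_mapping_eqI) (simp add: lookup_mask lookup_add)

lemma mask_zero [simp]: "mask Q 0 = 0"
  by (rule poly_mapping_eqI) (simp add: lookup_mask)

lemma mask_sum: "mask Q (sum f A) = (\<Sum>x\<in>A. mask Q (f x))"
  by (induction A rule: infinite_finite_induct) (simp_all add: mask_add)

lemma mask_single: "mask Q (mterm m a) = (if Q m then mterm m a else 0)"
  by (rule poly_mapping_eqI) (auto simp: lookup_mask lookup_single when_def)

text \<open>The substitution of 0 for the variables with index in \<open>S\<close>.\<close>

definition zap :: "nat set \<Rightarrow> 'k::field mpol \<Rightarrow> 'k mpol" where
  "zap S = mask (\<lambda>m. msupp m \<inter> S = {})"

lemma lookup_zap: "mcoeff (zap S p) m = (if msupp m \<inter> S = {} then mcoeff p m else 0)"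
  by (simp add: zap_def lookup_mask)

lemma keys_zap: "msupp (zap S p) = {m \<in> msupp p. msupp m \<inter> S = {}}"
  by (simp add: zap_def keys_mask)

lemma zap_add: "zap S (p + q) = zap S p + zap S q"
  by (simp add: zap_def mask_add)

lemma zap_zero [simp]: "zap S 0 = 0"
  by (simp add: zap_def)

lemma zap_uminus: "zap S (- p) = - zap S p"
  using zap_add[of S p "- p"] by (simp add: eq_neg_iff_add_eq_0 add.commute)

lemma zap_diff: "zap S (p - q) = zap S p - zap S q"
  using zap_add[of S p "- q"] by (simp add: zap_uminus)

lemma zap_sum: "zap S (sum f A) = (\<Sum>x\<in>A. zap S (f x))"
  by (simp add: zap_def mask_sum)

lemma keys_add_nat: "msupp (a + b :: nat \<Rightarrow>\<^sub>0 nat) = msupp a \<union> msupp b"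
  by (auto simp: in_keys_iff lookup_add)

lemma zap_mult: "zap S (p * q) = zap S p * zap S q"
proof (rule mult_additive_ext[of "\<lambda>p q. zap S (p * q)"])
  show "zap S (mterm m a * mterm m' a') = zap S (mterm m a) * zap S (mterm m' a')" for m m' a a'
    by (auto simp: zap_def mult_single mask_single keys_add_nat)
qed (simp_all add: zap_add algebra_simps)

lemma zap_one [simp]: "zap S 1 = 1"
  by (rule poly_mapping_eqI) (auto simp: lookup_zap lookup_one when_def)

lemma zap_power: "zap S (p ^ k) = zap S p ^ k"
  by (induction k) (simp_all add: zap_mult)

lemma zap_of_nat [simp]: "zap S (of_nat k) = of_nat k"
  by (induction k) (simp_all add: zap_add)

lemma zap_zap: "zap S (zap T p) = zap (S \<union> T) p"
  by (rule poly_mapping_eqI) (auto simp: lookup_zap)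

lemma zap_mvar: "zap S (mvar i) = (if i \<in> S then 0 else mvar i)"
  by (simp add: mvar_def zap_def mask_single)

lemma mvar_nz [simp]: "mvar i \<noteq> (0 :: 'k::field mpol)"
  by (metis lookup_single_eq lookup_zero mvar_def zero_neq_one)

text \<open>Divisibility becomes vanishing under a ring endomorphism of a domain, so primality of a
  variable, and likewise of a pair of variables below, follows from \<open>zap_mult\<close>.\<close>

lemma mvar_dvd_iff: "(mvar i :: 'k::field mpol) dvd p \<longleftrightarrow> zap {i} p = 0"
proof
  assume "mvar i dvd p"
  then show "zap {i} p = 0"
    by (elim dvdE) (simp add: zap_mult zap_mvar)
next
  assume z: "zap {i} p = 0"
  have i: "i \<in> msupp m" if "m \<in> msupp p" for m
    using z that keys_zap[of "{i}" p] by auto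
  have "mvar i dvd mterm m (mcoeff p m)" if "m \<in> msupp p" for m
  proof -
    have "m = Poly_Mapping.single i 1 + (m - Poly_Mapping.single i 1)"
      using i[OF that] by (intro poly_mapping_eqI)
        (auto simp: lookup_add lookup_minus lookup_single when_def in_keys_iff)
    then have "mterm m (mcoeff p m) = mvar i * mterm (m - Poly_Mapping.single i 1) (mcoeff p m)"
      by (simp add: mvar_def mult_single)
    then show ?thesis by simp
  qed
  then have "mvar i dvd (\<Sum>m\<in>msupp p. mterm m (mcoeff p m))"
    by (rule dvd_sum)
  also have "(\<Sum>m\<in>msupp p. mterm m (mcoeff p m)) = p"
    by (rule poly_mapping_eqI) (simp add: lookup_sum lookup_single when_def in_keys_iff)
  finally show "mvar i dvd p" .
qed

lemma mvar_pair_iff: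
  "(\<exists>u v. p = (mvar i :: 'k::field mpol) * u + mvar j * v) \<longleftrightarrow> zap {i, j} p = 0"
proof
  assume "zap {i, j} p = 0"
  then have "zap {j} (zap {i} p) = 0" "zap {i} (p - zap {i} p) = 0"
    by (simp_all add: zap_zap zap_diff insert_commute)
  then have "mvar j dvd zap {i} p" "mvar i dvd p - zap {i} p"
    by (simp_all add: mvar_dvd_iff)
  then obtain v u where "zap {i} p = mvar j * v" "p - zap {i} p = mvar i * u"
    by (elim dvdE)
  then have "p = mvar i * u + mvar j * v" by (metis diff_add_cancel)
  then show "\<exists>u v. p = mvar i * u + mvar j * v" by blast
qed (auto simp: zap_add zap_mult zap_mvar)

subsection \<open>Derivations and degrees\<close>

lemma partial_deriv_superset:
  assumes "finite A" "msupp p \<subseteq> A"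
  shows "partial_deriv i p = (\<Sum>m\<in>A. mterm (m - mterm i 1) (of_nat (mcoeff m i) * mcoeff p m))"
  unfolding partial_deriv_def using assms
  by (intro sum.mono_neutral_left) (auto simp: in_keys_iff)

lemma partial_deriv_add: "partial_deriv i (p + q) = partial_deriv i p + partial_deriv i q"
proof -
  let ?A = "msupp p \<union> msupp q"
  have "msupp (p + q) \<subseteq> ?A" by (rule Poly_Mapping.keys_add)
  then show ?thesis
    by (simp add: partial_deriv_superset[of ?A] sum.distrib[symmetric] lookup_add distrib_left single_add)
qed

lemma partial_deriv_single: "partial_deriv i (mterm m a) = mterm (m - mterm i 1) (of_nat (mcoeff m i) * a)"
  by (cases "a = 0") (simp_all add: partial_deriv_def)

lemma partial_deriv_mult: "partial_deriv i (p * q) = partial_deriv i p * q + p * partial_deriv i q"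
proof (rule mult_additive_ext[of "\<lambda>p q. partial_deriv i (p * q)"
      "\<lambda>p q. partial_deriv i p * q + p * partial_deriv i q"])
  fix m m' :: "nat \<Rightarrow>\<^sub>0 nat" and a a' :: 'a
  \<comment> \<open>Subtraction of exponents is truncated. If \<open>mcoeff m i = 0\<close> the
    exponents may differ, but the coefficient of both terms is then 0.\<close>
  have shift: "mterm ((m + m') - mterm i 1) (of_nat (mcoeff m i) * b) = mterm ((m - mterm i 1) + m') (of_nat (mcoeff m i) * b)"
    for m m' :: "nat \<Rightarrow>\<^sub>0 nat" and b :: 'a
  proof (cases "mcoeff m i = 0")
    case False
    then have "(m + m') - mterm i 1 = (m - mterm i 1) + m'"
      by (intro poly_mapping_eqI) (auto simp: lookup_minus lookup_add lookup_single when_def)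
    then show ?thesis by simp
  qed simp
  have "partial_deriv i (mterm m a * mterm m' a')
      = mterm ((m + m') - mterm i 1) (of_nat (mcoeff m i) * (a * a'))
        + mterm ((m' + m) - mterm i 1) (of_nat (mcoeff m' i) * (a * a'))"
    by (simp add: mult_single partial_deriv_single lookup_add distrib_right single_add add.commute)
  then show "partial_deriv i (mterm m a * mterm m' a')
      = partial_deriv i (mterm m a) * mterm m' a' + mterm m a * partial_deriv i (mterm m' a')"
    unfolding shift by (simp add: partial_deriv_single mult_single mult_ac add_ac)
qed (simp_all add: partial_deriv_add algebra_simps)

lemma partial_deriv_mvar: "partial_deriv i (mvar j) = (if i = j then 1 else 0)"
  by (simp add: mvar_def partial_deriv_single lookup_single when_def)

lemma partial_deriv_zero: "partial_deriv i 0 = 0"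
  by (simp add: partial_deriv_def)

lemma partial_deriv_one: "partial_deriv i 1 = 0"
  using partial_deriv_mult[of i 1 1] by (simp only: mult_1_left mult_1_right add_cancel_right_right)

lemma partial_deriv_mvar_power:
  "partial_deriv i (mvar j ^ k) = (if i = j then of_nat k * mvar j ^ (k - 1) else 0)"
proof (induction k)
  case (Suc k)
  then show ?case
    by (cases k) (auto simp: partial_deriv_mult partial_deriv_mvar partial_deriv_one algebra_simps)
qed (simp add: partial_deriv_one)

lemma mon_deg_superset:
  "finite A \<Longrightarrow> msupp m \<subseteq> A \<Longrightarrow> mon_deg m = (\<Sum>i\<in>A. mcoeff m i)"
  unfolding mon_deg_def by (intro sum.mono_neutral_left) (auto simp: in_keys_iff)

lemma mon_deg_add: "mon_deg (a + b) = mon_deg a + mon_deg b"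
  by (simp add: mon_deg_superset[of "msupp a \<union> msupp b"] keys_add_nat lookup_add sum.distrib)

lemma homogeneous_zero [simp]: "homogeneous d 0"
  by (simp add: homogeneous_def)

lemma homogeneous_one: "homogeneous 0 1"
  by (simp add: homogeneous_def mon_deg_def)

lemma homogeneous_single: "int (mon_deg m) = d \<Longrightarrow> homogeneous d (mterm m a)"
  by (cases "a = 0") (simp_all add: homogeneous_def)

lemma homogeneous_mvar: "homogeneous 1 (mvar i)"
  unfolding mvar_def by (rule homogeneous_single) (simp add: mon_deg_def)

lemma homogeneous_add: "homogeneous d p \<Longrightarrow> homogeneous d q \<Longrightarrow> homogeneous d (p + q)"
  using Poly_Mapping.keys_add[of p q] by (auto simp: homogeneous_def)

lemma homogeneous_uminus: "homogeneous d p \<Longrightarrow> homogeneous d (- p)"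
  by (simp add: homogeneous_def in_keys_iff)

lemma homogeneous_sum: "(\<And>x. x \<in> A \<Longrightarrow> homogeneous d (f x)) \<Longrightarrow> homogeneous d (sum f A)"
  by (induction A rule: infinite_finite_induct) (auto intro: homogeneous_add)

lemma homogeneous_mult: "homogeneous d p \<Longrightarrow> homogeneous e q \<Longrightarrow> homogeneous (d + e) (p * q)"
  using Poly_Mapping.keys_mult[of p q] by (force simp: homogeneous_def mon_deg_add)

lemma homogeneous_power: "homogeneous d p \<Longrightarrow> homogeneous (int k * d) (p ^ k)"
proof (induction k)
  case (Suc k)
  then have "homogeneous (d + int k * d) (p * p ^ k)" by (intro homogeneous_mult)
  then show ?case by (simp add: algebra_simps)
qed (simp add: homogeneous_one)

lemma of_nat_conv_single: "(of_nat k :: 'k::field mpol) = mterm 0 (of_nat k)"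
  by (simp add: single_of_nat)

lemma homogeneous_of_nat: "homogeneous 0 (of_nat k)"
  unfolding of_nat_conv_single by (rule homogeneous_single) (simp add: mon_deg_def)

definition hcomp :: "int \<Rightarrow> 'k::field mpol \<Rightarrow> 'k mpol" where
  "hcomp d = mask (\<lambda>m. int (mon_deg m) = d)"

lemma homogeneous_hcomp: "homogeneous d (hcomp d p)"
  by (simp add: homogeneous_def hcomp_def keys_mask)

lemma hcomp_id: "homogeneous d p \<Longrightarrow> hcomp d p = p"
  by (rule poly_mapping_eqI) (auto simp: hcomp_def lookup_mask homogeneous_def in_keys_iff)

lemma hcomp_add: "hcomp d (p + q) = hcomp d p + hcomp d q"
  by (simp add: hcomp_def mask_add)

lemma hcomp_sum: "hcomp d (sum f A) = (\<Sum>x\<in>A. hcomp d (f x))"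
  by (simp add: hcomp_def mask_sum)

text \<open>Extracts homogeneous coefficients from combinations of homogeneous elements. Degrees are
  integers, so \<open>d - e\<close> may be negative, and then the component is 0.\<close>

lemma hcomp_mult:
  assumes "homogeneous e q"
  shows "hcomp d (p * q) = hcomp (d - e) p * q"
proof -
  have "hcomp d (p * hcomp e q) = hcomp (d - e) p * hcomp e q"
  proof (rule mult_additive_ext[of "\<lambda>p q. hcomp d (p * hcomp e q)" "\<lambda>p q. hcomp (d - e) p * hcomp e q"])
    show "hcomp d (mterm m a * hcomp e (mterm m' a')) = hcomp (d - e) (mterm m a) * hcomp e (mterm m' a')"
      for m m' a a'
      by (auto simp: hcomp_def mask_single mult_single mon_deg_add)
  qed (simp_all add: hcomp_add algebra_simps)
  then show ?thesis by (simp add: hcomp_id[OF assms])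
qed


subsection \<open>The ring in finitely many variables and its ideals\<close>

abbreviation "polys n \<equiv> carrier (mpoly_ring n)"

lemma mpoly_ring_simps [simp]:
  "p \<oplus>\<^bsub>mpoly_ring n\<^esub> q = p + q" "p \<otimes>\<^bsub>mpoly_ring n\<^esub> q = p * q"
  "\<one>\<^bsub>mpoly_ring n\<^esub> = 1" "\<zero>\<^bsub>mpoly_ring n\<^esub> = 0"
  by (simp_all add: mpoly_ring_def)

lemma polys_iff: "p \<in> polys n \<longleftrightarrow> (\<forall>m\<in>msupp p. msupp m \<subseteq> {..n})"
  by (simp add: mpoly_ring_def)

text \<open>Membership as being fixed by a ring endomorphism makes all closure properties formal,
  and the same retraction pulls coefficients with surplus variables back into the ring.\<close>

lemma polys_iff_zap: "p \<in> polys n \<longleftrightarrow> zap {n<..} p = p"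
proof
  assume p: "p \<in> polys n"
  have *: "msupp m \<inter> {n<..} = {}" if "m \<in> msupp p" for m
  proof -
    have "msupp m \<subseteq> {..n}" using p that by (simp add: polys_iff)
    then show ?thesis by auto
  qed
  show "zap {n<..} p = p"
  proof (rule poly_mapping_eqI)
    fix m
    show "mcoeff (zap {n<..} p) m = mcoeff p m"
      by (cases "m \<in> msupp p") (simp_all add: lookup_zap *, simp add: in_keys_iff)
  qed
next
  assume *: "zap {n<..} p = p"
  have "msupp m \<subseteq> {..n}" if "m \<in> msupp p" for m
  proof -
    from that have "m \<in> msupp (zap {n<..} p)" by (simp only: *)
    then have "msupp m \<inter> {n<..} = {}" by (simp add: keys_zap)
    then show ?thesis by fastforce
  qed
  then show "p \<in> polys n"
    by (simp add: polys_iff)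
qed

lemma polys_closed [simp, intro]:
  "0 \<in> polys n" "1 \<in> polys n" "of_nat k \<in> polys n"
  "p \<in> polys n \<Longrightarrow> - p \<in> polys n"
  "p \<in> polys n \<Longrightarrow> q \<in> polys n \<Longrightarrow> p + q \<in> polys n"
  "p \<in> polys n \<Longrightarrow> q \<in> polys n \<Longrightarrow> p - q \<in> polys n"
  "p \<in> polys n \<Longrightarrow> q \<in> polys n \<Longrightarrow> p * q \<in> polys n"
  "p \<in> polys n \<Longrightarrow> p ^ k \<in> polys n"
  by (simp_all add: polys_iff_zap zap_add zap_mult zap_diff zap_uminus zap_power)

lemma polys_sum: "(\<And>x. x \<in> A \<Longrightarrow> f x \<in> polys n) \<Longrightarrow> sum f A \<in> polys n"
  by (induction A rule: infinite_finite_induct) auto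

lemma polys_mvar [simp, intro]: "i \<le> n \<Longrightarrow> mvar i \<in> polys n"
  by (simp add: polys_iff_zap zap_mvar)

lemma polys_const [simp, intro]: "(mterm 0 a :: 'k::field mpol) \<in> polys n"
  by (cases "a = 0") (simp_all add: polys_iff)

lemma polys_zap [simp, intro]: "p \<in> polys n \<Longrightarrow> zap S p \<in> polys n"
  by (auto simp: polys_iff keys_zap)

lemma polys_retract: "zap {n<..} p \<in> polys n"
  by (simp add: polys_iff_zap zap_zap)

lemma polys_hcomp [simp, intro]: "p \<in> polys n \<Longrightarrow> hcomp d p \<in> polys n"
  by (auto simp: polys_iff hcomp_def keys_mask)

interpretation mpoly_ring: cring "mpoly_ring n :: 'k::field mpol ring" for n
  by (rule cring_mpoly_ring)

lemma ideal_mpoly_ringI: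
  assumes "I \<subseteq> polys n" "0 \<in> I" "\<And>a b. a \<in> I \<Longrightarrow> b \<in> I \<Longrightarrow> a + b \<in> I"
    and "\<And>c a. c \<in> polys n \<Longrightarrow> a \<in> I \<Longrightarrow> c * a \<in> I"
  shows "ideal I (mpoly_ring n :: 'k::field mpol ring)"
proof (rule idealI)
  show "subgroup I (add_monoid (mpoly_ring n))"
  proof (rule mpoly_ring.add.subgroupI)
    fix a assume a: "a \<in> I"
    have "\<ominus>\<^bsub>mpoly_ring n\<^esub> a = - a"
      by (rule mpoly_ring.minus_equality) (use a assms(1) in auto)
    moreover have "(- 1) * a \<in> I" by (rule assms(4)) (use a in auto)
    ultimately show "\<ominus>\<^bsub>mpoly_ring n\<^esub> a \<in> I" by simp
  qed (use assms in auto)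
  show "a \<in> I \<Longrightarrow> x \<in> polys n \<Longrightarrow> x \<otimes>\<^bsub>mpoly_ring n\<^esub> a \<in> I" for a x
    using assms(4) by simp
  show "a \<in> I \<Longrightarrow> x \<in> polys n \<Longrightarrow> a \<otimes>\<^bsub>mpoly_ring n\<^esub> x \<in> I" for a x
    using assms(4)[of x a] by (simp add: mult.commute)
qed (rule mpoly_ring.ring_axioms)

context
  fixes I :: "'k::field mpol set" and n
  assumes I: "ideal I (mpoly_ring n)"
begin

interpretation I: ideal I "mpoly_ring n" by (rule I)

lemma mpoly_ideal_subset: "I \<subseteq> polys n"
  by (rule I.a_subset)

lemma mpoly_ideal_zero: "0 \<in> I"
  using I.zero_closed by simp

lemma mpoly_ideal_add: "a \<in> I \<Longrightarrow> b \<in> I \<Longrightarrow> a + b \<in> I"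
  using I.a_closed by simp

lemma mpoly_ideal_mult: "a \<in> I \<Longrightarrow> c \<in> polys n \<Longrightarrow> c * a \<in> I"
  using I.I_l_closed by simp

lemma mpoly_ideal_uminus: "a \<in> I \<Longrightarrow> - a \<in> I"
  using mpoly_ideal_mult[of a "- 1"] by simp

lemma mpoly_ideal_diff: "a \<in> I \<Longrightarrow> b \<in> I \<Longrightarrow> a - b \<in> I"
  using mpoly_ideal_add[of a "- b"] mpoly_ideal_uminus by simp

lemma mpoly_ideal_sum: "(\<And>x. x \<in> A \<Longrightarrow> f x \<in> I) \<Longrightarrow> sum f A \<in> I"
  by (induction A rule: infinite_finite_induct) (auto intro: mpoly_ideal_add mpoly_ideal_zero)

lemma mpoly_ideal_eq_carrier_iff: "I = polys n \<longleftrightarrow> 1 \<in> I"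
  using I.one_imp_carrier by auto

lemma mpoly_ideal_by_monomials:
  assumes p: "p \<in> polys n" and i: "\<And>m. m \<in> msupp p \<Longrightarrow> \<exists>i\<in>msupp m. mvar i \<in> I"
  shows "p \<in> I"
proof -
  have "mterm m (mcoeff p m) \<in> I" if m: "m \<in> msupp p" for m
  proof -
    obtain i where i: "i \<in> msupp m" "mvar i \<in> I" using i m by blast
    define m' where "m' = m - Poly_Mapping.single i 1"
    have m': "m = m' + Poly_Mapping.single i 1"
      using i unfolding m'_def by (intro poly_mapping_eqI)
        (auto simp: lookup_add lookup_minus lookup_single when_def in_keys_iff)
    have eq: "mterm m (mcoeff p m) = mterm m' (mcoeff p m) * mvar i"
      by (simp add: mvar_def mult_single m')
    have "msupp m' \<subseteq> msupp m"
      by (simp add: m' keys_add_nat) auto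
    also have "msupp m \<subseteq> {..n}"
      using p m by (simp add: polys_iff)
    finally have "mterm m' (mcoeff p m) \<in> polys n"
      by (cases "mcoeff p m = 0") (simp_all add: polys_iff)
    then show ?thesis
      unfolding eq by (rule mpoly_ideal_mult[OF i(2)])
  qed
  then have "(\<Sum>m\<in>msupp p. mterm m (mcoeff p m)) \<in> I"
    by (rule mpoly_ideal_sum)
  also have "(\<Sum>m\<in>msupp p. mterm m (mcoeff p m)) = p"
    by (rule poly_mapping_eqI) (simp add: lookup_sum lookup_single when_def in_keys_iff)
  finally show ?thesis .
qed

lemma diff_zap_in_ideal:
  assumes "p \<in> polys n" "\<And>i. i \<in> S \<Longrightarrow> mvar i \<in> I"
  shows "p - zap S p \<in> I"
proof (rule mpoly_ideal_by_monomials)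
  fix m assume "m \<in> msupp (p - zap S p)"
  then have "msupp m \<inter> S \<noteq> {}"
    by (auto simp: in_keys_iff lookup_minus lookup_zap)
  then show "\<exists>i\<in>msupp m. mvar i \<in> I"
    using assms(2) by blast
qed (use assms in auto)

end

lemma ideal_genideal: "X \<subseteq> polys n \<Longrightarrow> ideal (genideal (mpoly_ring n) X) (mpoly_ring n)"
  by (rule mpoly_ring.genideal_ideal)

lemma genideal_least: "ideal I (mpoly_ring n) \<Longrightarrow> X \<subseteq> I \<Longrightarrow> genideal (mpoly_ring n) X \<subseteq> I"
  by (rule mpoly_ring.genideal_minimal)

lemma genideal_incl: "X \<subseteq> polys n \<Longrightarrow> X \<subseteq> genideal (mpoly_ring n) X"
  by (rule mpoly_ring.genideal_self)

definition combos :: "nat \<Rightarrow> nat \<Rightarrow> (nat \<Rightarrow> 'k::field mpol) \<Rightarrow> 'k mpol set" where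
  "combos n k g = {\<Sum>p<k. r p * g p | r. \<forall>p. r p \<in> polys n}"

lemma combosI: "(\<And>p. p < k \<Longrightarrow> r p \<in> polys n) \<Longrightarrow> (\<Sum>p<k. r p * g p) \<in> combos n k g"
  unfolding combos_def
  by (intro CollectI exI[of _ "\<lambda>p. if p < k then r p else 0"] conjI sum.cong) auto

lemma combosE:
  assumes "b \<in> combos n k g"
  obtains r where "b = (\<Sum>p<k. r p * g p)" "\<forall>p. r p \<in> polys n"
  using assms by (auto simp: combos_def)

lemma combos_gen: "p < k \<Longrightarrow> g p \<in> combos n k g"
proof -
  assume p: "p < k"
  have "(\<Sum>q<k. (if q = p then 1 else 0) * g q) \<in> combos n k g"
    by (rule combosI) auto
  also have "(\<Sum>q<k. (if q = p then 1 else 0) * g q) = g p"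
    using p by (subst sum.remove[of _ p]) (auto intro!: sum.neutral)
  finally show ?thesis .
qed

lemma ideal_combos:
  fixes g :: "nat \<Rightarrow> 'k::field mpol"
  assumes "\<And>p. p < k \<Longrightarrow> g p \<in> polys n"
  shows "ideal (combos n k g) (mpoly_ring n)"
proof (rule ideal_mpoly_ringI)
  show "combos n k g \<subseteq> polys n"
    using assms by (auto elim!: combosE intro!: polys_sum polys_closed(7))
  show "0 \<in> combos n k g"
    using combosI[of k "\<lambda>_. 0" n g] by simp
next
  fix a b assume a: "a \<in> combos n k g" and b: "b \<in> combos n k g"
  obtain r where r: "a = (\<Sum>p<k. r p * g p)" "\<forall>p. r p \<in> polys n"
    using combosE[OF a] .
  obtain s where s: "b = (\<Sum>p<k. s p * g p)" "\<forall>p. s p \<in> polys n"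
    using combosE[OF b] .
  have "a + b = (\<Sum>p<k. (r p + s p) * g p)"
    unfolding r s by (simp add: distrib_right sum.distrib)
  also have "\<dots> \<in> combos n k g"
    by (rule combosI) (simp add: r s)
  finally show "a + b \<in> combos n k g" .
next
  fix c a :: "'k mpol" assume c: "c \<in> polys n" and a: "a \<in> combos n k g"
  obtain r where r: "a = (\<Sum>p<k. r p * g p)" "\<forall>p. r p \<in> polys n"
    using combosE[OF a] .
  have "c * a = (\<Sum>p<k. (c * r p) * g p)"
    unfolding r by (simp add: sum_distrib_left mult.assoc)
  also have "\<dots> \<in> combos n k g"
    by (rule combosI) (simp add: r c)
  finally show "c * a \<in> combos n k g" .
qed

lemma combos_least:
  assumes "ideal I (mpoly_ring n)" "\<And>p. p < k \<Longrightarrow> g p \<in> I"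
  shows "combos n k g \<subseteq> I"
  using assms(2)
  by (auto elim!: combosE intro!: mpoly_ideal_sum[OF assms(1)] mpoly_ideal_mult[OF assms(1)])

text \<open>The factor \<open>t\<close> absorbs the sign between the partial derivatives of the
  determinant and \<open>grad_gen\<close>.\<close>

lemma genideal_eq_combos:
  assumes g: "\<And>p. p < k \<Longrightarrow> g p \<in> polys n" and t: "t \<in> polys n" "t * t = 1"
    and h: "\<And>p. p < k \<Longrightarrow> h p = t * g p"
  shows "genideal (mpoly_ring n) (h ` {..<k}) = combos n k g"
proof
  have sub: "h ` {..<k} \<subseteq> polys n" using g t h by auto
  show "genideal (mpoly_ring n) (h ` {..<k}) \<subseteq> combos n k g"
    using mpoly_ideal_mult[OF ideal_combos[of k g n]] g t h
    by (intro genideal_least ideal_combos) (auto intro: combos_gen)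
  show "combos n k g \<subseteq> genideal (mpoly_ring n) (h ` {..<k})"
  proof
    fix b assume b: "b \<in> combos n k g"
    obtain r where r: "b = (\<Sum>p<k. r p * g p)" "\<forall>p. r p \<in> polys n"
      using combosE[OF b] .
    have "r p * g p \<in> genideal (mpoly_ring n) (h ` {..<k})" if "p < k" for p
    proof -
      have "r p * g p = r p * (t * t) * g p" by (simp only: t mult_1_right)
      also have "\<dots> = (r p * t) * h p" using h[OF that] by (simp add: mult_ac)
      finally have eq: "r p * g p = (r p * t) * h p" .
      show ?thesis
        unfolding eq using genideal_incl[OF sub] r t that
        by (intro mpoly_ideal_mult[OF ideal_genideal[OF sub]]) auto
    qed
    then show "b \<in> genideal (mpoly_ring n) (h ` {..<k})"
      unfolding r by (intro mpoly_ideal_sum[OF ideal_genideal[OF sub]]) auto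
  qed
qed

lemma irrelevant_ideal_ideal: "ideal (irrelevant_ideal n) (mpoly_ring n)"
  unfolding irrelevant_ideal_def by (rule ideal_genideal) auto

lemma lookup_mvar_0 [simp]: "mcoeff (mvar i :: 'k::field mpol) 0 = 0"
proof -
  have "mterm i (1::nat) \<noteq> 0"
    by (metis lookup_single_eq lookup_zero zero_neq_one)
  then show ?thesis by (simp add: mvar_def lookup_single when_def)
qed

lemma irrelevant_ideal_iff:
  fixes p :: "'k::field mpol"
  shows "p \<in> irrelevant_ideal n \<longleftrightarrow> p \<in> polys n \<and> mcoeff p 0 = 0"
proof
  have "ideal {p \<in> polys n. mcoeff p 0 = (0::'k)} (mpoly_ring n)"
  proof (rule ideal_mpoly_ringI)
    fix c a :: "'k mpol" assume "c \<in> polys n" "a \<in> {p \<in> polys n. mcoeff p 0 = 0}"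
    moreover have "0 \<notin> msupp (c * a)" if "0 \<notin> msupp a"
    proof
      assume "0 \<in> msupp (c * a)"
      then obtain x y where xy: "0 = x + y" "y \<in> msupp a"
        using Poly_Mapping.keys_mult[of c a] by blast
      have "msupp y = {}" using keys_add_nat[of x y] xy(1) by (metis Un_empty keys_zero)
      with xy(2) that show False by simp
    qed
    ultimately show "c * a \<in> {p \<in> polys n. mcoeff p 0 = 0}"
      by (simp add: in_keys_iff)
  qed (auto simp: lookup_add)
  then have "irrelevant_ideal n \<subseteq> {p \<in> polys n. mcoeff p 0 = (0::'k)}"
    unfolding irrelevant_ideal_def
    by (intro genideal_least) auto
  then show "p \<in> irrelevant_ideal n \<Longrightarrow> p \<in> polys n \<and> mcoeff p 0 = 0"
    by blast
next
  assume p: "p \<in> polys n \<and> mcoeff p 0 = 0"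
  show "p \<in> irrelevant_ideal n"
  proof (rule mpoly_ideal_by_monomials[OF irrelevant_ideal_ideal])
    fix m assume m: "m \<in> msupp p"
    then have "m \<noteq> 0" using p by (auto simp: in_keys_iff)
    then obtain i where "i \<in> msupp m" by fastforce
    moreover from this have "i \<le> n"
      using p m by (auto simp: polys_iff)
    moreover have "mvar ` {..n} \<subseteq> (irrelevant_ideal n :: 'k mpol set)"
      unfolding irrelevant_ideal_def by (rule genideal_incl) auto
    ultimately show "\<exists>i\<in>msupp m. mvar i \<in> (irrelevant_ideal n :: 'k mpol set)"
      by auto
  qed (use p in simp)
qed

lemma homogeneous_irrelevant:
  assumes "p \<in> polys n" "homogeneous d p" "d \<noteq> 0"
  shows "p \<in> irrelevant_ideal n"
proof -
  have "0 \<notin> msupp p" using assms(2,3) by (force simp: homogeneous_def mon_deg_def)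
  then show ?thesis using assms(1) by (simp add: irrelevant_ideal_iff in_keys_iff)
qed


subsection \<open>The gradient of the sub-Hankel determinant\<close>

text \<open>The variables in reverse order: \<open>hvar n {} i\<close> is $y_i = x_{n-i}$, and those with
  $n - i \in S$ are replaced by 0.\<close>

definition hvar :: "nat \<Rightarrow> nat set \<Rightarrow> nat \<Rightarrow> 'k::field mpol" where
  "hvar n S i = (if i \<le> n \<and> n - i \<notin> S then mvar (n - i) else 0)"

lemma zap_hvar: "zap S (hvar n T i) = hvar n (S \<union> T) i"
  by (simp add: hvar_def zap_mvar)

lemma hvar_polys [simp]: "hvar n S i \<in> polys n"
  by (simp add: hvar_def)

lemma homogeneous_hvar: "homogeneous 1 (hvar n S i)"
  by (simp add: hvar_def homogeneous_mvar)

lemma zap_recip_sq: "zap S (recip_sq y $ m) = recip_sq (\<lambda>i. zap S (y i)) $ m"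
  by (rule recip_hom) (simp_all add: zap_add zap_mult)

lemma recip_sq_polys:
  assumes "\<And>i. y i \<in> polys n"
  shows "recip_sq y $ m \<in> polys n"
  using assms by (simp add: polys_iff_zap zap_recip_sq)

lemma homogeneous_cong: "homogeneous d p \<Longrightarrow> d = e \<Longrightarrow> homogeneous e p"
  by simp

lemma homogeneous_recip:
  assumes "\<And>i. homogeneous 1 (y i)"
  shows "homogeneous (int m) (recip y $ m)"
proof (induction m rule: less_induct)
  case (less m)
  show ?case
  proof (cases "m = 0")
    case True
    then show ?thesis by (simp add: homogeneous_one)
  next
    case False
    have "homogeneous (int m) (y i * y 0 ^ (i - 1) * recip y $ (m - i))" if "i \<in> {1..m}" for i
    proof (rule homogeneous_cong)
      show "homogeneous (1 + int (i - 1) * 1 + int (m - i)) (y i * y 0 ^ (i - 1) * recip y $ (m - i))"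
        using that by (intro homogeneous_mult homogeneous_power assms less.IH) auto
    qed (use that in auto)
    then have "homogeneous (int m) (- (\<Sum>i=1..m. y i * y 0 ^ (i - 1) * recip y $ (m - i)))"
      by (intro homogeneous_uminus homogeneous_sum)
    then show ?thesis
      using False by (simp only: recip_rec)
  qed
qed

lemma homogeneous_recip_sq:
  assumes "\<And>i. homogeneous 1 (y i)"
  shows "homogeneous (int m) (recip_sq y $ m)"
  unfolding recip_sq_def fps_mult_nth
proof (rule homogeneous_sum)
  fix i assume "i \<in> {0..m}"
  then show "homogeneous (int m) (recip y $ i * recip y $ (m - i))"
    by (intro homogeneous_cong[OF homogeneous_mult[OF homogeneous_recip homogeneous_recip]] assms) auto
qed

text \<open>The entry of the adjugate of the Hankel matrix of size \<open>n + 1\<close> in the last row and column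
  is the sub-Hankel determinant of size \<open>n\<close>; the last column solves the triangular Toeplitz system
  whose inverse is the reciprocal power series.\<close>

lemma det_sub_hankel:
  fixes n :: nat
  shows "\<exists>\<epsilon>. (\<epsilon> = 1 \<or> \<epsilon> = - 1) \<and> det (sub_hankel n) = \<epsilon> * recip (hvar n {} :: nat \<Rightarrow> 'k::field mpol) $ n"
proof -
  let ?y = "hvar n {} :: nat \<Rightarrow> 'k mpol"
  define U :: "'k mpol mat" where "U = mat (Suc n) (Suc n) (\<lambda>(i, j). if i + j \<le> n then mvar (i + j) else 0)"
  define v where "v j = adj_mat U $$ (j, n)" for j
  have U: "U \<in> carrier_mat (Suc n) (Suc n)" by (simp add: U_def)
  have "mat_delete U n n = sub_hankel n"
    by (rule eq_matI) (auto simp: mat_delete_def U_def sub_hankel_def)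
  then have vn: "v n = det (sub_hankel n)"
    using U by (simp add: v_def adj_mat_def cofactor_def)
  \<comment> \<open>Reversing the rows makes the Hankel matrix a lower triangular Toeplitz matrix
    with x_n = y_0 on the diagonal.\<close>
  define p where "p i = (if i \<le> n then n - i else i)" for i
  have p: "p permutes {0..<Suc n}"
    by (rule bij_imp_permutes) (auto simp: p_def intro!: bij_betw_byWitness[of _ "\<lambda>i. n - i"])
  define L where "L = mat (Suc n) (Suc n) (\<lambda>(i, j). U $$ (p i, j))"
  have "det L = prod_list (diag_mat L)"
    by (rule det_lower_triangular[of "Suc n"]) (auto simp: L_def U_def p_def)
  also have "diag_mat L = replicate (Suc n) (mvar n)"
    by (rule nth_equalityI) (auto simp: diag_mat_def L_def U_def p_def simp del: upt_Suc replicate_Suc)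
  finally have "det L = mvar n ^ Suc n" by (simp add: prod_list_replicate)
  moreover have "det L = signof p * det U"
    unfolding L_def by (rule det_permute_rows[OF U p])
  ultimately have detL: "mvar n ^ Suc n = signof p * det U" by simp
  define \<epsilon> :: "'k mpol" where "\<epsilon> = signof p"
  have \<epsilon>: "\<epsilon> = 1 \<or> \<epsilon> = - 1" by (simp add: \<epsilon>_def sign_def)
  then have detU: "det U = \<epsilon> * mvar n ^ Suc n"
    unfolding detL \<epsilon>_def[symmetric] by auto
  have toep: "(\<Sum>j\<le>m. ?y (m - j) * v j) = (if m = 0 then det U else 0)" if "m \<le> n" for m
  proof -
    have "(U * adj_mat U) $$ (n - m, n) = (det U \<cdot>\<^sub>m 1\<^sub>m (Suc n)) $$ (n - m, n)"
      using adj_mat(2)[OF U] by simp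
    also have "\<dots> = (if m = 0 then det U else 0)"
      using that by auto
    also have "(U * adj_mat U) $$ (n - m, n) = (\<Sum>j<Suc n. U $$ (n - m, j) * v j)"
      using U adj_mat(1)[OF U] by (auto simp: scalar_prod_def v_def atLeast0LessThan intro!: sum.cong)
    also have "\<dots> = (\<Sum>j\<le>m. U $$ (n - m, j) * v j)"
      using that by (intro sum.mono_neutral_right) (auto simp: U_def)
    also have "\<dots> = (\<Sum>j\<le>m. ?y (m - j) * v j)"
      using that by (intro sum.cong) (auto simp: U_def hvar_def)
    finally show ?thesis by simp
  qed
  have y0: "?y 0 = mvar n" by (simp add: hvar_def)
  \<comment> \<open>Forward substitution in the Toeplitz system. The value is \<open>det U\<close>
    times the coefficient of t^m in 1 / y(t), written without denominators; for \<open>m = n\<close>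
    the power of \<open>mvar n\<close> disappears.\<close>
  have "v m = \<epsilon> * (mvar n ^ (n - m) * recip ?y $ m)" if "m \<le> n" for m
    using that
  proof (induction m rule: less_induct)
    case (less m)
    have "mvar n * v m = mvar n * (\<epsilon> * (mvar n ^ (n - m) * recip ?y $ m))"
    proof (cases "m = 0")
      case True
      then show ?thesis using toep[of 0] detU by (simp add: y0 mult_ac)
    next
      case False
      then have m: "m > 0" by simp
      have "{..m} = insert m {..<m}" by auto
      then have "mvar n * v m + (\<Sum>j<m. ?y (m - j) * v j) = 0"
        using toep[OF less.prems] False by (simp add: y0)
      then have "mvar n * v m = - (\<Sum>j<m. ?y (m - j) * v j)"
        by (simp add: eq_neg_iff_add_eq_0)
      also have "(\<Sum>j<m. ?y (m - j) * v j) = (\<Sum>i=1..m. ?y i * v (m - i))"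
        by (rule sum.reindex_bij_witness[of _ "\<lambda>i. m - i" "\<lambda>i. m - i"]) auto
      also have "\<dots> = (\<Sum>i=1..m. mvar n * \<epsilon> * mvar n ^ (n - m) * (?y i * ?y 0 ^ (i - 1) * recip ?y $ (m - i)))"
      proof (rule sum.cong)
        fix i assume i: "i \<in> {1..m}"
        then have "n - (m - i) = Suc ((n - m) + (i - 1))" using less.prems by auto
        then have pow: "mvar n ^ (n - (m - i)) = mvar n * (mvar n ^ (n - m) * mvar n ^ (i - 1))"
          by (simp only: power_Suc power_add)
        have "v (m - i) = \<epsilon> * (mvar n ^ (n - (m - i)) * recip ?y $ (m - i))"
          using i less.prems by (intro less.IH) auto
        then show "?y i * v (m - i) = mvar n * \<epsilon> * mvar n ^ (n - m) * (?y i * ?y 0 ^ (i - 1) * recip ?y $ (m - i))"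
          unfolding y0 pow by (simp only: mult_ac)
      qed simp
      also have "\<dots> = mvar n * \<epsilon> * mvar n ^ (n - m) * (- (recip ?y $ m))"
      proof -
        have "(\<Sum>i=1..m. ?y i * ?y 0 ^ (i - 1) * recip ?y $ (m - i)) = - (recip ?y $ m)"
          unfolding recip_rec[OF m, of ?y] minus_minus ..
        then show ?thesis by (simp only: sum_distrib_left[symmetric])
      qed
      also have "- \<dots> = mvar n * \<epsilon> * mvar n ^ (n - m) * recip ?y $ m" by simp
      finally show ?thesis by (simp only: mult_ac)
    qed
    then show ?case by simp
  qed
  from this[of n] vn \<epsilon> show ?thesis by auto
qed

text \<open>Indexed by the variable x_p = y_(n-p): up to sign the partial derivative of the
  determinant, with the variables in \<open>S\<close> set to 0 after differentiating.\<close>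

definition grad_gen :: "nat \<Rightarrow> nat set \<Rightarrow> nat \<Rightarrow> 'k::field mpol" where
  "grad_gen n S p = (if p < n then hb_gen (hvar n S) (n - 1) p else last_gen (hvar n S) n)"

text \<open>The coefficients of \<open>dehom\<close> are x_(n-i) x_n^(i-1). For \<open>p < n\<close>
  only the one with \<open>i = n - p\<close> involves x_p; for \<open>p = n\<close> each
  contributes, with factor i - 1, and the sum is \<open>last_gen\<close>.\<close>

lemma partial_deriv_recip:
  assumes "p \<le> n" "n \<ge> 1"
  shows "partial_deriv p (recip (hvar n {} :: nat \<Rightarrow> 'k::field mpol) $ n) = - grad_gen n {} p"
proof -
  let ?y = "hvar n {} :: nat \<Rightarrow> 'k mpol"
  have D: "partial_deriv p (recip ?y $ n) = - (\<Sum>i=0..n. partial_deriv p (dehom ?y $ i) * recip_sq ?y $ (n - i))"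
    by (rule recip_deriv) (simp_all add: partial_deriv_add partial_deriv_mult)
  have dehom: "dehom ?y $ i = mvar (n - i) * mvar n ^ (i - 1)" if "i \<in> {1..n}" for i
    using that by (simp add: dehom_nth hvar_def)
  have "(\<Sum>i=0..n. partial_deriv p (dehom ?y $ i) * recip_sq ?y $ (n - i))
      = (\<Sum>i=1..n. partial_deriv p (mvar (n - i) * mvar n ^ (i - 1)) * recip_sq ?y $ (n - i))"
    by (simp add: sum.atLeast_Suc_atMost[of 0] partial_deriv_one dehom)
  also have "\<dots> = grad_gen n {} p"
  proof (cases "p < n")
    case True
    have "(\<Sum>i=1..n. partial_deriv p (mvar (n - i) * mvar n ^ (i - 1)) * recip_sq ?y $ (n - i))
        = (\<Sum>i=1..n. if i = n - p then mvar n ^ (n - 1 - p) * recip_sq ?y $ p else 0)"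
      using True by (intro sum.cong)
        (auto simp: partial_deriv_mult partial_deriv_mvar_power partial_deriv_mvar diff_commute)
    also have "\<dots> = mvar n ^ (n - 1 - p) * recip_sq ?y $ p"
      using True by (subst sum.delta) auto
    finally show ?thesis
      using True by (simp add: grad_gen_def hb_gen_def hvar_def)
  next
    case False
    then have p: "p = n" using assms by simp
    have "(\<Sum>i=1..n. partial_deriv p (mvar (n - i) * mvar n ^ (i - 1)) * recip_sq ?y $ (n - i))
        = (\<Sum>q<n. of_nat (n - 1 - q) * ?y (n - q) * ?y 0 ^ (n - 2 - q) * recip_sq ?y $ q)"
    proof (rule sum.reindex_bij_witness[of _ "\<lambda>i. n - i" "\<lambda>i. n - i"])
      fix i assume i: "i \<in> {1..n}"
      then have "n - 1 - (n - i) = i - 1" "n - 2 - (n - i) = i - 1 - 1" "n - (n - i) = i" "n - i \<noteq> n" by auto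
      then show "of_nat (n - 1 - (n - i)) * ?y (n - (n - i)) * ?y 0 ^ (n - 2 - (n - i)) * recip_sq ?y $ (n - i)
          = partial_deriv p (mvar (n - i) * mvar n ^ (i - 1)) * recip_sq ?y $ (n - i)"
        using i p by (simp add: partial_deriv_mult partial_deriv_mvar_power partial_deriv_mvar hvar_def mult_ac)
    qed auto
    also have "\<dots> = last_gen ?y n"
    proof -
      have "{..<n} = insert (n - 1) {..<n-1}" using assms by auto
      then show ?thesis by (simp add: last_gen_def)
    qed
    finally show ?thesis
      using p by (simp add: grad_gen_def)
  qed
  finally show ?thesis using D by simp
qed

lemma hb_gen_polys: "(\<And>i. y i \<in> polys n) \<Longrightarrow> hb_gen y N p \<in> polys n"
  by (simp add: hb_gen_def recip_sq_polys)

lemma last_gen_polys: "(\<And>i. y i \<in> polys n) \<Longrightarrow> last_gen y N \<in> polys n"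
  by (simp add: last_gen_def recip_sq_polys polys_sum)

lemma grad_gen_polys [simp]: "grad_gen n S p \<in> polys n"
  by (simp add: grad_gen_def hb_gen_polys last_gen_polys)

lemma homogeneous_hb_gen:
  assumes "\<And>i. homogeneous 1 (y i)" "p \<le> N"
  shows "homogeneous (int N) (hb_gen y N p)"
proof -
  have "homogeneous (int (N - p) * 1 + int p) (hb_gen y N p)"
    unfolding hb_gen_def by (intro homogeneous_mult homogeneous_power homogeneous_recip_sq assms)
  then show ?thesis using assms by simp
qed

lemma homogeneous_last_gen:
  assumes "\<And>i. homogeneous 1 (y i)" "n \<ge> 2"
  shows "homogeneous (int n - 1) (last_gen y n)"
  unfolding last_gen_def
proof (rule homogeneous_sum)
  fix p assume p: "p \<in> {..<n-1}"
  have "homogeneous (0 + 1 + int (n - 2 - p) * 1 + int p)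
      (of_nat (n - 1 - p) * y (n - p) * y 0 ^ (n - 2 - p) * recip_sq y $ p)"
    by (intro homogeneous_mult homogeneous_power homogeneous_recip_sq homogeneous_of_nat assms)
  then show "homogeneous (int n - 1) (of_nat (n - 1 - p) * y (n - p) * y 0 ^ (n - 2 - p) * recip_sq y $ p)"
    by (rule homogeneous_cong) (use p in auto)
qed

lemma homogeneous_grad_gen:
  assumes "n \<ge> 2"
  shows "homogeneous (int n - 1) (grad_gen n S p)"
proof (cases "p < n")
  case True
  have "homogeneous (int (n - 1)) (hb_gen (hvar n S) (n - 1) p :: 'a mpol)"
    using True by (intro homogeneous_hb_gen homogeneous_hvar) auto
  then show ?thesis using True assms by (simp add: grad_gen_def of_nat_diff)
qed (simp add: grad_gen_def homogeneous_last_gen homogeneous_hvar assms)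

lemma zap_grad_gen: "zap S (grad_gen n T p) = grad_gen n (S \<union> T) p"
  by (simp add: grad_gen_def hb_gen_def last_gen_def zap_mult zap_power zap_recip_sq zap_hvar zap_sum zap_diff zap_add)

lemma gradient_ideal_sub_hankel:
  assumes "n \<ge> 2"
  shows "gradient_ideal n (det (sub_hankel n :: 'k::field mpol mat)) = combos n (Suc n) (grad_gen n {})"
proof -
  obtain \<epsilon> :: "'k mpol" where \<epsilon>: "\<epsilon> = 1 \<or> \<epsilon> = - 1" "det (sub_hankel n) = \<epsilon> * recip (hvar n {}) $ n"
    using det_sub_hankel[of n, where ?'k = 'k] by blast
  have neg: "partial_deriv p (- q) = - partial_deriv p q" for p and q :: "'k mpol"
    using partial_deriv_add[of p q "- q"]
    by (simp add: partial_deriv_zero eq_neg_iff_add_eq_0 add.commute)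
  have "partial_deriv p (det (sub_hankel n)) = - \<epsilon> * grad_gen n {} p" if "p < Suc n" for p
    using \<epsilon> partial_deriv_recip[of p n, where ?'k = 'k] that assms by (auto simp: neg)
  then have "genideal (mpoly_ring n) ((\<lambda>p. partial_deriv p (det (sub_hankel n))) ` {..<Suc n})
      = combos n (Suc n) (grad_gen n {} :: nat \<Rightarrow> 'k mpol)"
    by (intro genideal_eq_combos[of _ _ _ "- \<epsilon>"]) (use \<epsilon> in auto)
  then show ?thesis
    by (simp add: gradient_ideal_def lessThan_Suc_atMost)
qed

lemma prime_start_hvar:
  assumes n: "n \<ge> 2" and S: "S \<inter> {n-2..n} = {}"
  shows "prime_start (hvar n S :: nat \<Rightarrow> 'k::field_char_0 mpol)"
proof
  have y: "hvar n S 0 = mvar n" "hvar n S 1 = mvar (n - 1)" "hvar n S 2 = mvar (n - 2)"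
    using n S by (auto simp: hvar_def)
  show "hvar n S 0 \<noteq> (0 :: 'k mpol)" by (simp add: y)
  show "of_nat k dvd (1 :: 'k mpol)" if "k > 0" for k
  proof
    have "of_nat k * mterm 0 (1 / of_nat k) = (mterm (0 + 0) (of_nat k * (1 / of_nat k)) :: 'k mpol)"
      unfolding of_nat_conv_single mult_single ..
    also have "of_nat k * (1 / of_nat k) = (1 :: 'k)"
      using that by simp
    finally show "1 = of_nat k * (mterm 0 (1 / of_nat k) :: 'k mpol)"
      by simp
  qed
  show "hvar n S 0 dvd a \<or> hvar n S 0 dvd b" if "hvar n S 0 dvd a * b" for a b :: "'k mpol"
    using that unfolding y mvar_dvd_iff zap_mult by (simp only: mult_eq_0_iff)
  have "zap {n} (mvar (n - 1)) \<noteq> (0 :: 'k mpol)"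
    using n by (simp add: zap_mvar)
  then show "\<not> hvar n S 0 dvd (hvar n S 1 :: 'k mpol)"
    unfolding y mvar_dvd_iff .
  show "(\<exists>u v. a = hvar n S 0 * u + hvar n S 1 * v) \<or> (\<exists>u v. b = hvar n S 0 * u + hvar n S 1 * v)"
    if "\<exists>u v. a * b = hvar n S 0 * u + hvar n S 1 * v" for a b :: "'k mpol"
    using that unfolding y mvar_pair_iff zap_mult by (simp only: mult_eq_0_iff)
  have "n - 2 \<notin> {n, n - 1}"
    using n by auto
  then have "zap {n, n - 1} (mvar (n - 2)) \<noteq> (0 :: 'k mpol)"
    by (simp only: zap_mvar if_False mvar_nz not_False_eq_True)
  then show "\<nexists>u v. hvar n S 2 = hvar n S 0 * u + hvar n S 1 * (v :: 'k mpol)"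
    unfolding y mvar_pair_iff .
qed


unbundle no fps_syntax
notation vec_index (infixl "$" 100)

subsection \<open>The resolution\<close>

text \<open>The columns of the second map of the mapping cone: for \<open>j < n - 1\<close> the
  Hilbert--Burch columns (numbered from 1, hence \<open>Suc j\<close>), then the Euler relation,
  then the Koszul relation between the generators \<open>n - 1\<close> and \<open>n\<close>. Row
  \<open>p = n\<close> belongs to the extra generator F.\<close>

definition syz :: "nat \<Rightarrow> nat set \<Rightarrow> nat \<Rightarrow> nat \<Rightarrow> 'k::field mpol" where
  "syz n S j p =
     (if j < n - 1 then (if p < n then hb_mat (hvar n S) (Suc j) p else 0)
      else if j = n - 1 then (if p < n then - euler_coeff (hvar n S) n p else hvar n S 0)
      else (if p = n - 1 then - grad_gen n S n else if p = n then grad_gen n S (n - 1) else 0))"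

lemma zap_hb_mat: "zap T (hb_mat (hvar n S) m p) = hb_mat (hvar n (T \<union> S)) m p"
  unfolding hb_mat_def by (simp only: zap_mult zap_hvar zap_of_nat zap_zero if_distrib[of "zap T"])

lemma zap_euler_coeff: "zap T (euler_coeff (hvar n S) m p) = euler_coeff (hvar n (T \<union> S)) m p"
  unfolding euler_coeff_def by (simp only: zap_mult zap_hvar zap_of_nat)

lemma zap_syz: "zap T (syz n S j p) = syz n (T \<union> S) j p"
  unfolding syz_def
  by (simp only: zap_hb_mat zap_euler_coeff zap_uminus zap_grad_gen zap_hvar zap_zero if_distrib[of "zap T"])

lemma hb_mat_polys [simp]: "hb_mat (hvar n S) m p \<in> polys n"
  unfolding hb_mat_def by (simp only: polys_closed hvar_polys split: if_splits) simp

lemma euler_coeff_polys [simp]: "euler_coeff (hvar n S) m p \<in> polys n"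
  unfolding euler_coeff_def by (simp only: polys_closed hvar_polys)

lemma syz_polys [simp]: "syz n S j p \<in> polys n"
  by (simp add: syz_def)

lemma homogeneous_hb_mat: "homogeneous 1 (hb_mat (hvar n S) m p)"
proof (cases "p \<le> m")
  case True
  have "homogeneous (0 + 1) (of_nat (2 * m - p) * hvar n S (m - p))"
    by (intro homogeneous_mult homogeneous_of_nat homogeneous_hvar)
  then show ?thesis unfolding hb_mat_def using True by (simp only: add_0_left if_True)
qed (simp add: hb_mat_def)

lemma homogeneous_euler_coeff: "homogeneous 1 (euler_coeff (hvar n S) m p)"
proof -
  have "homogeneous (0 + 1) (of_nat (m - 1 - p) * hvar n S (m - p))"
    by (intro homogeneous_mult homogeneous_of_nat homogeneous_hvar)
  then show ?thesis unfolding euler_coeff_def by (simp only: add_0_left)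
qed

lemma homogeneous_syz:
  assumes "n \<ge> 2"
  shows "homogeneous (if j < n then 1 else int n - 1) (syz n S j p)"
  using assms
  by (auto simp: syz_def intro!: homogeneous_uminus homogeneous_hb_mat homogeneous_euler_coeff
      homogeneous_hvar homogeneous_grad_gen)

lemma sum_grad_gen:
  "(\<Sum>p<Suc n. r p * grad_gen n S p)
    = r n * last_gen (hvar n S) n + (\<Sum>p<n. r p * hb_gen (hvar n S) (n - 1) p)"
  by (simp add: grad_gen_def add.commute)

lemma syz_grad_gen:
  assumes n: "n \<ge> 2" and j: "j < Suc n"
  shows "(\<Sum>p<Suc n. syz n S j p * grad_gen n S p) = (0 :: 'k::field mpol)"
proof -
  let ?y = "hvar n S :: nat \<Rightarrow> 'k mpol"
  let ?s = "syz n S j :: nat \<Rightarrow> 'k mpol" and ?g = "grad_gen n S :: nat \<Rightarrow> 'k mpol"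
  have le: "{..<n} = {..n-1}" using n by auto
  consider "j < n - 1" | "j = n - 1" | "j = n" "\<not> n < n - 1" "n \<noteq> n - 1"
    using j n by linarith
  then show ?thesis
  proof cases
    case 1
    then have "(\<Sum>p<Suc n. ?s p * ?g p)
        = (\<Sum>p<n. hb_mat ?y (Suc j) p * hb_gen ?y (n - 1) p)"
      unfolding sum_grad_gen by (simp add: syz_def)
    also have "\<dots> = 0"
      using hb_relation[of "Suc j" "n - 1" ?y] 1 by (simp add: le)
    finally show ?thesis .
  next
    case 2
    then have "(\<Sum>p<Suc n. ?s p * ?g p)
        = ?y 0 * last_gen ?y n - (\<Sum>p<n. euler_coeff ?y n p * hb_gen ?y (n - 1) p)"
      unfolding sum_grad_gen by (simp add: syz_def sum_negf)
    then show ?thesis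
      by (simp only: euler_relation[OF n] diff_self)
  next
    case 3
    then have syz: "?s p = (if p = n - 1 then - ?g n else if p = n then ?g (n - 1) else 0)"
      for p by (simp add: syz_def)
    have split: "{..<Suc n} = insert n (insert (n - 1) {..<n-1})" using n by auto
    have "(\<Sum>p<n-1. ?s p * ?g p) = 0"
      by (intro sum.neutral) (auto simp: syz)
    then show ?thesis
      unfolding split using 3(2,3) syz[of n] syz[of "n - 1"] by simp
  qed
qed

lemma syz_exact:
  fixes r :: "nat \<Rightarrow> 'k::field_char_0 mpol"
  assumes n: "n \<ge> 2" and S: "S \<inter> {n-2..n} = {}" and r: "\<And>p. p < Suc n \<Longrightarrow> r p \<in> polys n"
    and rel: "(\<Sum>p<Suc n. r p * grad_gen n S p) = 0"
  shows "\<exists>c. (\<forall>j. c j \<in> polys n) \<and> (\<forall>p<Suc n. r p = (\<Sum>j<Suc n. c j * syz n S j p))"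
proof -
  let ?y = "hvar n S :: nat \<Rightarrow> 'k mpol"
  interpret prime_start ?y by (rule prime_start_hvar[OF n S])
  from rel have "r n * last_gen ?y n + (\<Sum>p<n. r p * hb_gen ?y (n - 1) p) = 0"
    unfolding sum_grad_gen .
  from syzygies_exact[OF n this] obtain c u v where
    rn: "r n = u * ?y 0 + v * hb_gen ?y (n - 1) (n - 1)" and
    rp: "\<And>p. p < n \<Longrightarrow> r p = (\<Sum>m=1..n-1. c m * hb_mat ?y m p) - u * euler_coeff ?y n p
        - (if p = n - 1 then v * last_gen ?y n else 0)"
    by blast
  define c' where "c' j = (if j < n - 1 then c (Suc j) else if j = n - 1 then u else v)" for j
  have split: "{..<Suc n} = insert n (insert (n - 1) {..<n-1})" using n by auto
  have ne: "n \<noteq> n - 1" "\<not> n < n - 1" using n by auto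
  have eq: "r p = (\<Sum>j<Suc n. c' j * syz n S j p)" if "p < Suc n" for p
  proof -
    have "(\<Sum>j<Suc n. c' j * syz n S j p)
        = v * syz n S n p + u * syz n S (n - 1) p + (\<Sum>j<n-1. c (Suc j) * syz n S j p)"
      unfolding split using ne by (simp add: c'_def)
    also have "(\<Sum>j<n-1. c (Suc j) * syz n S j p)
        = (if p < n then \<Sum>m=1..n-1. c m * hb_mat ?y m p else 0)"
    proof (cases "p < n")
      case True
      have "(\<Sum>j<n-1. c (Suc j) * syz n S j p) = (\<Sum>j<n-1. c (Suc j) * hb_mat ?y (Suc j) p)"
        using True by (intro sum.cong) (auto simp: syz_def)
      also have "\<dots> = (\<Sum>m=1..n-1. c m * hb_mat ?y m p)"
        by (rule sum.reindex_bij_witness[of _ "\<lambda>m. m - 1" Suc]) auto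
      finally show ?thesis using True by simp
    qed (simp add: syz_def)
    also have "v * syz n S n p + u * syz n S (n - 1) p + \<dots> = r p"
    proof (cases "p < n")
      case True
      then have "p \<noteq> n" by simp
      then show ?thesis
        unfolding rp[OF True] using True ne by (simp add: syz_def grad_gen_def)
    next
      case False
      then have "p = n" using that by simp
      then show ?thesis
        using ne n by (simp add: syz_def rn grad_gen_def)
    qed
    finally show ?thesis by simp
  qed
  \<comment> \<open>The coefficients \<open>c'\<close> may involve variables beyond x_n. The
    retraction fixes \<open>r\<close> and \<open>syz\<close>, so applying it to the equation repairs
    this.\<close>
  have fixed: "zap {n<..} q = q" if "q \<in> polys n" for q :: "'k mpol"
    using that by (simp add: polys_iff_zap)
  have "r p = (\<Sum>j<Suc n. zap {n<..} (c' j) * syz n S j p)" if "p < Suc n" for p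
  proof -
    have "r p = zap {n<..} (\<Sum>j<Suc n. c' j * syz n S j p)"
      using fixed[OF r[OF that]] eq[OF that] by simp
    then show ?thesis
      by (simp only: zap_sum zap_mult fixed[OF syz_polys])
  qed
  then show ?thesis
    by (intro exI[of _ "\<lambda>j. zap {n<..} (c' j)"]) (simp add: polys_retract del: sum.lessThan_Suc)
qed

text \<open>The Koszul relation on y_0 and H, lifted to the cone: \<open>y 0\<close> times the
  Koszul column minus H times the Euler column has last entry 0, hence is a syzygy of the
  \<open>hb_gen\<close> and a combination of the Hilbert--Burch columns.\<close>

lemma second_syzygy:
  assumes n: "n \<ge> 2"
  shows "\<exists>e :: nat \<Rightarrow> 'k::field_char_0 mpol. (\<forall>j. e j \<in> polys n)
    \<and> (\<forall>j<n. homogeneous (int n - 1) (e j)) \<and> e (n - 1) = - grad_gen n {} (n - 1)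
    \<and> e n = mvar n \<and> (\<forall>p<Suc n. (\<Sum>j<Suc n. e j * syz n {} j p) = 0)"
proof -
  let ?y = "hvar n {} :: nat \<Rightarrow> 'k mpol" and ?A = "grad_gen n {} (n - 1) :: 'k mpol"
  interpret prime_start ?y by (rule prime_start_hvar[OF n]) simp
  have y0: "?y 0 = mvar n" by (simp add: hvar_def)
  have split: "{..<Suc n} = insert n (insert (n - 1) {..<n-1})" using n by auto
  have ne: "n \<noteq> n - 1" "\<not> n < n - 1" using n by auto
  have le: "{..n-1} = {..<n}" using n by auto
  define w where "w p = ?y 0 * syz n {} n p - ?A * syz n {} (n - 1) p" for p
  have wn: "w n = 0"
    using ne n by (simp add: w_def syz_def mult.commute)
  have "(\<Sum>p<Suc n. w p * grad_gen n {} p)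
      = ?y 0 * (\<Sum>p<Suc n. syz n {} n p * grad_gen n {} p) - ?A * (\<Sum>p<Suc n. syz n {} (n - 1) p * grad_gen n {} p)"
    unfolding sum_distrib_left sum_subtractf[symmetric]
    by (intro sum.cong) (simp_all add: w_def algebra_simps)
  also have "\<dots> = 0"
    using n by (simp only: syz_grad_gen mult_zero_right diff_self)
  finally have "(\<Sum>p\<le>n-1. w p * hb_gen ?y (n - 1) p) = 0"
    unfolding sum_grad_gen wn le by simp
  from hb_exact[OF this] obtain c where c: "\<And>p. p \<le> n - 1 \<Longrightarrow> w p = (\<Sum>m=1..n-1. c m * hb_mat ?y m p)"
    by blast
  have hw: "homogeneous (int n) (w p)" for p
  proof -
    have "homogeneous (1 + (int n - 1)) (?y 0 * syz n {} n p)"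
      using homogeneous_syz[OF n, of n "{}" p] by (intro homogeneous_mult homogeneous_hvar) simp
    moreover have "homogeneous ((int n - 1) + 1) (?A * syz n {} (n - 1) p)"
      using homogeneous_syz[OF n, of "n - 1" "{}" p] n
      by (intro homogeneous_mult homogeneous_grad_gen) auto
    ultimately show ?thesis
      using homogeneous_add[OF _ homogeneous_uminus, of "int n"] by (simp add: w_def)
  qed
  have wpolys: "w p \<in> polys n" for p by (simp add: w_def)
  have fixed: "zap {n<..} q = q" if "q \<in> polys n" for q :: "'k mpol"
    using that by (simp add: polys_iff_zap)
  \<comment> \<open>\<open>hb_exact\<close> gives no control over variables or degrees. Since
    \<open>w\<close> has degree n and the columns are linear, only the retracted components of
    degree n - 1 matter.\<close>
  define q where "q j = - hcomp (int n - 1) (zap {n<..} (c (Suc j)))" for j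
  have q: "w p = - (\<Sum>j<n-1. q j * hb_mat ?y (Suc j) p)" if "p \<le> n - 1" for p
  proof -
    have "w p = hcomp (int n) (zap {n<..} (\<Sum>m=1..n-1. c m * hb_mat ?y m p))"
      using fixed[OF wpolys] hcomp_id[OF hw] c[OF that] by metis
    also have "\<dots> = (\<Sum>m=1..n-1. hcomp (int n - 1) (zap {n<..} (c m)) * hb_mat ?y m p)"
      by (simp only: zap_sum zap_mult fixed[OF hb_mat_polys] hcomp_sum hcomp_mult[OF homogeneous_hb_mat])
    also have "\<dots> = (\<Sum>j<n-1. - q j * hb_mat ?y (Suc j) p)"
      by (rule sum.reindex_bij_witness[of _ Suc "\<lambda>m. m - 1"]) (auto simp: q_def)
    finally show ?thesis by (simp add: sum_negf)
  qed
  define e where "e j = (if j < n - 1 then q j else if j = n - 1 then - ?A else mvar n)" for j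
  have "(\<Sum>j<Suc n. e j * syz n {} j p) = 0" if "p < Suc n" for p
  proof -
    have "(\<Sum>j<Suc n. e j * syz n {} j p) = w p + (\<Sum>j<n-1. q j * syz n {} j p)"
      unfolding split using ne by (simp add: e_def w_def y0)
    also have "(\<Sum>j<n-1. q j * syz n {} j p) = - w p"
    proof (cases "p = n")
      case True
      then show ?thesis by (simp add: wn syz_def)
    next
      case False
      then have p: "p < n" "p \<le> n - 1" using that by auto
      have "(\<Sum>j<n-1. q j * syz n {} j p) = (\<Sum>j<n-1. q j * hb_mat ?y (Suc j) p)"
        using p by (intro sum.cong) (auto simp: syz_def)
      then show ?thesis unfolding q[OF p(2)] by simp
    qed
    finally show ?thesis by simp
  qed
  moreover have "e j \<in> polys n" for j
    by (simp add: e_def q_def polys_retract)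
  moreover have "homogeneous (int n - 1) (e j)" if "j < n" for j
    using that n
    by (auto simp: e_def q_def intro!: homogeneous_uminus homogeneous_hcomp homogeneous_grad_gen)
  moreover have "e (n - 1) = - ?A" "e n = mvar n"
    using ne by (simp_all add: e_def)
  ultimately show ?thesis by blast
qed

text \<open>The last row reads c_n H + c_(n-1) y_0 = 0. As y_0 is prime and does not divide H,
  (c_(n-1), c_n) is a multiple of (- H, y_0). Subtracting that multiple of \<open>e\<close> leaves a
  relation between Hilbert--Burch columns, which \<open>hb_inj\<close> makes trivial.\<close>

lemma syz_kernel:
  fixes c e :: "nat \<Rightarrow> 'k::field_char_0 mpol"
  assumes n: "n \<ge> 2" and e: "\<And>j. e j \<in> polys n" "e (n - 1) = - grad_gen n {} (n - 1)" "e n = mvar n"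
    "\<And>p. p < Suc n \<Longrightarrow> (\<Sum>j<Suc n. e j * syz n {} j p) = 0"
    and c: "\<And>j. j < Suc n \<Longrightarrow> c j \<in> polys n" "\<And>p. p < Suc n \<Longrightarrow> (\<Sum>j<Suc n. c j * syz n {} j p) = 0"
  shows "\<exists>t\<in>polys n. \<forall>j<Suc n. c j = e j * t"
proof -
  let ?y = "hvar n {} :: nat \<Rightarrow> 'k mpol" and ?A = "grad_gen n {} (n - 1) :: 'k mpol"
  interpret prime_start ?y by (rule prime_start_hvar[OF n]) simp
  have y0: "?y 0 = mvar n" by (simp add: hvar_def)
  have split: "{..<Suc n} = insert n (insert (n - 1) {..<n-1})" using n by auto
  have ne: "n \<noteq> n - 1" "\<not> n < n - 1" using n by auto
  have A: "?A = fps_nth (recip_sq ?y) (n - 1)"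
    using n by (simp add: grad_gen_def hb_gen_def)
  have "(\<Sum>j<Suc n. c j * syz n {} j n) = c n * ?A + c (n - 1) * ?y 0"
    unfolding split using ne n by (simp add: syz_def)
  then have 0: "c n * ?A + c (n - 1) * ?y 0 = 0" using c(2)[of n] by simp
  then have "c n * ?A = ?y 0 * - c (n - 1)"
    by (simp add: eq_neg_iff_add_eq_0 mult.commute)
  then have "?y 0 dvd c n * ?A" by (rule dvdI)
  then have "?y 0 dvd c n"
    unfolding A using y0_prime not_y0_dvd_recip_sq by blast
  then obtain t where t: "c n = ?y 0 * t" ..
  have "?y 0 * (c (n - 1) + t * ?A) = 0"
    using 0 by (simp add: t algebra_simps)
  then have t': "c (n - 1) = - ?A * t"
    using y0_nz by (simp add: eq_neg_iff_add_eq_0 mult.commute)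
  define b where "b j = c j - e j * t" for j
  have b0: "b n = 0" "b (n - 1) = 0"
    unfolding b_def t t' e(2,3) y0 by simp_all
  have b: "(\<Sum>j<Suc n. b j * syz n {} j p) = 0" if "p < Suc n" for p
  proof -
    have "(\<Sum>j<Suc n. b j * syz n {} j p)
        = (\<Sum>j<Suc n. c j * syz n {} j p) - t * (\<Sum>j<Suc n. e j * syz n {} j p)"
      unfolding sum_distrib_left sum_subtractf[symmetric]
      by (intro sum.cong) (simp_all add: b_def algebra_simps)
    then show ?thesis using c(2)[OF that] e(4)[OF that] by simp
  qed
  have "(\<Sum>m=1..n-1. b (m - 1) * hb_mat ?y m p) = 0" if "p \<le> n - 1" for p
  proof -
    have p: "p < n" using that n by auto
    have "(\<Sum>m=1..n-1. b (m - 1) * hb_mat ?y m p) = (\<Sum>j<n-1. b j * hb_mat ?y (Suc j) p)"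
      by (rule sum.reindex_bij_witness[of _ Suc "\<lambda>m. m - 1"]) auto
    also have "\<dots> = (\<Sum>j<n-1. b j * syz n {} j p)"
      using p by (intro sum.cong) (auto simp: syz_def)
    also have "\<dots> = (\<Sum>j<Suc n. b j * syz n {} j p)"
      unfolding split using ne b0 by simp
    also have "\<dots> = 0" using b[of p] p by simp
    finally show ?thesis .
  qed
  then have "b (m - 1) = 0" if "1 \<le> m" "m \<le> n - 1" for m
    using hb_inj[of "n - 1" "\<lambda>m. b (m - 1)" m] that by blast
  then have "b j = 0" if "j < n - 1" for j
    using that by (metis Suc_leI diff_Suc_1 le_add1 plus_1_eq_Suc)
  moreover have "j < n - 1 \<or> j = n - 1 \<or> j = n" if "j < Suc n" for j
    using that by linarith
  ultimately have "b j = 0" if "j < Suc n" for j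
    using that b0 by blast
  then have ct: "c j = e j * t" if "j < Suc n" for j
    using that by (simp add: b_def)
  have "c j = e j * zap {n<..} t" if "j < Suc n" for j
  proof -
    have "c j = zap {n<..} (c j)" using c(1)[OF that] by (simp add: polys_iff_zap)
    also have "\<dots> = zap {n<..} (e j) * zap {n<..} t" by (simp only: ct[OF that] zap_mult)
    also have "zap {n<..} (e j) = e j" using e(1) by (simp add: polys_iff_zap)
    finally show ?thesis .
  qed
  then show ?thesis using polys_retract by blast
qed


section \<open>Assembly of the graded complex\<close>

lemma mult_mat_vec_eq:
  assumes "v \<in> carrier_vec c"
  shows "mat r c (\<lambda>(i, j). F i j) *\<^sub>v v = vec r (\<lambda>i. \<Sum>j<c. F i j * v $ j)"
  using assms by (intro eq_vecI) (auto simp: scalar_prod_def atLeast0LessThan intro!: sum.cong)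

lemma free_moduleI: "(\<And>i. i < r \<Longrightarrow> f i \<in> polys n) \<Longrightarrow> vec r f \<in> free_module n r"
  by (simp add: free_module_def)

lemma free_moduleD:
  assumes "v \<in> free_module n r"
  shows "v \<in> carrier_vec r" "i < r \<Longrightarrow> v $ i \<in> polys n"
  using assms by (auto simp: free_module_def)

lemma mat_graded_maps:
  assumes "r = length a" "c = length b"
    and "\<And>i j. i < r \<Longrightarrow> j < c \<Longrightarrow> F i j \<in> polys n \<and> homogeneous (int (b ! j) - int (a ! i)) (F i j)"
  shows "mat r c (\<lambda>(i, j). F i j) \<in> graded_maps n b a"
  using assms by (auto simp: graded_maps_def)

lemma graded_map_image:
  assumes "\<And>i j. i < r \<Longrightarrow> j < c \<Longrightarrow> F i j \<in> polys n"
    and "v \<in> free_module n c"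
  shows "mat r c (\<lambda>(i, j). F i j) *\<^sub>v v \<in> free_module n r"
  unfolding mult_mat_vec_eq[OF free_moduleD(1)[OF assms(2)]]
  using assms(1) free_moduleD(2)[OF assms(2)] by (intro free_moduleI polys_sum polys_closed(7)) auto

lemma all_less_Suc3: "(\<forall>i<Suc (Suc (Suc 0)). P i) \<longleftrightarrow> P 0 \<and> P (Suc 0) \<and> P (Suc (Suc 0))"
  by (auto simp: less_Suc_eq)

lemma all_less_Suc4: "(\<forall>i<Suc (Suc (Suc (Suc 0))). P i) \<longleftrightarrow> P 0 \<and> P (Suc 0) \<and> P (Suc (Suc 0)) \<and> P (Suc (Suc (Suc 0)))"
  by (auto simp: less_Suc_eq)

text \<open>Exactness at the two middle places is \<open>syz_exact\<close> and
  \<open>syz_kernel\<close>; at the left end the entry \<open>e n = mvar n\<close> gives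
  injectivity. Minimality holds because all entries are homogeneous of degree 1 or n - 1, both
  positive.\<close>

lemma grad_resolution:
  assumes n: "n \<ge> 2"
  shows "\<exists>d. minimal_graded_resolution n (combos n (Suc n) (grad_gen n {} :: nat \<Rightarrow> 'k::field_char_0 mpol))
    [[0], replicate (n + 1) (n - 1), replicate n n @ [2 * (n - 1)], [2 * n - 1]] d"
proof -
  let ?g = "grad_gen n {} :: nat \<Rightarrow> 'k mpol" and ?N = "Suc n"
  let ?J = "combos n ?N ?g"
  obtain e :: "nat \<Rightarrow> 'k mpol" where e: "\<And>j. e j \<in> polys n"
    "\<And>j. j < n \<Longrightarrow> homogeneous (int n - 1) (e j)" "e (n - 1) = - ?g (n - 1)" "e n = mvar n"
    "\<And>p. p < ?N \<Longrightarrow> (\<Sum>j<?N. e j * syz n {} j p) = 0"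
    using second_syzygy[OF n, where ?'k = 'k] by blast
  let ?a = "[[0], replicate (n + 1) (n - 1), replicate n n @ [2 * (n - 1)], [2 * n - 1]]"
  define d1 where "d1 = mat 1 ?N (\<lambda>(i, p). ?g p)"
  define d2 where "d2 = mat ?N ?N (\<lambda>(p, j). syz n {} j p :: 'k mpol)"
  define d3 where "d3 = mat ?N 1 (\<lambda>(j, i). e j)"
  have d1_mult: "d1 *\<^sub>v v = vec 1 (\<lambda>_. \<Sum>p<?N. v $ p * ?g p)" if "v \<in> carrier_vec ?N" for v
    unfolding d1_def mult_mat_vec_eq[OF that] by (simp only: mult.commute)
  have d2_mult: "d2 *\<^sub>v v = vec ?N (\<lambda>p. \<Sum>j<?N. v $ j * syz n {} j p)" if "v \<in> carrier_vec ?N" for v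
    unfolding d2_def mult_mat_vec_eq[OF that] by (simp only: mult.commute)
  have d3_mult: "d3 *\<^sub>v v = vec ?N (\<lambda>j. e j * v $ 0)" if "v \<in> carrier_vec 1" for v
    unfolding d3_def mult_mat_vec_eq[OF that] by simp
  have "d1 \<in> graded_maps n (replicate (n + 1) (n - 1)) [0]"
    unfolding d1_def
  proof (rule mat_graded_maps)
    fix i j :: nat assume "i < 1" "j < ?N"
    moreover have "int (n - 1) = int n - 1" using n by simp
    ultimately show "(?g j) \<in> polys n \<and>
        homogeneous (int (replicate (n + 1) (n - 1) ! j) - int ([0] ! i)) (?g j)"
      using homogeneous_grad_gen[OF n, of "{}" j, where ?'a = 'k] by (simp del: replicate_Suc)
  qed simp_all
  moreover have "d2 \<in> graded_maps n (replicate n n @ [2 * (n - 1)]) (replicate (n + 1) (n - 1))"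
    unfolding d2_def
  proof (rule mat_graded_maps)
    fix p j :: nat assume pj: "p < ?N" "j < ?N"
    have "int ((replicate n n @ [2 * (n - 1)]) ! j) - int (n - 1) = (if j < n then 1 else int n - 1)"
      using n pj by (auto simp: nth_append)
    then show "(syz n {} j p :: 'k mpol) \<in> polys n \<and>
        homogeneous (int ((replicate n n @ [2 * (n - 1)]) ! j) - int (replicate (n + 1) (n - 1) ! p))
          (syz n {} j p :: 'k mpol)"
      using homogeneous_syz[OF n, of j "{}" p, where ?'a = 'k] pj by (simp del: replicate_Suc)
  qed simp_all
  moreover have "d3 \<in> graded_maps n [2 * n - 1] (replicate n n @ [2 * (n - 1)])"
    unfolding d3_def
  proof (rule mat_graded_maps)
    fix j i :: nat assume ji: "j < ?N" "i < (1::nat)"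
    have "int (2 * n - 1) - int ((replicate n n @ [2 * (n - 1)]) ! j) = (if j < n then int n - 1 else 1)"
      using n ji by (auto simp: nth_append)
    moreover have "homogeneous (if j < n then int n - 1 else 1) (e j)"
      using e(2,4) ji homogeneous_mvar[of n, where ?'a = 'k] by (auto simp: less_Suc_eq)
    ultimately show "(e j) \<in> polys n \<and>
        homogeneous (int ([2 * n - 1] ! i) - int ((replicate n n @ [2 * (n - 1)]) ! j)) (e j)"
      using ji e(1) by simp
  qed simp_all
  ultimately have maps: "\<forall>i<3. [d1, d2, d3] ! i \<in> graded_maps n (?a ! Suc i) (?a ! i)"
    by (simp add: numeral_3_eq_3 all_less_Suc3 del: replicate_Suc)
  have ex0: "{v \<in> free_module n 1. v $ 0 \<in> ?J} = (*\<^sub>v) d1 ` free_module n ?N"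
  proof
    show "{v \<in> free_module n 1. v $ 0 \<in> ?J} \<subseteq> (*\<^sub>v) d1 ` free_module n ?N"
    proof
      fix v assume v: "v \<in> {v \<in> free_module n 1. v $ 0 \<in> ?J}"
      then obtain r where r: "v $ 0 = (\<Sum>p<?N. r p * ?g p)" "\<forall>p. r p \<in> polys n"
        by (auto elim: combosE)
      have "v = d1 *\<^sub>v vec ?N r"
        using v r by (intro eq_vecI) (auto simp: d1_mult free_module_def simp del: sum.lessThan_Suc)
      then show "v \<in> (*\<^sub>v) d1 ` free_module n ?N"
        using r by (auto intro: free_moduleI)
    qed
    show "(*\<^sub>v) d1 ` free_module n ?N \<subseteq> {v \<in> free_module n 1. v $ 0 \<in> ?J}"
    proof (rule image_subsetI)
      fix v :: "'k mpol vec" assume v: "v \<in> free_module n ?N"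
      then have "(\<Sum>p<?N. v $ p * ?g p) \<in> ?J"
        by (intro combosI free_moduleD)
      moreover have "d1 *\<^sub>v v \<in> free_module n 1"
        unfolding d1_def using v by (intro graded_map_image) auto
      ultimately show "d1 *\<^sub>v v \<in> {v \<in> free_module n 1. v $ 0 \<in> ?J}"
        using free_moduleD(1)[OF v] by (simp add: d1_mult)
    qed
  qed
  have ex1: "{v \<in> free_module n ?N. d1 *\<^sub>v v = 0\<^sub>v 1} = (*\<^sub>v) d2 ` free_module n ?N"
  proof
    show "{v \<in> free_module n ?N. d1 *\<^sub>v v = 0\<^sub>v 1} \<subseteq> (*\<^sub>v) d2 ` free_module n ?N"
    proof
      fix v assume v: "v \<in> {v \<in> free_module n ?N. d1 *\<^sub>v v = 0\<^sub>v 1}"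
      then have c: "v \<in> carrier_vec ?N" by (simp add: free_module_def)
      have "(d1 *\<^sub>v v) $ 0 = 0" using v by simp
      then have "(\<Sum>p<?N. v $ p * ?g p) = 0"
        unfolding d1_mult[OF c] by simp
      from syz_exact[OF n _ _ this] v obtain b where
        b: "\<And>j. b j \<in> polys n" "\<And>p. p < ?N \<Longrightarrow> v $ p = (\<Sum>j<?N. b j * syz n {} j p)"
        by (auto simp: free_module_def simp del: sum.lessThan_Suc)
      have "v = d2 *\<^sub>v vec ?N b"
        using c b by (intro eq_vecI) (auto simp: d2_mult simp del: sum.lessThan_Suc)
      then show "v \<in> (*\<^sub>v) d2 ` free_module n ?N"
        using b by (auto intro: free_moduleI)
    qed
    show "(*\<^sub>v) d2 ` free_module n ?N \<subseteq> {v \<in> free_module n ?N. d1 *\<^sub>v v = 0\<^sub>v 1}"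
    proof (rule image_subsetI)
      fix v :: "'k mpol vec" assume v: "v \<in> free_module n ?N"
      have im: "d2 *\<^sub>v v \<in> free_module n ?N"
        unfolding d2_def using v by (intro graded_map_image) auto
      have "(\<Sum>p<?N. (d2 *\<^sub>v v) $ p * ?g p) = (\<Sum>p<?N. \<Sum>j<?N. v $ j * (syz n {} j p * ?g p))"
        using free_moduleD(1)[OF v] by (intro sum.cong) (simp_all add: d2_mult sum_distrib_right mult.assoc del: sum.lessThan_Suc)
      also have "\<dots> = (\<Sum>j<?N. v $ j * (\<Sum>p<?N. syz n {} j p * ?g p))"
        unfolding sum_distrib_left by (rule sum.swap)
      also have "\<dots> = 0"
        by (intro sum.neutral ballI) (simp add: syz_grad_gen[OF n] del: sum.lessThan_Suc)
      finally have "d1 *\<^sub>v (d2 *\<^sub>v v) = 0\<^sub>v 1"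
        unfolding d1_mult[OF free_moduleD(1)[OF im]] by (intro eq_vecI) simp_all
      with im show "d2 *\<^sub>v v \<in> {v \<in> free_module n ?N. d1 *\<^sub>v v = 0\<^sub>v 1}" by simp
    qed
  qed
  have ex2: "{v \<in> free_module n ?N. d2 *\<^sub>v v = 0\<^sub>v ?N} = (*\<^sub>v) d3 ` free_module n 1"
  proof
    show "{v \<in> free_module n ?N. d2 *\<^sub>v v = 0\<^sub>v ?N} \<subseteq> (*\<^sub>v) d3 ` free_module n 1"
    proof
      fix v assume v: "v \<in> {v \<in> free_module n ?N. d2 *\<^sub>v v = 0\<^sub>v ?N}"
      then have c: "v \<in> carrier_vec ?N" by (simp add: free_module_def)
      have z: "(\<Sum>j<?N. v $ j * syz n {} j p) = 0" if "p < ?N" for p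
      proof -
        have "(d2 *\<^sub>v v) $ p = 0" using v that by simp
        then show ?thesis unfolding d2_mult[OF c] using that by simp
      qed
      have "\<exists>t\<in>polys n. \<forall>j<?N. v $ j = e j * t"
        by (rule syz_kernel[OF n e(1,3,4,5)]) (use v z in \<open>auto simp: free_module_def simp del: sum.lessThan_Suc\<close>)
      then obtain t where t: "t \<in> polys n" "\<And>j. j < ?N \<Longrightarrow> v $ j = e j * t" by blast
      have "v = d3 *\<^sub>v vec 1 (\<lambda>_. t)"
        using c t by (intro eq_vecI) (auto simp: d3_mult)
      then show "v \<in> (*\<^sub>v) d3 ` free_module n 1"
        using t by (auto intro: free_moduleI)
    qed
    show "(*\<^sub>v) d3 ` free_module n 1 \<subseteq> {v \<in> free_module n ?N. d2 *\<^sub>v v = 0\<^sub>v ?N}"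
    proof (rule image_subsetI)
      fix v :: "'k mpol vec" assume v: "v \<in> free_module n 1"
      have im: "d3 *\<^sub>v v \<in> free_module n ?N"
        unfolding d3_def using v e(1) by (intro graded_map_image) auto
      have "(\<Sum>j<?N. (d3 *\<^sub>v v) $ j * syz n {} j p) = v $ 0 * (\<Sum>j<?N. e j * syz n {} j p)" for p
        using free_moduleD(1)[OF v] unfolding sum_distrib_left by (intro sum.cong) (simp_all add: d3_mult mult_ac)
      then have "d2 *\<^sub>v (d3 *\<^sub>v v) = 0\<^sub>v ?N"
        unfolding d2_mult[OF free_moduleD(1)[OF im]] using e(5)
        by (intro eq_vecI) (simp_all del: sum.lessThan_Suc)
      with im show "d3 *\<^sub>v v \<in> {v \<in> free_module n ?N. d2 *\<^sub>v v = 0\<^sub>v ?N}" by simp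
    qed
  qed
  have ex3: "{v \<in> free_module n 1. d3 *\<^sub>v v = 0\<^sub>v ?N} = {0\<^sub>v 1}"
  proof -
    have "v = 0\<^sub>v 1" if v: "v \<in> free_module n 1" "d3 *\<^sub>v v = 0\<^sub>v ?N" for v :: "'k mpol vec"
    proof -
      have "(d3 *\<^sub>v v) $ n = 0" using v by simp
      then have "mvar n * v $ 0 = 0"
        using free_moduleD(1)[OF v(1)] e(4) by (simp add: d3_mult)
      then have "v $ 0 = 0" by simp
      then show ?thesis using free_moduleD(1)[OF v(1)] by (intro eq_vecI) auto
    qed
    moreover have "d3 *\<^sub>v 0\<^sub>v 1 = 0\<^sub>v ?N"
      by (subst d3_mult) (auto intro: eq_vecI)
    ultimately show ?thesis by (auto simp: free_module_def)
  qed
  have "graded_resolution n ?J ?a [d1, d2, d3]"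
    unfolding graded_resolution_def
  proof (intro conjI)
    show "\<forall>i<length [d1, d2, d3]. [d1, d2, d3] ! i \<in> graded_maps n (?a ! Suc i) (?a ! i)"
      using maps by (simp add: numeral_3_eq_3)
    show "\<forall>i<length ?a. cycles n ?J ?a [d1, d2, d3] i = boundaries n ?a [d1, d2, d3] i"
      using ex0 ex1 ex2 ex3
      by (simp add: all_less_Suc4 cycles_def boundaries_def del: replicate_Suc)
  qed simp_all
  moreover have "\<forall>A\<in>set [d1, d2, d3]. \<forall>i<dim_row A. \<forall>j<dim_col A. A $$ (i, j) \<in> irrelevant_ideal n"
  proof -
    have "?g p \<in> irrelevant_ideal n" for p
      by (rule homogeneous_irrelevant[OF _ homogeneous_grad_gen[OF n]]) (use n in auto)
    moreover have "syz n {} j p \<in> (irrelevant_ideal n :: 'k mpol set)" for j p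
      by (rule homogeneous_irrelevant[OF _ homogeneous_syz[OF n]]) (use n in auto)
    moreover have "e j \<in> irrelevant_ideal n" if "j < ?N" for j
    proof (cases "j < n")
      case True
      then show ?thesis
        using homogeneous_irrelevant[OF e(1) e(2)] n by auto
    next
      case False
      then have "j = n" using that by simp
      then show ?thesis
        using homogeneous_irrelevant[OF e(1)[of n], of 1] homogeneous_mvar e(4) by auto
    qed
    ultimately show ?thesis
      by (auto simp: d1_def d2_def d3_def)
  qed
  ultimately show ?thesis
    unfolding minimal_graded_resolution_def by blast
qed


subsection \<open>Algebraic dependence\<close>

fun monom_eval :: "'a::comm_monoid_mult list \<Rightarrow> nat list \<Rightarrow> 'a" where
  "monom_eval [] es = 1"
| "monom_eval (x # xs) es = x ^ hd es * monom_eval xs (tl es)"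

lemma monom_eval_polys: "set xs \<subseteq> polys n \<Longrightarrow> monom_eval xs es \<in> polys n"
  by (induction xs es rule: monom_eval.induct) auto

lemma zap_monom_eval: "zap S (monom_eval xs es) = monom_eval (map (zap S) xs) es"
  by (induction xs es rule: monom_eval.induct) (simp_all add: zap_mult zap_power)

text \<open>Bounding each exponent separately, rather than the total degree, makes the number of
  monomials at most a plain power.\<close>

definition mbox :: "nat \<Rightarrow> nat set \<Rightarrow> (nat \<Rightarrow>\<^sub>0 nat) set" where
  "mbox B W = {m. msupp m \<subseteq> W \<and> (\<forall>i. mcoeff m i \<le> B)}"

lemma mbox_finite_card:
  assumes "finite W"
  shows "finite (mbox B W) \<and> card (mbox B W) \<le> (B + 1) ^ card W"
proof -
  let ?T = "PiE W (\<lambda>_. {..B})" and ?f = "\<lambda>m. restrict (mcoeff m) W"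
  have inj: "inj_on ?f (mbox B W)"
  proof (rule inj_onI)
    fix a b assume ab: "a \<in> mbox B W" "b \<in> mbox B W" "?f a = ?f b"
    show "a = b"
    proof (rule poly_mapping_eqI)
      fix i
      show "mcoeff a i = mcoeff b i"
      proof (cases "i \<in> W")
        case True
        then show ?thesis using fun_cong[OF ab(3), of i] by simp
      next
        case False
        then have "i \<notin> msupp a" "i \<notin> msupp b" using ab by (auto simp: mbox_def)
        then show ?thesis by (simp add: in_keys_iff)
      qed
    qed
  qed
  have sub: "?f ` mbox B W \<subseteq> ?T" by (auto simp: mbox_def)
  have fin: "finite ?T" using assms by (intro finite_PiE) auto
  have "finite (mbox B W)" using inj_on_finite[OF inj sub fin] .
  moreover have "card (mbox B W) \<le> card ?T" using card_inj_on_le[OF inj sub fin] .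
  ultimately show ?thesis using assms by (simp add: card_PiE)
qed

lemma mbox_mult:
  fixes p q :: "'k::field mpol"
  assumes "msupp p \<subseteq> mbox A W" "msupp q \<subseteq> mbox B W"
  shows "msupp (p * q) \<subseteq> mbox (A + B) W"
proof
  fix m assume "m \<in> msupp (p * q)"
  then obtain a b where ab: "m = a + b" "a \<in> msupp p" "b \<in> msupp q"
    using Poly_Mapping.keys_mult[of p q] by blast
  then have "a \<in> mbox A W" "b \<in> mbox B W" using assms by auto
  then show "m \<in> mbox (A + B) W"
    by (auto simp: ab mbox_def keys_add_nat lookup_add add_mono)
qed

lemma mbox_mono: "A \<le> B \<Longrightarrow> mbox A W \<subseteq> mbox B W"
  by (auto simp: mbox_def intro: le_trans)

lemma mbox_power:
  fixes p :: "'k::field mpol"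
  assumes "msupp p \<subseteq> mbox A W"
  shows "msupp (p ^ k) \<subseteq> mbox (k * A) W"
proof (induction k)
  case (Suc k)
  then show ?case using mbox_mult[OF assms Suc] by simp
qed (simp add: mbox_def)

lemma mbox_monom_eval:
  fixes xs :: "'k::field mpol list"
  assumes "\<forall>x\<in>set xs. msupp x \<subseteq> mbox D W" "length es = length xs" "set es \<subseteq> {..<N}"
  shows "msupp (monom_eval xs es) \<subseteq> mbox (length xs * (N * D)) W"
  using assms
proof (induction xs arbitrary: es)
  case Nil
  then show ?case by (simp add: mbox_def)
next
  case (Cons x xs)
  then obtain e fs where es: "es = e # fs" by (cases es) auto
  have "msupp (x ^ e) \<subseteq> mbox (e * D) W"
    using Cons.prems by (intro mbox_power) auto
  also have "\<dots> \<subseteq> mbox (N * D) W"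
    using Cons.prems by (intro mbox_mono) (auto simp: es)
  finally have "msupp (x ^ e * monom_eval xs fs) \<subseteq> mbox (N * D + length xs * (N * D)) W"
    using Cons.prems by (intro mbox_mult Cons.IH) (auto simp: es)
  then show ?case by (simp add: es)
qed

interpretation mpol_space: vector_space "\<lambda>c (p :: 'k::field mpol). mterm 0 c * p"
  by unfold_locales
    (simp_all add: algebra_simps single_add mult_single flip: mult.assoc single_one)

text \<open>By counting: the \<open>N ^ length xs\<close> products with exponents below
  \<open>N\<close> lie in the span of a box of monomials whose side is linear in \<open>N\<close>,
  so of dimension at most a constant times \<open>N ^ card W\<close>.\<close>

lemma algebraically_dependent:
  fixes xs :: "'k::field mpol list"
  assumes W: "finite W" "card W < length xs" and xs: "\<And>x m. x \<in> set xs \<Longrightarrow> m \<in> msupp x \<Longrightarrow> msupp m \<subseteq> W"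
  shows "\<exists>E c. finite E \<and> E \<noteq> {} \<and> (\<forall>es\<in>E. length es = length xs \<and> c es \<noteq> 0) \<and>
    (\<Sum>es\<in>E. mterm 0 (c es) * monom_eval xs es) = 0"
proof -
  define l d where "l = length xs" and "d = card W"
  let ?X = "\<Union>x\<in>set xs. \<Union>m\<in>msupp x. mcoeff m ` msupp m"
  define D where "D = Max (insert 0 ?X)"
  have "mcoeff m i \<le> D" if "x \<in> set xs" "m \<in> msupp x" for x m i
  proof (cases "i \<in> msupp m")
    case True
    then show ?thesis unfolding D_def using that by (intro Max_ge) auto
  qed (simp add: in_keys_iff)
  with xs have box: "\<forall>x\<in>set xs. msupp x \<subseteq> mbox D W"
    by (auto simp: mbox_def)
  \<comment> \<open>Chosen so that (B + 1)^d \<le> N^d (l D + 1)^d < N^(d+1) \<le> N^l for the bound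
    \<open>B\<close> defined next.\<close>
  define N where "N = (l * D + 1) ^ d + 1"
  define B where "B = l * (N * D)"
  define E0 where "E0 = {es. set es \<subseteq> {..<N} \<and> length es = l}"
  have E0: "finite E0" "card E0 = N ^ l"
    unfolding E0_def using finite_lists_length_eq[of "{..<N}" l] card_lists_length_eq[of "{..<N}" l] by auto
  define T where "T = (\<lambda>m. mterm m (1::'k)) ` mbox B W"
  have T: "finite T" "card T \<le> (B + 1) ^ d"
    using mbox_finite_card[OF W(1), of B] card_image_le[of "mbox B W" "\<lambda>m. mterm m (1::'k)"]
    unfolding T_def d_def by auto
  have "B + 1 \<le> N * (l * D + 1)"
    by (simp add: B_def N_def algebra_simps)
  then have "(B + 1) ^ d \<le> N ^ d * (l * D + 1) ^ d"
    by (metis power_mono power_mult_distrib zero_le)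
  also have "\<dots> < N ^ d * N"
    by (simp add: N_def)
  also have "\<dots> \<le> N ^ l"
    using W(2) power_increasing[of "Suc d" l N] by (simp add: N_def l_def d_def mult.commute)
  finally have card: "card T < card E0" using T E0 by simp
  show ?thesis
  proof (cases "inj_on (monom_eval xs) E0")
    \<comment> \<open>Linear dependence concerns the set of values. If two exponent lists give the
      same value, the difference of the two products is already a relation.\<close>
    case False
    then obtain a b where ab: "a \<in> E0" "b \<in> E0" "a \<noteq> b" "monom_eval xs a = monom_eval xs b"
      by (auto simp: inj_on_def)
    show ?thesis
      using ab by (intro exI[of _ "{a, b}"] exI[of _ "\<lambda>es. if es = a then 1 else - 1"])
        (auto simp: E0_def l_def single_uminus)
  next
    case True
    let ?S = "monom_eval xs ` E0"
    have "?S \<subseteq> mpol_space.span T"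
    proof
      fix p assume "p \<in> ?S"
      then have p: "msupp p \<subseteq> mbox B W"
        using mbox_monom_eval[OF box, of _ N] by (auto simp: E0_def B_def l_def)
      have "(\<Sum>m\<in>msupp p. mterm 0 (mcoeff p m) * mterm m 1) \<in> mpol_space.span T"
        using p by (intro mpol_space.span_sum mpol_space.span_scale mpol_space.span_base) (auto simp: T_def)
      also have "(\<Sum>m\<in>msupp p. mterm 0 (mcoeff p m) * mterm m 1) = p"
        by (rule poly_mapping_eqI) (simp add: mult_single lookup_sum lookup_single when_def in_keys_iff)
      finally show "p \<in> mpol_space.span T" .
    qed
    then have "mpol_space.dependent ?S"
      using mpol_space.independent_span_bound[OF T(1), of ?S] card card_image[OF True] by fastforce
    then obtain u where u: "\<exists>v\<in>?S. u v \<noteq> 0" "(\<Sum>v\<in>?S. mterm 0 (u v) * v) = 0"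
      using mpol_space.dependent_finite[of ?S] E0(1) by auto
    let ?E = "{es \<in> E0. u (monom_eval xs es) \<noteq> 0}"
    have "(\<Sum>es\<in>E0. mterm 0 (u (monom_eval xs es)) * monom_eval xs es) = 0"
      using u(2) by (simp add: sum.reindex[OF True])
    also have "(\<Sum>es\<in>E0. mterm 0 (u (monom_eval xs es)) * monom_eval xs es)
        = (\<Sum>es\<in>?E. mterm 0 (u (monom_eval xs es)) * monom_eval xs es)"
      using E0(1) by (intro sum.mono_neutral_right) auto
    finally have "(\<Sum>es\<in>?E. mterm 0 (u (monom_eval xs es)) * monom_eval xs es) = 0" .
    moreover have "finite ?E" using E0(1) by simp
    moreover have "?E \<noteq> {}" using u(1) by auto
    moreover have "\<forall>es\<in>?E. length es = length xs \<and> u (monom_eval xs es) \<noteq> 0"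
      by (simp add: E0_def l_def)
    ultimately show ?thesis
      by (intro exI[of _ ?E] exI[of _ "\<lambda>es. u (monom_eval xs es)"] conjI)
  qed
qed

text \<open>Dividing a polynomial relation by the largest power of the first element and reducing
  modulo that element leaves a nonzero relation between the remaining ones, so the
  lexicographically lowest coefficient survives.\<close>

lemma lowest_coefficient_descent:
  fixes xs :: "'k::field mpol list" and V :: "nat \<Rightarrow> 'k mpol set"
  assumes "\<And>i. i \<le> length xs \<Longrightarrow> ideal (V i) (mpoly_ring n)"
    and "\<And>i. i < length xs \<Longrightarrow> V i \<subseteq> V (Suc i)"
    and "\<And>i. i < length xs \<Longrightarrow> xs ! i \<in> V (Suc i)"
    and "\<And>i b. i < length xs \<Longrightarrow> b \<in> polys n \<Longrightarrow> xs ! i * b \<in> V i \<Longrightarrow> b \<in> V i"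
    and "set xs \<subseteq> polys n"
    and "finite E" "E \<noteq> {}" "\<And>es. es \<in> E \<Longrightarrow> length es = length xs \<and> c es \<noteq> 0"
    and "(\<Sum>es\<in>E. mterm 0 (c es) * monom_eval xs es) \<in> V 0"
  shows "1 \<in> V (length xs)"
  using assms
proof (induction xs arbitrary: V E c)
  case Nil
  then have E: "E = {[]}" by auto
  have "mterm 0 (inverse (c [])) * mterm 0 (c []) \<in> V 0"
    using Nil.prems(1)[of 0] Nil.prems(9) by (intro mpoly_ideal_mult) (auto simp: E)
  moreover have "c [] \<noteq> 0" using Nil.prems(8) E by auto
  ultimately show ?case by (simp add: mult_single)
next
  case (Cons x xs)
  have x: "x \<in> polys n" and xs: "set xs \<subseteq> polys n" using Cons.prems(5) by auto
  have id: "ideal (V 0) (mpoly_ring n)" "ideal (V 1) (mpoly_ring n)"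
    using Cons.prems(1)[of 0] Cons.prems(1)[of 1] by auto
  define a where "a = Min (hd ` E)"
  have a_le: "a \<le> hd es" if "es \<in> E" for es
    unfolding a_def using that Cons.prems(6) by auto
  have a_in: "a \<in> hd ` E"
    unfolding a_def using Cons.prems(6,7) by auto
  define E0 where "E0 = {es \<in> E. hd es = a}"
  let ?t = "\<lambda>es. mterm 0 (c es) * monom_eval xs (tl es)"
  have tP: "?t es \<in> polys n" for es
    using monom_eval_polys[OF xs] by simp
  \<comment> \<open>The relation equals \<open>x ^ a * (Y0 + x * Y1)\<close>, where
    \<open>Y0\<close> collects the terms of least exponent in \<open>x\<close>.\<close>
  define Y0 where "Y0 = (\<Sum>es\<in>E0. ?t es)"
  define Y1 where "Y1 = (\<Sum>es\<in>E - E0. x ^ (hd es - Suc a) * ?t es)"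
  have YP: "Y0 \<in> polys n" "Y1 \<in> polys n"
    unfolding Y0_def Y1_def using tP x by (auto intro!: polys_sum)
  have "(\<Sum>es\<in>E. mterm 0 (c es) * monom_eval (x # xs) es) = (\<Sum>es\<in>E. x ^ hd es * ?t es)"
    by (intro sum.cong) (simp_all add: mult_ac)
  also have "\<dots> = (\<Sum>es\<in>E0. x ^ hd es * ?t es) + (\<Sum>es\<in>E - E0. x ^ hd es * ?t es)"
    using Cons.prems(6) by (subst sum.subset_diff[of E0]) (auto simp: E0_def)
  also have "(\<Sum>es\<in>E0. x ^ hd es * ?t es) = x ^ a * Y0"
    unfolding Y0_def sum_distrib_left by (intro sum.cong) (auto simp: E0_def)
  also have "(\<Sum>es\<in>E - E0. x ^ hd es * ?t es) = x ^ a * (x * Y1)"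
    unfolding Y1_def sum_distrib_left
  proof (intro sum.cong refl)
    fix es assume "es \<in> E - E0"
    then have "hd es = a + Suc (hd es - Suc a)"
      using a_le[of es] by (auto simp: E0_def)
    then have "x ^ hd es = x ^ a * (x * x ^ (hd es - Suc a))"
      by (metis power_Suc power_add)
    then show "x ^ hd es * ?t es = x ^ a * (x * (x ^ (hd es - Suc a) * ?t es))"
      by (simp only: mult.assoc)
  qed
  finally have "x ^ a * (Y0 + x * Y1) \<in> V 0"
    using Cons.prems(9) by (simp only: distrib_left)
  moreover have nzd: "x ^ k * b \<in> V 0 \<Longrightarrow> b \<in> V 0" if "b \<in> polys n" for k b
  proof (induction k)
    case (Suc k)
    then show ?case
      using Cons.prems(4)[of 0 "x ^ k * b"] that x by (simp add: mult.assoc)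
  qed simp
  ultimately have "Y0 + x * Y1 \<in> V 0"
    using YP x by (intro nzd[of "Y0 + x * Y1" a]) auto
  then have "Y0 + x * Y1 \<in> V 1"
    using Cons.prems(2)[of 0] by auto
  moreover have "Y1 * x \<in> V 1"
    using Cons.prems(3)[of 0] YP by (intro mpoly_ideal_mult[OF id(2)]) auto
  ultimately have "Y0 \<in> V 1"
    using mpoly_ideal_diff[OF id(2), of "Y0 + x * Y1" "Y1 * x"] by (simp add: mult.commute)
  have E0_cons: "es = a # tl es" if "es \<in> E0" for es
    using that Cons.prems(8)[of es] by (cases es) (auto simp: E0_def)
  have "inj_on tl E0"
    by (rule inj_onI) (metis E0_cons)
  then have "(\<Sum>fs\<in>tl ` E0. mterm 0 (c (a # fs)) * monom_eval xs fs)
      = (\<Sum>es\<in>E0. mterm 0 (c (a # tl es)) * monom_eval xs (tl es))"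
    by (rule sum.reindex[unfolded comp_def])
  also have "\<dots> = Y0"
    unfolding Y0_def
  proof (intro sum.cong refl)
    fix es assume "es \<in> E0"
    then have "c (a # tl es) = c es"
      using arg_cong[OF E0_cons, of es c] by simp
    then show "mterm 0 (c (a # tl es)) * monom_eval xs (tl es) = ?t es" by simp
  qed
  finally have sum_in: "(\<Sum>fs\<in>tl ` E0. mterm 0 (c (a # fs)) * monom_eval xs fs) \<in> V (Suc 0)"
    using \<open>Y0 \<in> V 1\<close> by simp
  have "1 \<in> V (Suc (length xs))"
  proof (rule Cons.IH[of "\<lambda>i. V (Suc i)" "tl ` E0" "\<lambda>fs. c (a # fs)"])
    show "ideal (V (Suc i)) (mpoly_ring n)" if "i \<le> length xs" for i
      using Cons.prems(1)[of "Suc i"] that by simp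
    show "V (Suc i) \<subseteq> V (Suc (Suc i))" if "i < length xs" for i
      using Cons.prems(2)[of "Suc i"] that by simp
    show "xs ! i \<in> V (Suc (Suc i))" if "i < length xs" for i
      using Cons.prems(3)[of "Suc i"] that by simp
    show "b \<in> V (Suc i)" if "i < length xs" "b \<in> polys n" "xs ! i * b \<in> V (Suc i)" for i b
      using Cons.prems(4)[of "Suc i" b] that by simp
    show "finite (tl ` E0)" "tl ` E0 \<noteq> {}"
      using Cons.prems(6) a_in by (auto simp: E0_def)
    show "length fs = length xs \<and> c (a # fs) \<noteq> 0" if "fs \<in> tl ` E0" for fs
      using that Cons.prems(8) E0_cons by (force simp: E0_def)
  qed (use xs sum_in in auto)
  then show ?case by simp
qed

subsection \<open>Powers of weakly regular sequences\<close>

definition adjoin :: "nat \<Rightarrow> 'k::field mpol set \<Rightarrow> 'k mpol \<Rightarrow> 'k mpol set" where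
  "adjoin n I x = {a + r * x | a r. a \<in> I \<and> r \<in> polys n}"

definition colon :: "nat \<Rightarrow> 'k::field mpol set \<Rightarrow> 'k mpol \<Rightarrow> 'k mpol set" where
  "colon n I x = {b \<in> polys n. x * b \<in> I}"

text \<open>Properness of the final ideal is left out, so that the statements about colon ideals and
  powers need not track it; it is checked separately where \<open>regular_sequence\<close> is
  concerned.\<close>

fun weakly_regular :: "nat \<Rightarrow> 'k::field mpol set \<Rightarrow> 'k mpol list \<Rightarrow> bool" where
  "weakly_regular n I [] \<longleftrightarrow> True"
| "weakly_regular n I (x # xs) \<longleftrightarrow>
    (\<forall>b\<in>polys n. x * b \<in> I \<longrightarrow> b \<in> I) \<and> weakly_regular n (adjoin n I x) xs"

lemma adjoinI: "a \<in> I \<Longrightarrow> r \<in> polys n \<Longrightarrow> a + r * x \<in> adjoin n I x"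
  by (auto simp: adjoin_def)

lemma ideal_adjoin:
  fixes I :: "'k::field mpol set"
  assumes I: "ideal I (mpoly_ring n)" and x: "x \<in> polys n"
  shows "ideal (adjoin n I x) (mpoly_ring n)"
proof (rule ideal_mpoly_ringI)
  show "adjoin n I x \<subseteq> polys n"
    using mpoly_ideal_subset[OF I] x by (auto simp: adjoin_def)
  show "0 \<in> adjoin n I x"
    using adjoinI[OF mpoly_ideal_zero[OF I], of 0] by simp
  fix a b assume "a \<in> adjoin n I x" "b \<in> adjoin n I x"
  then obtain i j r s where "a = i + r * x" "b = j + s * x" "i \<in> I" "j \<in> I" "r \<in> polys n" "s \<in> polys n"
    by (auto simp: adjoin_def)
  then show "a + b \<in> adjoin n I x"
    using adjoinI[OF mpoly_ideal_add[OF I, of i j], of "r + s" n x] by (simp add: algebra_simps)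
next
  fix c a :: "'k mpol" assume "c \<in> polys n" "a \<in> adjoin n I x"
  then obtain i r where "c \<in> polys n" "a = i + r * x" "i \<in> I" "r \<in> polys n"
    by (auto simp: adjoin_def)
  then show "c * a \<in> adjoin n I x"
    using adjoinI[OF mpoly_ideal_mult[OF I, of i c], of "c * r" n x] by (simp add: algebra_simps)
qed

lemma ideal_colon:
  fixes I :: "'k::field mpol set"
  assumes I: "ideal I (mpoly_ring n)" and x: "x \<in> polys n"
  shows "ideal (colon n I x) (mpoly_ring n)"
proof (rule ideal_mpoly_ringI)
  fix c a :: "'k mpol" assume "c \<in> polys n" "a \<in> colon n I x"
  then show "c * a \<in> colon n I x"
    using mpoly_ideal_mult[OF I, of "x * a" c] by (auto simp: colon_def mult_ac)
qed (auto simp: colon_def distrib_left mpoly_ideal_zero[OF I] intro: mpoly_ideal_add[OF I])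

lemma adjoin_superset:
  assumes "ideal I (mpoly_ring n)"
  shows "I \<subseteq> adjoin n I x" "x \<in> adjoin n I x"
proof -
  show "I \<subseteq> adjoin n I x" using adjoinI[of _ I 0 n x] by auto
  show "x \<in> adjoin n I x" using adjoinI[OF mpoly_ideal_zero[OF assms], of 1] by simp
qed

lemma adjoin_least:
  assumes "ideal K (mpoly_ring n)" "I \<subseteq> K" "x \<in> K"
  shows "adjoin n I x \<subseteq> K"
  using assms by (auto simp: adjoin_def intro!: mpoly_ideal_add[OF assms(1)] mpoly_ideal_mult[OF assms(1)])

lemma adjoin_commute:
  assumes "ideal I (mpoly_ring n)" "x \<in> polys n" "y \<in> polys n"
  shows "adjoin n (adjoin n I x) y = adjoin n (adjoin n I y) x"
proof -
  have "adjoin n (adjoin n I x) y \<subseteq> adjoin n (adjoin n I y) x"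
    if xy: "x \<in> polys n" "y \<in> polys n" for x y
  proof -
    have id: "ideal (adjoin n I y) (mpoly_ring n)" "ideal (adjoin n (adjoin n I y) x) (mpoly_ring n)"
      using assms(1) xy by (auto intro: ideal_adjoin)
    have "adjoin n I y \<subseteq> adjoin n (adjoin n I y) x" by (rule adjoin_superset[OF id(1)])
    then show ?thesis
      using adjoin_superset[OF assms(1), of y] adjoin_superset(2)[OF id(1), of x]
      by (intro adjoin_least id) auto
  qed
  then show ?thesis using assms by blast
qed

text \<open>A snake argument: if \<open>b\<close> is a nonzerodivisor modulo I + x, the exact
  sequence relating I : x, I and I + x stays exact after reduction modulo \<open>b\<close>. This
  carries the induction in \<open>weakly_regular_extension\<close>.\<close>

lemma colon_adjoin:
  assumes I: "ideal I (mpoly_ring n)" and x: "x \<in> polys n" and b: "b \<in> polys n"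
    and nzd: "\<forall>u\<in>polys n. b * u \<in> adjoin n I x \<longrightarrow> u \<in> adjoin n I x"
  shows "colon n (adjoin n I b) x = adjoin n (colon n I x) b"
proof
  show "adjoin n (colon n I x) b \<subseteq> colon n (adjoin n I b) x"
  proof (rule adjoin_least)
    show "ideal (colon n (adjoin n I b) x) (mpoly_ring n)"
      using I x b by (intro ideal_colon ideal_adjoin)
    show "colon n I x \<subseteq> colon n (adjoin n I b) x"
      using adjoin_superset(1)[OF I, of b] by (auto simp: colon_def)
    show "b \<in> colon n (adjoin n I b) x"
      using mpoly_ideal_mult[OF ideal_adjoin[OF I b] adjoin_superset(2)[OF I] x] b by (simp add: colon_def)
  qed
  show "colon n (adjoin n I b) x \<subseteq> adjoin n (colon n I x) b"
  proof
    fix u assume "u \<in> colon n (adjoin n I b) x"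
    then obtain i v where u: "u \<in> polys n" "x * u = i + v * b" "i \<in> I" "v \<in> polys n"
      by (auto simp: colon_def adjoin_def)
    have "b * v = - i + u * x" using u by (simp add: algebra_simps)
    also have "\<dots> \<in> adjoin n I x"
      by (intro adjoinI mpoly_ideal_uminus[OF I] u)
    finally have "v \<in> adjoin n I x" using nzd u by blast
    then obtain j w where v: "v = j + w * x" "j \<in> I" "w \<in> polys n"
      by (auto simp: adjoin_def)
    have "x * (u - w * b) = i + b * j"
      using u(2) by (simp add: v algebra_simps)
    also have "\<dots> \<in> I"
      by (intro mpoly_ideal_add[OF I] mpoly_ideal_mult[OF I] u v b)
    finally have "u - w * b \<in> colon n I x"
      using u v b by (simp add: colon_def)
    from adjoinI[OF this v(3), of b] show "u \<in> adjoin n (colon n I x) b" by simp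
  qed
qed

text \<open>In terms of modules this is the exact sequence
  \<open>0 \<rightarrow> R/(I : x) \<rightarrow> R/I \<rightarrow> R/(I + x) \<rightarrow> 0\<close>.\<close>

lemma weakly_regular_extension:
  assumes "ideal I (mpoly_ring n)" "x \<in> polys n" "set bs \<subseteq> polys n"
    and "weakly_regular n (colon n I x) bs" "weakly_regular n (adjoin n I x) bs"
  shows "weakly_regular n I bs"
  using assms
proof (induction bs arbitrary: I)
  case (Cons b bs)
  have b: "b \<in> polys n" using Cons.prems by simp
  have nzd: "\<forall>u\<in>polys n. b * u \<in> adjoin n I x \<longrightarrow> u \<in> adjoin n I x"
    using Cons.prems(5) by simp
  have "u \<in> I" if u: "u \<in> polys n" "b * u \<in> I" for u
  proof -
    have "u \<in> adjoin n I x"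
      using nzd u adjoin_superset(1)[OF Cons.prems(1)] by blast
    then obtain i v where v: "u = i + v * x" "i \<in> I" "v \<in> polys n" by (auto simp: adjoin_def)
    have "x * (b * v) = b * u - b * i" by (simp add: v algebra_simps)
    also have "\<dots> \<in> I"
      by (rule mpoly_ideal_diff[OF Cons.prems(1) u(2) mpoly_ideal_mult[OF Cons.prems(1) v(2) b]])
    finally have "b * v \<in> colon n I x" using v b by (simp add: colon_def)
    then have "v \<in> colon n I x" using Cons.prems(4) v by simp
    then have "x * v \<in> I" by (simp add: colon_def)
    then have "i + x * v \<in> I" using Cons.prems(1) v by (intro mpoly_ideal_add)
    then show ?thesis by (simp add: v mult.commute)
  qed
  moreover have "weakly_regular n (adjoin n I b) bs"
  proof (rule Cons.IH)
    show "weakly_regular n (colon n (adjoin n I b) x) bs"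
      using Cons.prems colon_adjoin[OF Cons.prems(1,2) b nzd] by simp
    show "weakly_regular n (adjoin n (adjoin n I b) x) bs"
      using Cons.prems(5) adjoin_commute[OF Cons.prems(1,2) b] by simp
  qed (use Cons.prems b in \<open>auto intro: ideal_adjoin\<close>)
  ultimately show ?case by simp
qed simp

lemma power_nonzerodivisor:
  assumes "\<forall>b\<in>polys n. x * b \<in> I \<longrightarrow> b \<in> I" "x \<in> polys n" "b \<in> polys n" "x ^ k * b \<in> I"
  shows "b \<in> I"
  using assms(4)
proof (induction k)
  case (Suc k)
  then have "x * (x ^ k * b) \<in> I" by (simp only: power_Suc mult.assoc)
  moreover have "x ^ k * b \<in> polys n" using assms(2,3) by (intro polys_closed)
  ultimately have "x ^ k * b \<in> I" using assms(1) by blast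
  then show ?case by (rule Suc.IH)
qed simp

text \<open>For K = I + x^(k+2) and z = x^(k+1) one has K : z = I + x and K + z = I + x^(k+1), so
  \<open>weakly_regular_extension\<close> passes from one power to the next.\<close>

lemma weakly_regular_power_head:
  assumes I: "ideal I (mpoly_ring n)" and x: "x \<in> polys n" "set xs \<subseteq> polys n"
    and reg: "weakly_regular n I (x # xs)"
  shows "weakly_regular n (adjoin n I (x ^ Suc k)) xs"
proof (induction k)
  case 0
  then show ?case using reg by simp
next
  case (Suc k)
  let ?K = "adjoin n I (x ^ Suc (Suc k))" and ?z = "x ^ Suc k"
  have K: "ideal ?K (mpoly_ring n)" using I x by (intro ideal_adjoin polys_closed)
  have nzd: "\<forall>b\<in>polys n. x * b \<in> I \<longrightarrow> b \<in> I" using reg by simp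
  have z: "?z \<in> polys n" using x by (intro polys_closed)
  have "colon n ?K ?z = adjoin n I x"
  proof
    show "colon n ?K ?z \<subseteq> adjoin n I x"
    proof
      fix b assume "b \<in> colon n ?K ?z"
      then obtain i r where b: "b \<in> polys n" "?z * b = i + r * x ^ Suc (Suc k)" "i \<in> I" "r \<in> polys n"
        by (auto simp: colon_def adjoin_def)
      have "?z * (b - r * x) = i" using b(2) by (simp add: algebra_simps)
      then have "b - r * x \<in> I"
        using power_nonzerodivisor[OF nzd x(1), of "b - r * x" "Suc k"] b x by auto
      from adjoinI[OF this b(4), of x] show "b \<in> adjoin n I x" by simp
    qed
    have "?z * x \<in> ?K"
      using adjoin_superset(2)[OF I, of "x ^ Suc (Suc k)"] by (simp add: mult_ac)
    moreover have "I \<subseteq> colon n ?K ?z"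
      using adjoin_superset(1)[OF I] mpoly_ideal_mult[OF I _ z] mpoly_ideal_subset[OF I]
      by (auto simp: colon_def)
    ultimately show "adjoin n I x \<subseteq> colon n ?K ?z"
      using K z x by (intro adjoin_least ideal_colon) (auto simp: colon_def)
  qed
  moreover have "adjoin n ?K ?z = adjoin n I ?z"
  proof
    have id: "ideal (adjoin n I ?z) (mpoly_ring n)" by (rule ideal_adjoin[OF I z])
    have "x * ?z \<in> adjoin n I ?z"
      using mpoly_ideal_mult[OF id adjoin_superset(2)[OF I] x(1)] .
    then have "x ^ Suc (Suc k) \<in> adjoin n I ?z" by simp
    then have "?K \<subseteq> adjoin n I ?z"
      by (rule adjoin_least[OF id adjoin_superset(1)[OF I]])
    then show "adjoin n ?K ?z \<subseteq> adjoin n I ?z"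
      by (rule adjoin_least[OF id _ adjoin_superset(2)[OF I]])
    show "adjoin n I ?z \<subseteq> adjoin n ?K ?z"
      by (rule adjoin_least[OF ideal_adjoin[OF K z] order_trans[OF adjoin_superset(1)[OF I] adjoin_superset(1)[OF K]]
            adjoin_superset(2)[OF K]])
  qed
  ultimately show ?case
    using weakly_regular_extension[OF K z x(2)] reg Suc.IH by simp
qed

lemma weakly_regular_powers:
  assumes "ideal I (mpoly_ring n)" "set xs \<subseteq> polys n" "weakly_regular n I xs"
  shows "weakly_regular n I (map (\<lambda>x. x ^ Suc k) xs)"
  using assms
proof (induction xs arbitrary: I)
  case (Cons x xs)
  then have x: "x \<in> polys n" "set xs \<subseteq> polys n" by auto
  have "\<forall>b\<in>polys n. x * b \<in> I \<longrightarrow> b \<in> I" using Cons.prems by simp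
  then have "b \<in> I" if "b \<in> polys n" "x ^ Suc k * b \<in> I" for b
    by (rule power_nonzerodivisor[OF _ x(1) that])
  moreover have "weakly_regular n (adjoin n I (x ^ Suc k)) (map (\<lambda>x. x ^ Suc k) xs)"
    using Cons.prems x by (intro Cons.IH weakly_regular_power_head ideal_adjoin polys_closed)
  ultimately show ?case by simp
qed simp

lemma ideal_foldl_adjoin:
  "ideal I (mpoly_ring n) \<Longrightarrow> set xs \<subseteq> polys n \<Longrightarrow> ideal (foldl (adjoin n) I xs) (mpoly_ring n)"
  by (induction xs arbitrary: I) (auto intro: ideal_adjoin)

lemma foldl_adjoin_superset:
  "ideal I (mpoly_ring n) \<Longrightarrow> set xs \<subseteq> polys n \<Longrightarrow> I \<subseteq> foldl (adjoin n) I xs \<and> set xs \<subseteq> foldl (adjoin n) I xs"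
proof (induction xs arbitrary: I)
  case (Cons x xs)
  then have "adjoin n I x \<subseteq> foldl (adjoin n) (adjoin n I x) xs \<and> set xs \<subseteq> foldl (adjoin n) (adjoin n I x) xs"
    by (intro Cons.IH) (auto intro: ideal_adjoin)
  then show ?case using adjoin_superset[OF Cons.prems(1), of x] by auto
qed simp

lemma foldl_adjoin_least:
  "ideal K (mpoly_ring n) \<Longrightarrow> I \<subseteq> K \<Longrightarrow> set xs \<subseteq> K \<Longrightarrow> foldl (adjoin n) I xs \<subseteq> K"
  by (induction xs arbitrary: I) (auto dest: adjoin_least)

lemma genideal_eq_foldl_adjoin:
  assumes "ideal I (mpoly_ring n)" "set xs \<subseteq> polys n"
  shows "genideal (mpoly_ring n) (I \<union> set xs) = foldl (adjoin n) I xs"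
proof
  have sub: "I \<union> set xs \<subseteq> polys n" using assms mpoly_ideal_subset by blast
  show "genideal (mpoly_ring n) (I \<union> set xs) \<subseteq> foldl (adjoin n) I xs"
    using foldl_adjoin_superset[OF assms] ideal_foldl_adjoin[OF assms] by (intro genideal_least) auto
  show "foldl (adjoin n) I xs \<subseteq> genideal (mpoly_ring n) (I \<union> set xs)"
    using genideal_incl[OF sub] by (intro foldl_adjoin_least ideal_genideal sub) auto
qed

lemma weakly_regular_iff_nth:
  "weakly_regular n I xs \<longleftrightarrow> (\<forall>i<length xs. \<forall>b\<in>polys n.
     xs ! i * b \<in> foldl (adjoin n) I (take i xs) \<longrightarrow> b \<in> foldl (adjoin n) I (take i xs))"
proof (induction xs arbitrary: I)
  case (Cons x xs)
  have "(\<forall>i<length (x # xs). P i) \<longleftrightarrow> P 0 \<and> (\<forall>i<length xs. P (Suc i))" for P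
    by (auto simp: less_Suc_eq_0_disj)
  then show ?case by (simp add: Cons.IH)
qed simp


subsection \<open>Quotients\<close>

lemma mpoly_ring_minus:
  assumes "(b :: 'k::field mpol) \<in> polys n"
  shows "a \<ominus>\<^bsub>mpoly_ring n\<^esub> b = a - b"
proof -
  have "\<ominus>\<^bsub>mpoly_ring n\<^esub> b = - b"
    by (rule mpoly_ring.minus_equality) (use assms in auto)
  then show ?thesis by (simp add: a_minus_def)
qed

context
  fixes J :: "'k::field mpol set" and n
  assumes J: "ideal J (mpoly_ring n)"
begin

abbreviation "cls \<equiv> (+>\<^bsub>mpoly_ring n\<^esub>) J"

lemma carrier_quot: "carrier (mpoly_ring n Quot J) = cls ` polys n"
  by (auto simp: FactRing_def A_RCOSETS_def')

lemma ring_quot: "ring (mpoly_ring n Quot J)" and cring_quot: "cring (mpoly_ring n Quot J)"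
  using ideal.quotient_is_ring[OF J] ideal.quotient_is_cring[OF J cring_mpoly_ring] .

lemma cls_hom: "ring_hom_ring (mpoly_ring n) (mpoly_ring n Quot J) cls"
  by (rule ideal.rcos_ring_hom_ring[OF J])

lemma cls_mult:
  "a \<in> polys n \<Longrightarrow> b \<in> polys n \<Longrightarrow> cls a \<otimes>\<^bsub>mpoly_ring n Quot J\<^esub> cls b = cls (a * b)"
  using ring_hom_mult[OF ideal.rcos_ring_hom[OF J], of a b] by simp

lemma cls_eq_iff: "a \<in> polys n \<Longrightarrow> b \<in> polys n \<Longrightarrow> cls a = cls b \<longleftrightarrow> a - b \<in> J"
  using mpoly_ring.quotient_eq_iff_same_a_r_cos[OF J, of a b] by (simp add: mpoly_ring_minus)

lemma cls_mem_image_iff: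
  assumes K: "ideal K (mpoly_ring n)" "J \<subseteq> K" and a: "a \<in> polys n"
  shows "cls a \<in> cls ` K \<longleftrightarrow> a \<in> K"
proof
  assume "cls a \<in> cls ` K"
  then obtain k where k: "k \<in> K" "cls a = cls k" by blast
  then have "a - k \<in> K"
    using cls_eq_iff[OF a, of k] mpoly_ideal_subset[OF K(1)] K(2) by blast
  from mpoly_ideal_add[OF K(1) this k(1)] show "a \<in> K" by simp
qed simp

lemma ideal_cls_image:
  assumes "ideal K (mpoly_ring n)" "J \<subseteq> K"
  shows "ideal (cls ` K) (mpoly_ring n Quot J)"
  using bij_betw_apply[OF mpoly_ring.quot_ideal_correspondence[OF J], of K] assms by simp

lemma genideal_quot:
  assumes X: "X \<subseteq> polys n"
  shows "genideal (mpoly_ring n Quot J) (cls ` X) = cls ` genideal (mpoly_ring n) (J \<union> X)"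
proof
  have sub: "J \<union> X \<subseteq> polys n" using X mpoly_ideal_subset[OF J] by blast
  note K = ideal_genideal[OF sub] and JX = genideal_incl[OF sub]
  show "genideal (mpoly_ring n Quot J) (cls ` X) \<subseteq> cls ` genideal (mpoly_ring n) (J \<union> X)"
    using JX by (intro ring.genideal_minimal[OF ring_quot] ideal_cls_image K) auto
  have cX: "cls ` X \<subseteq> carrier (mpoly_ring n Quot J)" using X carrier_quot by blast
  let ?K' = "genideal (mpoly_ring n Quot J) (cls ` X)"
  have K': "ideal ?K' (mpoly_ring n Quot J)"
    by (rule ring.genideal_ideal[OF ring_quot cX])
  let ?K = "{r \<in> polys n. cls r \<in> ?K'}"
  have K: "ideal ?K (mpoly_ring n)"
    by (rule ring_hom_ring.ideal_vimage[OF cls_hom K'])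
  have "cls j \<in> ?K'" if "j \<in> J" for j
  proof -
    have "j \<in> polys n" using that mpoly_ideal_subset[OF J] by blast
    then have "cls j = cls 0" using that by (simp add: cls_eq_iff)
    moreover have "0 \<in> ?K" by (rule mpoly_ideal_zero[OF K])
    ultimately show ?thesis by simp
  qed
  moreover have "cls ` X \<subseteq> ?K'" by (rule ring.genideal_self[OF ring_quot cX])
  ultimately have "J \<union> X \<subseteq> ?K" using sub by auto
  then have "genideal (mpoly_ring n) (J \<union> X) \<subseteq> ?K" by (rule genideal_least[OF K])
  then show "cls ` genideal (mpoly_ring n) (J \<union> X) \<subseteq> ?K'" by auto
qed

lemma regular_sequence_quot:
  assumes xs: "set xs \<subseteq> polys n"
  shows "regular_sequence (mpoly_ring n Quot J) (map cls xs) \<longleftrightarrow>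
    1 \<notin> foldl (adjoin n) J xs \<and> weakly_regular n J xs"
proof -
  have gen: "genideal (mpoly_ring n Quot J) (set (map cls ys)) = cls ` foldl (adjoin n) J ys"
    if "set ys \<subseteq> polys n" for ys
    using genideal_quot[OF that] genideal_eq_foldl_adjoin[OF J that] by simp
  have mem: "cls a \<in> cls ` foldl (adjoin n) J ys \<longleftrightarrow> a \<in> foldl (adjoin n) J ys"
    if "set ys \<subseteq> polys n" "a \<in> polys n" for ys a
    using cls_mem_image_iff[OF ideal_foldl_adjoin[OF J that(1)] _ that(2)] foldl_adjoin_superset[OF J that(1)]
    by blast
  have "genideal (mpoly_ring n Quot J) (set (map cls xs)) \<noteq> carrier (mpoly_ring n Quot J)
      \<longleftrightarrow> 1 \<notin> foldl (adjoin n) J xs"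
  proof -
    have "cls ` foldl (adjoin n) J xs = cls ` polys n \<longleftrightarrow> 1 \<in> foldl (adjoin n) J xs"
      using mem[OF xs, of 1] mpoly_ideal_eq_carrier_iff[OF ideal_foldl_adjoin[OF J xs]]
      by (metis image_eqI polys_closed(2))
    then show ?thesis using gen[OF xs] carrier_quot by simp
  qed
  moreover have "(\<forall>b\<in>carrier (mpoly_ring n Quot J).
        (map cls xs ! i) \<otimes>\<^bsub>mpoly_ring n Quot J\<^esub> b \<in> genideal (mpoly_ring n Quot J) (set (take i (map cls xs)))
        \<longrightarrow> b \<in> genideal (mpoly_ring n Quot J) (set (take i (map cls xs))))
      \<longleftrightarrow> (\<forall>b\<in>polys n. xs ! i * b \<in> foldl (adjoin n) J (take i xs) \<longrightarrow> b \<in> foldl (adjoin n) J (take i xs))"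
    if i: "i < length xs" for i
  proof -
    have tk: "set (take i xs) \<subseteq> polys n" using xs set_take_subset[of i xs] by blast
    have xi: "xs ! i \<in> polys n" using xs i by auto
    have g: "genideal (mpoly_ring n Quot J) (set (take i (map cls xs))) = cls ` foldl (adjoin n) J (take i xs)"
      using gen[OF tk] by (simp add: take_map)
    show ?thesis
      unfolding g carrier_quot using mem[OF tk] xi i
      by (simp add: cls_mult)
  qed
  moreover have "set (map cls xs) \<subseteq> carrier (mpoly_ring n Quot J)"
    unfolding carrier_quot using xs by auto
  ultimately show ?thesis
    unfolding regular_sequence_def weakly_regular_iff_nth[of n J xs] length_map by blast
qed

lemma primeideal_vimage:
  assumes P: "primeideal P (mpoly_ring n Quot J)"
  shows "primeideal {r \<in> polys n. cls r \<in> P} (mpoly_ring n)"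
proof -
  interpret P: primeideal P "mpoly_ring n Quot J" by (rule P)
  interpret h: ring_hom_ring "mpoly_ring n" "mpoly_ring n Quot J" cls by (rule cls_hom)
  show ?thesis
  proof (rule primeidealI)
    show "ideal {r \<in> polys n. cls r \<in> P} (mpoly_ring n)"
      by (rule h.ideal_vimage) (rule P.is_ideal)
    show "polys n \<noteq> {r \<in> polys n. cls r \<in> P}"
    proof
      assume "polys n = {r \<in> polys n. cls r \<in> P}"
      then have "cls 1 \<in> P" by blast
      then have "P = carrier (mpoly_ring n Quot J)"
        using P.one_imp_carrier h.hom_one by simp
      then show False using P.I_notcarr by simp
    qed
    fix a b assume ab: "a \<in> polys n" "b \<in> polys n" "a \<otimes>\<^bsub>mpoly_ring n\<^esub> b \<in> {r \<in> polys n. cls r \<in> P}"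
    then have "cls a \<otimes>\<^bsub>mpoly_ring n Quot J\<^esub> cls b \<in> P" by (simp add: cls_mult)
    then show "a \<in> {r \<in> polys n. cls r \<in> P} \<or> b \<in> {r \<in> polys n. cls r \<in> P}"
      using P.I_prime[of "cls a" "cls b"] ab carrier_quot by auto
  qed (rule cring_mpoly_ring)
qed

lemma primeideal_image:
  assumes P: "primeideal P (mpoly_ring n)" "J \<subseteq> P"
  shows "primeideal (cls ` P) (mpoly_ring n Quot J)"
proof -
  interpret P: primeideal P "mpoly_ring n" by (rule P)
  note mem = cls_mem_image_iff[OF P.is_ideal P(2)]
  show ?thesis
  proof (rule primeidealI)
    show "ideal (cls ` P) (mpoly_ring n Quot J)" by (rule ideal_cls_image[OF P.is_ideal P(2)])
    have "1 \<notin> P" using P.one_imp_carrier P.I_notcarr by auto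
    then show "carrier (mpoly_ring n Quot J) \<noteq> cls ` P"
      using mem[of 1] carrier_quot by (metis image_eqI polys_closed(2))
    fix a b assume "a \<in> carrier (mpoly_ring n Quot J)" "b \<in> carrier (mpoly_ring n Quot J)"
      and ab: "a \<otimes>\<^bsub>mpoly_ring n Quot J\<^esub> b \<in> cls ` P"
    then obtain a' b' where "a = cls a'" "b = cls b'" "a' \<in> polys n" "b' \<in> polys n"
      unfolding carrier_quot by blast
    then show "a \<in> cls ` P \<or> b \<in> cls ` P"
      using ab P.I_prime[of a' b'] by (simp add: cls_mult mem)
  qed (rule cring_quot)
qed

end

lemma primeideal_zap: "primeideal {p \<in> polys n. zap T p = (0 :: 'k::field mpol)} (mpoly_ring n)"
proof (rule primeidealI)
  show "ideal {p \<in> polys n. zap T p = (0 :: 'k mpol)} (mpoly_ring n)"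
    by (rule ideal_mpoly_ringI) (auto simp: zap_add zap_mult)
  have "1 \<in> polys n" "1 \<notin> {p \<in> polys n. zap T p = (0 :: 'k mpol)}" by simp_all
  then show "polys n \<noteq> {p \<in> polys n. zap T p = (0 :: 'k mpol)}" by blast
qed (auto simp: zap_mult cring_mpoly_ring)

subsection \<open>The gradient ideal\<close>

abbreviation grad_ideal :: "nat \<Rightarrow> 'k::field mpol set" where
  "grad_ideal n \<equiv> combos n (Suc n) (grad_gen n {})"

lemma ideal_grad_ideal: "ideal (grad_ideal n) (mpoly_ring n)"
  by (rule ideal_combos) simp

lemma grad_gen_mem: "p \<le> n \<Longrightarrow> grad_gen n {} p \<in> grad_ideal n"
  by (rule combos_gen) simp

text \<open>With y_0 = y_1 = 0 the series \<open>recip_sq\<close> is constant, and its constant term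
  comes with a positive power of y_0. For \<open>last_gen\<close> that power is n - 2, whence n
  \<ge> 3.\<close>

lemma grad_gen_zero:
  assumes n: "n \<ge> 3" and S: "n \<in> S" "n - 1 \<in> S"
  shows "grad_gen n S p = (0 :: 'k::field mpol)"
proof -
  let ?y = "hvar n S :: nat \<Rightarrow> 'k mpol"
  have y: "?y 0 = 0" "?y 1 = 0" using S by (simp_all add: hvar_def)
  \<comment> \<open>Since \<open>?y 0 = 0\<close>, the divisibility in
    \<open>recip_sq_mod_y0\<close> is an equality.\<close>
  have H: "fps_nth (recip_sq ?y) m = 0" if "m > 0" for m
    using recip_sq_mod_y0[of ?y m] that unfolding y by simp
  show ?thesis
  proof (cases "p < n")
    case True
    then have "hb_gen ?y (n - 1) p = 0"
      using n H[of "n - 1"] by (cases "p = n - 1") (auto simp: hb_gen_def y(1))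
    then show ?thesis using True by (simp add: grad_gen_def)
  next
    case False
    have "?y 0 ^ (n - 2 - p) * fps_nth (recip_sq ?y) p = 0" if "p < n - 1" for p
      using n H[of p] that unfolding y by (cases "p = 0") auto
    then have "last_gen ?y n = 0"
      unfolding last_gen_def by (intro sum.neutral ballI) (simp add: mult.assoc)
    then show ?thesis using False by (simp add: grad_gen_def)
  qed
qed

lemma of_nat_inverse:
  "k > 0 \<Longrightarrow> mterm 0 (1 / of_nat k) * of_nat k = (1 :: 'k::field_char_0 mpol)"
  unfolding of_nat_conv_single mult_single by simp

lemma of_nat_cancel_ideal:
  assumes I: "ideal I (mpoly_ring n)" and "k > 0" "of_nat k * a \<in> I"
  shows "(a :: 'k::field_char_0 mpol) \<in> I"
proof -
  have "mterm 0 (1 / of_nat k) * (of_nat k * a) \<in> I"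
    by (rule mpoly_ideal_mult[OF I assms(3)]) simp
  then show ?thesis
    by (simp only: mult.assoc[symmetric] of_nat_inverse[OF assms(2)] mult_1_left)
qed

text \<open>Generator 0 is y_0^(n-1), and generator n - 1 is congruent to n (- y_1)^(n-1) modulo
  y_0.\<close>

lemma prime_over_grad_ideal:
  assumes n: "n \<ge> 3" and P: "primeideal P (mpoly_ring n)"
    and sub: "(grad_ideal n :: 'k::field_char_0 mpol set) \<subseteq> P"
  shows "mvar n \<in> P" "mvar (n - 1) \<in> P"
proof -
  interpret P: primeideal P "mpoly_ring n" by (rule P)
  have one: "1 \<notin> P" using P.one_imp_carrier P.I_notcarr by auto
  have root: "x \<in> P" if "x ^ k \<in> P" "x \<in> polys n" for x k
    using that
  proof (induction k)
    case 0
    then show ?case using one by simp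
  next
    case (Suc k)
    then show ?case using P.I_prime[of x "x ^ k"] by auto
  qed
  let ?y = "hvar n {} :: nat \<Rightarrow> 'k mpol"
  have "grad_gen n {} 0 = (mvar n ^ (n - 1) :: 'k mpol)"
    using n by (simp add: grad_gen_def hb_gen_def hvar_def)
  then have "mvar n ^ (n - 1) \<in> P"
    using grad_gen_mem[of 0 n] sub by force
  then show y0: "mvar n \<in> P" by (rule root) simp
  have gen: "grad_gen n {} (n - 1) = fps_nth (recip_sq ?y) (n - 1)"
    using n by (simp add: grad_gen_def hb_gen_def)
  have y00: "?y 0 = mvar n" by (simp add: hvar_def)
  have y1: "zap {n} (- ?y 1) = - mvar (n - 1)"
    using n by (simp add: hvar_def zap_uminus zap_mvar)
  have "zap {n} (fps_nth (recip_sq ?y) (n - 1) - of_nat (Suc (n - 1)) * (- ?y 1) ^ (n - 1)) = 0"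
    using recip_sq_mod_y0[of ?y "n - 1"] unfolding y00 mvar_dvd_iff .
  then have zap: "zap {n} (grad_gen n {} (n - 1)) = (of_nat (Suc (n - 1)) * (- mvar (n - 1)) ^ (n - 1) :: 'k mpol)"
    unfolding gen zap_diff zap_mult zap_of_nat zap_power y1 by (rule right_minus_eq[THEN iffD1])
  have mem: "grad_gen n {} (n - 1) \<in> P" using grad_gen_mem[of "n - 1" n] sub by auto
  have "grad_gen n {} (n - 1) - zap {n} (grad_gen n {} (n - 1)) \<in> P"
    by (rule diff_zap_in_ideal[OF P.is_ideal]) (use y0 in auto)
  from mpoly_ideal_diff[OF P.is_ideal mem this]
  have "of_nat (Suc (n - 1)) * (- mvar (n - 1)) ^ (n - 1) \<in> P"
    unfolding zap by simp
  then have "(- mvar (n - 1)) ^ (n - 1) \<in> P"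
    by (rule of_nat_cancel_ideal[OF P.is_ideal zero_less_Suc])
  then have "- mvar (n - 1) \<in> P" by (rule root) simp
  from mpoly_ideal_uminus[OF P.is_ideal this] show "mvar (n - 1) \<in> P" by simp
qed

subsection \<open>Dimension\<close>

text \<open>The chain starts at (x_(n-1), x_n) and adjoins x_(n-2), ..., x_0 one at a time.\<close>

lemma krull_dim_lower:
  assumes n: "n \<ge> 3"
  shows "enat (n - 1) \<le> krull_dim (mpoly_ring n Quot (grad_ideal n :: 'k::field_char_0 mpol set))"
proof -
  let ?J = "grad_ideal n :: 'k mpol set"
  note J = ideal_grad_ideal[of n, where ?'a = 'k]
  define P where "P i = {p \<in> polys n. zap {n - 1 - i..n} p = (0 :: 'k mpol)}" for i
  have P: "primeideal (P i) (mpoly_ring n)" for i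
    unfolding P_def by (rule primeideal_zap)
  have idP: "ideal (P i) (mpoly_ring n)" for i
    using P by (rule primeideal.axioms(1))
  have JP: "?J \<subseteq> P i" for i
  proof -
    have "n \<in> {n - 1 - i..n}" "n - 1 \<in> {n - 1 - i..n}" by simp_all
    from grad_gen_zero[OF n this] have "grad_gen n {} p \<in> P i" for p
      by (simp only: P_def mem_Collect_eq zap_grad_gen Un_empty_right grad_gen_polys simp_thms)
    then show ?thesis by (rule combos_least[OF idP])
  qed
  let ?c = "(+>\<^bsub>mpoly_ring n\<^esub>) ?J"
  have "?c ` P i \<subset> ?c ` P (Suc i)" if i: "i < n - 1" for i
  proof
    have "zap {n - 1 - Suc i..n} p = zap {n - 1 - Suc i..n} (zap {n - 1 - i..n} p)" for p :: "'k mpol"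
    proof -
      have "{n - 1 - Suc i..n} \<union> {n - 1 - i..n} = {n - 1 - Suc i..n}" by auto
      then show ?thesis by (simp only: zap_zap)
    qed
    then have "P i \<subseteq> P (Suc i)" by (auto simp: P_def) (metis zap_zero)
    then show "?c ` P i \<subseteq> ?c ` P (Suc i)" by blast
    let ?x = "mvar (n - 1 - Suc i) :: 'k mpol"
    have x: "?x \<in> polys n" by (rule polys_mvar) simp
    have "?x \<in> P (Suc i)" "?x \<notin> P i"
      using i x by (auto simp: P_def zap_mvar)
    then have "?c ?x \<in> ?c ` P (Suc i)" "?c ?x \<notin> ?c ` P i"
      using cls_mem_image_iff[OF J idP JP x] by auto
    then show "?c ` P i \<noteq> ?c ` P (Suc i)" by blast
  qed
  moreover have "primeideal (?c ` P i) (mpoly_ring n Quot ?J)" for i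
    by (rule primeideal_image[OF J P JP])
  ultimately show ?thesis
    unfolding krull_dim_def
    by (intro Sup_upper CollectI exI[of _ "n - 1"] exI[of _ "\<lambda>i. ?c ` P i"] conjI) auto
qed

text \<open>In a chain with n strict steps, choose an element entering at each step. Modulo
  (x_(n-1), x_n) these are n polynomials in n - 1 variables, hence dependent. Each is a
  nonzerodivisor modulo the prime before it, so the descent puts 1 into a prime.\<close>

lemma krull_dim_upper:
  assumes n: "n \<ge> 3"
  shows "krull_dim (mpoly_ring n Quot (grad_ideal n :: 'k::field_char_0 mpol set)) \<le> enat (n - 1)"
  unfolding krull_dim_def
proof (rule Sup_least)
  let ?J = "grad_ideal n :: 'k mpol set"
  note J = ideal_grad_ideal[of n, where ?'a = 'k]
  let ?c = "(+>\<^bsub>mpoly_ring n\<^esub>) ?J"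
  fix e assume "e \<in> {enat l | l. \<exists>P. (\<forall>i\<le>l. primeideal (P i) (mpoly_ring n Quot ?J)) \<and> (\<forall>i<l. P i \<subset> P (Suc i))}"
  then obtain l P where e: "e = enat l" and P: "\<And>i. i \<le> l \<Longrightarrow> primeideal (P i) (mpoly_ring n Quot ?J)"
    and chain: "\<And>i. i < l \<Longrightarrow> P i \<subset> P (Suc i)" by blast
  have "l \<le> n - 1"
  proof (rule ccontr)
    assume "\<not> l \<le> n - 1"
    then have l: "n \<le> l" by simp
    define V where "V i = {r \<in> polys n. ?c r \<in> P i}" for i
    have V: "primeideal (V i) (mpoly_ring n)" if "i \<le> n" for i
      unfolding V_def using P that l by (intro primeideal_vimage[OF J]) auto
    have idV: "ideal (V i) (mpoly_ring n)" if "i \<le> n" for i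
      using V[OF that] by (rule primeideal.axioms(1))
    have mono: "V i \<subseteq> V (Suc i)" if "i < n" for i
      using chain[of i] that l by (auto simp: V_def)
    have JV: "?J \<subseteq> V 0"
    proof
      fix j assume j: "j \<in> ?J"
      then have jP: "j \<in> polys n" using mpoly_ideal_subset[OF J] by blast
      then have "?c j = ?c 0" using j by (simp add: cls_eq_iff[OF J])
      moreover have "0 \<in> V 0" by (rule mpoly_ideal_zero[OF idV]) simp
      ultimately show "j \<in> V 0" using jP by (simp add: V_def)
    qed
    have y: "mvar i \<in> V 0" if "i \<in> {n - 1, n}" for i
      using prime_over_grad_ideal[OF n V[of 0] JV] that by auto
    have V0: "V 0 \<subseteq> V i" if "i \<le> n" for i
      using that
    proof (induction i)
      case (Suc i)
      then show ?case using mono[of i] by fastforce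
    qed simp
    have "\<exists>x. x \<in> V (Suc i) \<and> x \<notin> V i" if i: "i < n" for i
    proof -
      have "P i \<subset> P (Suc i)" using chain i l by simp
      then obtain q where q: "q \<in> P (Suc i)" "q \<notin> P i" by blast
      have "P (Suc i) \<subseteq> carrier (mpoly_ring n Quot ?J)"
        using P[of "Suc i"] i l by (auto dest!: primeideal.axioms(1) ideal.axioms(1) additive_subgroup.a_subset)
      then obtain x where "x \<in> polys n" "q = ?c x"
        using q carrier_quot[OF J] by auto
      then show ?thesis using q by (auto simp: V_def)
    qed
    then obtain x where x: "\<And>i. i < n \<Longrightarrow> x i \<in> V (Suc i) \<and> x i \<notin> V i" by metis
    have xP: "x i \<in> polys n" if "i < n" for i using x[OF that] by (simp add: V_def)
    \<comment> \<open>Setting x_(n-1) and x_n to 0 does not affect membership in any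
      \<open>V j\<close>, since both variables lie in \<open>V 0\<close>.\<close>
    define xs where "xs = map (\<lambda>i. zap {n - 1, n} (x i)) [0..<n]"
    have diff: "x i - zap {n - 1, n} (x i) \<in> V j" if "i < n" "j \<le> n" for i j
      using y V0[OF that(2)] xP[OF that(1)] by (intro diff_zap_in_ideal[OF idV[OF that(2)]]) auto
    have zx: "zap {n - 1, n} (x i) \<in> V (Suc i)" "zap {n - 1, n} (x i) \<notin> V i" if "i < n" for i
    proof -
      show "zap {n - 1, n} (x i) \<in> V (Suc i)"
        using mpoly_ideal_diff[OF idV _ diff[of i "Suc i"], of "x i"] x[OF that] that by simp
      show "zap {n - 1, n} (x i) \<notin> V i"
        using mpoly_ideal_add[OF idV diff[of i i], of "zap {n - 1, n} (x i)"] x[OF that] that by auto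
    qed
    have "\<exists>E c. finite E \<and> E \<noteq> {} \<and> (\<forall>es\<in>E. length es = length xs \<and> c es \<noteq> 0) \<and>
        (\<Sum>es\<in>E. mterm 0 (c es) * monom_eval xs es) = 0"
    proof (rule algebraically_dependent[of "{..<n-1}"])
      show "card {..<n-1} < length xs" using n by (simp add: xs_def)
      fix z m assume "z \<in> set xs" "m \<in> msupp z"
      then obtain i where i: "i < n" "m \<in> msupp (zap {n - 1, n} (x i))" by (auto simp: xs_def)
      then have "msupp m \<subseteq> {..n}" "msupp m \<inter> {n - 1, n} = {}"
        using xP[of i] by (auto simp: keys_zap polys_iff)
      then show "msupp m \<subseteq> {..<n-1}" by fastforce
    qed simp
    then obtain E c where E: "finite E" "E \<noteq> {}" "\<And>es. es \<in> E \<Longrightarrow> length es = length xs \<and> c es \<noteq> 0"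
      "(\<Sum>es\<in>E. mterm 0 (c es) * monom_eval xs es) = 0" by blast
    have len: "length xs = n" by (simp add: xs_def)
    have "1 \<in> V (length xs)"
    proof (rule lowest_coefficient_descent[OF _ _ _ _ _ E(1-3)])
      show "(\<Sum>es\<in>E. mterm 0 (c es) * monom_eval xs es) \<in> V 0"
        unfolding E(4) by (rule mpoly_ideal_zero[OF idV]) simp
      show "b \<in> V i" if "i < length xs" "b \<in> polys n" "xs ! i * b \<in> V i" for i b
        using primeideal.I_prime[OF V[of i], of "xs ! i" b] that zx(2)[of i] xP[of i]
        by (auto simp: len) (auto simp: xs_def)
    qed (use idV mono zx xP in \<open>auto simp: xs_def\<close>)
    then have "1 \<in> V n" by (simp add: len)
    then show False
      using primeideal.I_notcarr[OF V[of n]] mpoly_ideal_eq_carrier_iff[OF idV[of n]] by auto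
  qed
  then show "e \<le> enat (n - 1)" by (simp add: e)
qed


subsection \<open>Depth\<close>

lemma zap_singleton_dvd_polys:
  assumes "p \<in> polys n" "zap {i} p = 0"
  shows "\<exists>q\<in>polys n. p = mvar i * (q :: 'k::field mpol)"
proof -
  obtain q where q: "p = mvar i * q" using assms(2) mvar_dvd_iff[of i p] by (auto elim: dvdE)
  show ?thesis
  proof (cases "i \<le> n")
    case True
    have "p = zap {n<..} (mvar i * q)" using assms(1) q by (simp add: polys_iff_zap)
    also have "\<dots> = mvar i * zap {n<..} q" using True by (simp add: zap_mult zap_mvar)
    finally show ?thesis using polys_retract by blast
  next
    case False
    have "p = zap {n<..} (mvar i * q)" using assms(1) q by (simp add: polys_iff_zap)
    also have "\<dots> = 0" using False by (simp add: zap_mult zap_mvar)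
    finally show ?thesis by (intro bexI[of _ 0]) auto
  qed
qed

text \<open>Once x_0, ..., x_(i-1) are adjoined, membership depends only on the specialisation, so
  the nonzerodivisor test can be made with \<open>grad_gen n {..<i}\<close>.\<close>

lemma foldl_adjoin_mvars:
  assumes "i \<le> n"
  shows "foldl (adjoin n) (grad_ideal n) (map mvar [0..<i])
    = {b \<in> polys n. zap {..<i} b \<in> combos n (Suc n) (grad_gen n {..<i} :: nat \<Rightarrow> 'k::field mpol)}"
    (is "?K = ?W")
proof
  note J = ideal_grad_ideal[of n, where ?'a = 'k]
  have C: "ideal (combos n (Suc n) (grad_gen n {..<i} :: nat \<Rightarrow> 'k mpol)) (mpoly_ring n)"
    by (rule ideal_combos) simp
  have xs: "set (map mvar [0..<i]) \<subseteq> (polys n :: 'k mpol set)" using assms by auto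
  have W: "ideal ?W (mpoly_ring n)"
    by (rule ideal_mpoly_ringI)
      (auto simp: zap_add zap_mult mpoly_ideal_zero[OF C] intro: mpoly_ideal_add[OF C] mpoly_ideal_mult[OF C])
  have "grad_gen n {} p \<in> ?W" if "p < Suc n" for p
    using that by (simp add: zap_grad_gen combos_gen)
  then have "grad_ideal n \<subseteq> ?W"
    by (rule combos_least[OF W])
  moreover have "set (map mvar [0..<i]) \<subseteq> ?W"
    using xs by (auto simp: zap_mvar mpoly_ideal_zero[OF C])
  ultimately show "?K \<subseteq> ?W" by (rule foldl_adjoin_least[OF W])
  have K: "ideal ?K (mpoly_ring n)" by (rule ideal_foldl_adjoin[OF J xs])
  have sup: "grad_ideal n \<subseteq> ?K" "set (map mvar [0..<i]) \<subseteq> ?K"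
    using foldl_adjoin_superset[OF J xs] by auto
  have mv: "mvar j \<in> ?K" if "j \<in> {..<i}" for j
    using sup(2) that by auto
  show "?W \<subseteq> ?K"
  proof
    fix b assume b: "b \<in> ?W"
    then obtain r where r: "zap {..<i} b = (\<Sum>p<Suc n. r p * grad_gen n {..<i} p)" "\<forall>p. r p \<in> polys n"
      by (auto elim: combosE)
    have "grad_gen n {..<i} p \<in> ?K" if "p < Suc n" for p
    proof -
      have "grad_gen n {} p \<in> ?K" using sup(1) combos_gen[OF that] by blast
      moreover have "grad_gen n {} p - zap {..<i} (grad_gen n {} p) \<in> ?K"
        by (rule diff_zap_in_ideal[OF K _ mv]) simp
      ultimately show ?thesis
        using mpoly_ideal_diff[OF K] by (fastforce simp: zap_grad_gen)
    qed
    then have "zap {..<i} b \<in> ?K"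
      unfolding r using r(2) by (intro mpoly_ideal_sum[OF K] mpoly_ideal_mult[OF K]) auto
    moreover have "b - zap {..<i} b \<in> ?K"
      by (rule diff_zap_in_ideal[OF K _ mv]) (use b in simp)
    ultimately show "b \<in> ?K"
      using mpoly_ideal_add[OF K, of "b - zap {..<i} b" "zap {..<i} b"] by simp
  qed
qed

text \<open>The syzygies of the gradient specialise to those of its image under setting some of the
  variables \<open>mvar 0, \<dots>, mvar (n - 3)\<close> to zero; lifting a syzygy of the specialisation
  shows that the next variable is a nonzerodivisor.\<close>

lemma mvar_nonzerodivisor:
  fixes b :: "'k::field_char_0 mpol"
  assumes n: "n \<ge> 2" and i: "i < n - 2" and b: "b \<in> polys n"
    and mem: "mvar i * zap {..<i} b \<in> combos n (Suc n) (grad_gen n {..<i})"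
  shows "zap {..<i} b \<in> combos n (Suc n) (grad_gen n {..<i})"
proof -
  let ?g = "grad_gen n {..<i} :: nat \<Rightarrow> 'k mpol" and ?s = "syz n {..<i} :: nat \<Rightarrow> nat \<Rightarrow> 'k mpol"
  obtain r where r: "mvar i * zap {..<i} b = (\<Sum>p<Suc n. r p * ?g p)" "\<forall>p. r p \<in> polys n"
    using mem by (auto elim: combosE)
  have U: "{i} \<union> {..<i} = {..<Suc i}" by auto
  have "0 = zap {i} (mvar i * zap {..<i} b)" by (simp add: zap_mult zap_mvar)
  also have "\<dots> = (\<Sum>p<Suc n. zap {i} (r p) * grad_gen n {..<Suc i} p)"
    unfolding r(1) by (simp only: zap_sum zap_mult zap_grad_gen U)
  finally have rel: "(\<Sum>p<Suc n. zap {i} (r p) * grad_gen n {..<Suc i} p) = 0" ..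
  have "{..<Suc i} \<inter> {n-2..n} = {}" using i by auto
  from syz_exact[OF n this _ rel] r(2) obtain c where
    c: "\<And>j. c j \<in> polys n" "\<And>p. p < Suc n \<Longrightarrow> zap {i} (r p) = (\<Sum>j<Suc n. c j * syz n {..<Suc i} j p)"
    by (auto simp del: sum.lessThan_Suc)
  \<comment> \<open>Subtracting a syzygy does not change the combination, but now every coefficient
    vanishes at x_i = 0, so x_i can be divided out.\<close>
  define r' where "r' p = r p - (\<Sum>j<Suc n. c j * ?s j p)" for p
  have r'P: "r' p \<in> polys n" for p
    unfolding r'_def using r(2) c(1) by (intro polys_closed polys_sum) auto
  have "zap {i} (r' p) = 0" if "p < Suc n" for p
  proof -
    have "zap {i} (r p) = zap {i} (zap {i} (r p))" by (simp add: zap_zap)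
    also have "\<dots> = (\<Sum>j<Suc n. zap {i} (c j) * zap {i} (syz n {..<Suc i} j p))"
      unfolding c(2)[OF that] by (simp only: zap_sum zap_mult)
    also have "\<dots> = zap {i} (\<Sum>j<Suc n. c j * ?s j p)"
      unfolding zap_sum zap_mult zap_syz by (simp add: insert_absorb lessThan_Suc del: sum.lessThan_Suc)
    finally show ?thesis by (simp add: r'_def zap_diff)
  qed
  then have "\<forall>p. \<exists>q. p < Suc n \<longrightarrow> q \<in> polys n \<and> r' p = mvar i * q"
    using zap_singleton_dvd_polys[OF r'P] by blast
  then obtain q where q: "\<And>p. p < Suc n \<Longrightarrow> q p \<in> polys n \<and> r' p = mvar i * q p" by metis
  have "mvar i * (\<Sum>p<Suc n. q p * ?g p) = (\<Sum>p<Suc n. r' p * ?g p)"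
    unfolding sum_distrib_left using q by (intro sum.cong) (auto simp: mult_ac)
  also have "\<dots> = (\<Sum>p<Suc n. r p * ?g p) - (\<Sum>p<Suc n. \<Sum>j<Suc n. c j * (?s j p * ?g p))"
    by (simp only: r'_def left_diff_distrib sum_subtractf sum_distrib_right mult.assoc)
  also have "(\<Sum>p<Suc n. \<Sum>j<Suc n. c j * (?s j p * ?g p)) = (\<Sum>j<Suc n. c j * (\<Sum>p<Suc n. ?s j p * ?g p))"
    unfolding sum_distrib_left by (rule sum.swap)
  also have "\<dots> = 0"
    by (intro sum.neutral ballI) (simp add: syz_grad_gen[OF n] del: sum.lessThan_Suc)
  finally have "mvar i * (\<Sum>p<Suc n. q p * ?g p) = mvar i * zap {..<i} b"
    by (simp only: r(1) diff_0_right)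
  then have "zap {..<i} b = (\<Sum>p<Suc n. q p * ?g p)" by simp
  then show ?thesis using combosI[of "Suc n" q n ?g] q by (simp del: sum.lessThan_Suc)
qed

lemma depth_lower:
  assumes n: "n \<ge> 2"
  shows "enat (n - 2) \<le> depth (mpoly_ring n Quot (grad_ideal n :: 'k::field_char_0 mpol set))
    ((+>\<^bsub>mpoly_ring n\<^esub>) (grad_ideal n) ` irrelevant_ideal n)"
proof -
  let ?J = "grad_ideal n :: 'k mpol set"
  let ?c = "(+>\<^bsub>mpoly_ring n\<^esub>) ?J"
  note J = ideal_grad_ideal[of n, where ?'a = 'k]
  let ?xs = "map mvar [0..<n - 2] :: 'k mpol list"
  have xs: "set ?xs \<subseteq> polys n" by auto
  have fold: "foldl (adjoin n) ?J (map mvar [0..<i])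
      = {b \<in> polys n. zap {..<i} b \<in> combos n (Suc n) (grad_gen n {..<i})}" if "i \<le> n - 2" for i
    using that by (intro foldl_adjoin_mvars) simp
  have "weakly_regular n ?J ?xs"
    unfolding weakly_regular_iff_nth
  proof (intro allI ballI impI)
    fix i b assume i: "i < length ?xs" and b: "b \<in> polys n"
      and mem: "?xs ! i * b \<in> foldl (adjoin n) ?J (take i ?xs)"
    have tk: "take i ?xs = map mvar [0..<i]" using i by (simp add: take_map)
    have "zap {..<i} (mvar i * b) = mvar i * zap {..<i} b" by (simp add: zap_mult zap_mvar)
    then have "mvar i * zap {..<i} b \<in> combos n (Suc n) (grad_gen n {..<i})"
      using mem fold[of i] i unfolding tk by simp
    then show "b \<in> foldl (adjoin n) ?J (take i ?xs)"
      using mvar_nonzerodivisor[OF n _ b, of i] fold[of i] i b unfolding tk by simp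
  qed
  moreover have "1 \<notin> foldl (adjoin n) ?J ?xs"
  proof -
    note irr = irrelevant_ideal_ideal[of n, where ?'a = 'k]
    have "grad_gen n S p \<in> (irrelevant_ideal n :: 'k mpol set)" for S p
      by (rule homogeneous_irrelevant[OF _ homogeneous_grad_gen[OF n]]) (use n in auto)
    then have "combos n (Suc n) (grad_gen n S) \<subseteq> (irrelevant_ideal n :: 'k mpol set)" for S
      by (intro combos_least[OF irr])
    moreover have "1 \<notin> (irrelevant_ideal n :: 'k mpol set)" by (simp add: irrelevant_ideal_iff)
    ultimately show ?thesis unfolding fold[OF order_refl] by auto
  qed
  ultimately have "regular_sequence (mpoly_ring n Quot ?J) (map ?c ?xs)"
    using regular_sequence_quot[OF J xs] by blast
  moreover have "set (map ?c ?xs) \<subseteq> ?c ` irrelevant_ideal n"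
    by (auto simp: irrelevant_ideal_iff)
  ultimately show ?thesis
    unfolding depth_def by (intro Sup_upper CollectI exI[of _ "map ?c ?xs"]) auto
qed

section \<open>A homogeneous element outside J killed by x_(n-2), x_(n-1) and x_n\<close>

lemma hcomp_grad_ideal:
  assumes n: "n \<ge> 2" and p: "p \<in> grad_ideal n"
  shows "hcomp d p \<in> grad_ideal n"
proof -
  obtain r where r: "p = (\<Sum>q<Suc n. r q * grad_gen n {} q)" "\<forall>q. r q \<in> polys n"
    using p by (auto elim: combosE)
  have "hcomp d p = (\<Sum>q<Suc n. hcomp (d - (int n - 1)) (r q) * grad_gen n {} q)"
    unfolding r by (simp only: hcomp_sum hcomp_mult[OF homogeneous_grad_gen[OF n]])
  also have "\<dots> \<in> grad_ideal n"
    by (rule combosI) (use r in auto)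
  finally show ?thesis .
qed

lemma hcomp_negative: "d < 0 \<Longrightarrow> hcomp d p = 0"
  by (rule poly_mapping_eqI) (auto simp: hcomp_def lookup_mask)

text \<open>J is generated in degree n - 1, so it has no nonzero element of degree n - 2.\<close>

lemma mvar_power_not_grad:
  assumes n: "n \<ge> 2"
  shows "(mvar n :: 'k::field mpol) ^ (n - 2) \<notin> grad_ideal n"
proof
  assume mem: "(mvar n :: 'k mpol) ^ (n - 2) \<in> grad_ideal n"
  obtain r where r: "(mvar n :: 'k mpol) ^ (n - 2) = (\<Sum>q<Suc n. r q * grad_gen n {} q)" "\<forall>q. r q \<in> polys n"
    using combosE[OF mem] .
  have "homogeneous (int (n - 2) * 1) ((mvar n :: 'k mpol) ^ (n - 2))"
    by (intro homogeneous_power homogeneous_mvar)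
  then have "(mvar n :: 'k mpol) ^ (n - 2) = hcomp (int (n - 2)) (mvar n ^ (n - 2))"
    by (simp add: hcomp_id)
  also have "\<dots> = (\<Sum>q<Suc n. hcomp (int (n - 2) - (int n - 1)) (r q) * grad_gen n {} q)"
    unfolding r(1) by (simp only: hcomp_sum hcomp_mult[OF homogeneous_grad_gen[OF n]])
  also have "\<dots> = 0"
    using n by (intro sum.neutral ballI) (simp add: hcomp_negative)
  finally show False by simp
qed

text \<open>With \<open>B p = hb_gen y (n - 2) p\<close>, so that \<open>y 0 * B p\<close> is a partial derivative, the
  linear relations between the \<open>B p\<close> modulo the gradient ideal have multiples of \<open>y 1\<close> and
  \<open>y 2\<close> as their last two coefficients; eliminating from the bottom gives a power of
  \<open>y 2\<close> that kills \<open>B 0\<close>.\<close>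

lemma power_kills:
  assumes n: "n \<ge> 2"
  shows "mvar n * mvar n ^ (n - 2) \<in> (grad_ideal n :: 'k::field_char_0 mpol set)"
    and "mvar (n - 1) * mvar n ^ (n - 2) \<in> (grad_ideal n :: 'k mpol set)"
    and "mvar (n - 2) ^ (n - 1) * mvar n ^ (n - 2) \<in> (grad_ideal n :: 'k mpol set)"
proof -
  let ?J = "grad_ideal n :: 'k mpol set" and ?y = "hvar n {} :: nat \<Rightarrow> 'k mpol"
  note J = ideal_grad_ideal[of n, where ?'a = 'k]
  define B where "B p = hb_gen ?y (n - 2) p" for p
  have y: "?y 0 = mvar n" "?y 1 = mvar (n - 1)" "?y 2 = mvar (n - 2)"
    using n by (simp_all add: hvar_def)
  have BP: "B p \<in> polys n" for p unfolding B_def by (rule hb_gen_polys) simp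
  have B0: "B 0 = mvar n ^ (n - 2)" by (simp add: B_def hb_gen_def y)
  have y0B: "?y 0 * B p = grad_gen n {} p" if "p \<le> n - 2" for p
  proof -
    have "n - 1 - p = Suc (n - 2 - p)" "p < n" using that n by auto
    then show ?thesis by (simp add: B_def grad_gen_def hb_gen_def mult.assoc)
  qed
  show "mvar n * mvar n ^ (n - 2) \<in> ?J"
    using y0B[of 0] grad_gen_mem[of 0 n, where ?'a = 'k] by (simp add: B0 y)
  \<comment> \<open>This is \<open>hb_relation_le\<close> divided by y_0. For \<open>p < m\<close>
    the factor comes from the generator, for \<open>p = m\<close> from the matrix entry m y_0, and
    the latter term lies in J.\<close>
  have rel: "(\<Sum>p<m. hb_mat ?y m p * B p) \<in> ?J" if m: "m \<le> n - 1" for m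
  proof -
    have "{..m} = insert m {..<m}" by auto
    then have "0 = hb_mat ?y m m * hb_gen ?y (n - 1) m + (\<Sum>p<m. hb_mat ?y m p * hb_gen ?y (n - 1) p)"
      using hb_relation_le[OF m, of ?y] by simp
    also have "(\<Sum>p<m. hb_mat ?y m p * hb_gen ?y (n - 1) p) = ?y 0 * (\<Sum>p<m. hb_mat ?y m p * B p)"
      unfolding sum_distrib_left
    proof (intro sum.cong refl)
      fix p assume "p \<in> {..<m}"
      then have "p \<le> n - 2" "p < n" using m by auto
      then have "hb_gen ?y (n - 1) p = ?y 0 * B p" by (simp add: y0B grad_gen_def)
      then show "hb_mat ?y m p * hb_gen ?y (n - 1) p = ?y 0 * (hb_mat ?y m p * B p)"
        by (simp only: mult.left_commute)
    qed
    also have "hb_mat ?y m m * hb_gen ?y (n - 1) m = ?y 0 * (of_nat m * grad_gen n {} m)"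
    proof -
      have "m < n" using m n by linarith
      then show ?thesis by (simp add: hb_mat_def grad_gen_def mult_ac)
    qed
    finally have "?y 0 * (of_nat m * grad_gen n {} m + (\<Sum>p<m. hb_mat ?y m p * B p)) = 0"
      by (simp only: distrib_left)
    then have "(\<Sum>p<m. hb_mat ?y m p * B p) = - (of_nat m * grad_gen n {} m)"
      by (simp add: y eq_neg_iff_add_eq_0 add.commute)
    also have "\<dots> \<in> ?J"
      using m n by (intro mpoly_ideal_uminus[OF J] mpoly_ideal_mult[OF J] grad_gen_mem) auto
    finally show ?thesis .
  qed
  have shift: "mvar (n - 1) ^ k * B p \<in> ?J" if "mvar (n - 1) ^ j * B p \<in> ?J" "j \<le> k" for j k p
  proof -
    have "mvar (n - 1) ^ k * B p = mvar (n - 1) ^ (k - j) * (mvar (n - 1) ^ j * B p)"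
      using that(2) by (simp flip: power_add mult.assoc)
    also have "\<dots> \<in> ?J" by (intro mpoly_ideal_mult[OF J that(1)] polys_closed polys_mvar) simp
    finally show ?thesis .
  qed
  have tail: "mvar (n - 1) ^ k * (\<Sum>p<k. a p * B p) \<in> ?J"
    if "\<And>p. p < k \<Longrightarrow> mvar (n - 1) ^ Suc p * B p \<in> ?J" "\<And>p. p < k \<Longrightarrow> a p \<in> polys n" for k a
    unfolding sum_distrib_left
  proof (intro mpoly_ideal_sum[OF J])
    fix p assume "p \<in> {..<k}"
    then have p: "p < k" "Suc p \<le> k" by auto
    have "a p * (mvar (n - 1) ^ k * B p) \<in> ?J"
      by (rule mpoly_ideal_mult[OF J shift[OF that(1)[OF p(1)] p(2)] that(2)[OF p(1)]])
    then show "mvar (n - 1) ^ k * (a p * B p) \<in> ?J" by (simp add: mult.left_commute)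
  qed
  \<comment> \<open>The relation with \<open>m = s + 1\<close> ends in (s + 2) y_1
    \<open>B s\<close>; multiplied by y_1^s its earlier terms lie in J by induction.\<close>
  have k1: "mvar (n - 1) ^ Suc s * B s \<in> ?J" if "s \<le> n - 2" for s
    using that
  proof (induction s rule: less_induct)
    case (less s)
    let ?t = "(\<Sum>p<s. hb_mat ?y (Suc s) p * B p)"
    have "mvar (n - 1) ^ s * (\<Sum>p<Suc s. hb_mat ?y (Suc s) p * B p) \<in> ?J"
      using less.prems n by (intro mpoly_ideal_mult[OF J] rel polys_closed polys_mvar) auto
    moreover have "mvar (n - 1) ^ s * ?t \<in> ?J"
      using less by (intro tail) auto
    ultimately have "mvar (n - 1) ^ s * (\<Sum>p<Suc s. hb_mat ?y (Suc s) p * B p) - mvar (n - 1) ^ s * ?t \<in> ?J"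
      by (rule mpoly_ideal_diff[OF J])
    also have "(\<Sum>p<Suc s. hb_mat ?y (Suc s) p * B p) = ?t + of_nat (s + 2) * mvar (n - 1) * B s"
      using y(2) by (simp add: hb_mat_def)
    also have "mvar (n - 1) ^ s * (?t + of_nat (s + 2) * mvar (n - 1) * B s) - mvar (n - 1) ^ s * ?t
        = of_nat (s + 2) * (mvar (n - 1) ^ Suc s * B s)"
      by (simp only: power_Suc algebra_simps add_diff_cancel_left')
    finally show ?case
      by (rule of_nat_cancel_ideal[OF J, rotated]) simp
  qed
  show "mvar (n - 1) * mvar n ^ (n - 2) \<in> ?J"
    using k1[of 0] by (simp add: B0)
  \<comment> \<open>The relation with \<open>m = s + 2\<close>, multiplied by y_1^s, retains modulo
    J only its last two terms. Hence y_2 y_1^s \<open>B s\<close> is a constant multiple of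
    y_1^(s+1) \<open>B (s + 1)\<close>, which trades one factor y_2 for one factor y_1.\<close>
  have k2: "\<exists>\<kappa>\<in>polys n. mvar (n - 2) ^ s * B 0 - \<kappa> * (mvar (n - 1) ^ s * B s) \<in> ?J" if "s \<le> n - 2" for s
    using that
  proof (induction s)
    case 0
    then show ?case using mpoly_ideal_zero[OF J] by (intro bexI[of _ 1]) auto
  next
    case (Suc s)
    then obtain \<kappa> where \<kappa>: "\<kappa> \<in> polys n" "mvar (n - 2) ^ s * B 0 - \<kappa> * (mvar (n - 1) ^ s * B s) \<in> ?J"
      by auto
    let ?m = "Suc (Suc s)" and ?z = "mvar (n - 1) ^ s :: 'k mpol"
    let ?t = "(\<Sum>p<s. hb_mat ?y ?m p * B p)"
    define a :: "'k mpol" where "a = mterm 0 (1 / of_nat (s + 4))"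
    have "?z * (\<Sum>p<?m. hb_mat ?y ?m p * B p) \<in> ?J"
      using Suc.prems n by (intro mpoly_ideal_mult[OF J] rel polys_closed polys_mvar) auto
    moreover have "?z * ?t \<in> ?J"
      using Suc.prems by (intro tail k1) auto
    ultimately have "?z * (\<Sum>p<?m. hb_mat ?y ?m p * B p) - ?z * ?t \<in> ?J"
      by (rule mpoly_ideal_diff[OF J])
    then have "a * (?z * (\<Sum>p<?m. hb_mat ?y ?m p * B p) - ?z * ?t) \<in> ?J"
      by (rule mpoly_ideal_mult[OF J]) (simp add: a_def)
    moreover have "(\<Sum>p<?m. hb_mat ?y ?m p * B p)
        = ?t + of_nat (s + 4) * mvar (n - 2) * B s + of_nat (s + 3) * mvar (n - 1) * B (Suc s)"
    proof -
      have "2 * ?m - s = s + 4" "?m - s = 2" "2 * ?m - Suc s = s + 3" "?m - Suc s = 1" "s \<le> ?m" "Suc s \<le> ?m"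
        by simp_all
      then have "hb_mat ?y ?m s = of_nat (s + 4) * mvar (n - 2)"
        "hb_mat ?y ?m (Suc s) = of_nat (s + 3) * mvar (n - 1)"
        by (simp_all only: hb_mat_def y if_True)
      then show ?thesis by (simp only: sum.lessThan_Suc)
    qed
    ultimately have "a * (?z * (?t + of_nat (s + 4) * mvar (n - 2) * B s + of_nat (s + 3) * mvar (n - 1) * B (Suc s)) - ?z * ?t) \<in> ?J"
      by (simp only:)
    also have "a * (?z * (?t + of_nat (s + 4) * mvar (n - 2) * B s + of_nat (s + 3) * mvar (n - 1) * B (Suc s)) - ?z * ?t)
       = (a * of_nat (s + 4)) * (mvar (n - 2) * (?z * B s)) + a * of_nat (s + 3) * (mvar (n - 1) ^ Suc s * B (Suc s))"
      by (simp only: power_Suc algebra_simps add_diff_cancel_left')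
    also have "a * of_nat (s + 4) = 1" unfolding a_def by (rule of_nat_inverse) simp
    finally have "\<kappa> * (1 * (mvar (n - 2) * (?z * B s)) + a * of_nat (s + 3) * (mvar (n - 1) ^ Suc s * B (Suc s))) \<in> ?J"
      by (rule mpoly_ideal_mult[OF J _ \<kappa>(1)])
    moreover have "mvar (n - 2) * (mvar (n - 2) ^ s * B 0 - \<kappa> * (?z * B s)) \<in> ?J"
      by (rule mpoly_ideal_mult[OF J \<kappa>(2)]) simp
    ultimately have "mvar (n - 2) * (mvar (n - 2) ^ s * B 0 - \<kappa> * (?z * B s))
        + \<kappa> * (1 * (mvar (n - 2) * (?z * B s)) + a * of_nat (s + 3) * (mvar (n - 1) ^ Suc s * B (Suc s))) \<in> ?J"
      by (intro mpoly_ideal_add[OF J])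
    also have "mvar (n - 2) * (mvar (n - 2) ^ s * B 0 - \<kappa> * (?z * B s))
        + \<kappa> * (1 * (mvar (n - 2) * (?z * B s)) + a * of_nat (s + 3) * (mvar (n - 1) ^ Suc s * B (Suc s)))
        = mvar (n - 2) ^ Suc s * B 0 - (- (\<kappa> * a * of_nat (s + 3))) * (mvar (n - 1) ^ Suc s * B (Suc s))"
      by (simp add: algebra_simps)
    finally show ?case
      by (rule bexI) (unfold a_def, intro polys_closed polys_const \<kappa>(1))
  qed
  obtain \<kappa> where \<kappa>: "\<kappa> \<in> polys n" "mvar (n - 2) ^ (n - 2) * B 0 - \<kappa> * (mvar (n - 1) ^ (n - 2) * B (n - 2)) \<in> ?J"
    using k2[of "n - 2"] by auto
  let ?z = "mvar (n - 1) ^ (n - 2) :: 'k mpol" and ?t = "(\<Sum>p<n-2. euler_coeff ?y n p * B p)"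
  \<comment> \<open>The relations \<open>rel\<close> stop at \<open>m = n - 1\<close>, so the last
    factor y_2 has to come from \<open>last_gen\<close>. It ends in y_2 \<open>B (n - 2)\<close>,
    and its other terms fall into J after multiplication by y_1^(n-2).\<close>
  have "last_gen ?y n = (\<Sum>p<n-1. euler_coeff ?y n p * B p)"
    unfolding last_gen_def B_def euler_coeff_def hb_gen_def by (simp only: mult.assoc)
  also have "{..<n-1} = insert (n - 2) {..<n-2}" using n by auto
  also have "(\<Sum>p\<in>insert (n - 2) {..<n-2}. euler_coeff ?y n p * B p) = mvar (n - 2) * B (n - 2) + ?t"
  proof -
    have "n - 1 - (n - 2) = 1" "n - (n - 2) = 2" using n by auto
    then have "euler_coeff ?y n (n - 2) = mvar (n - 2)" using y(3) by (simp add: euler_coeff_def)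
    then show ?thesis by simp
  qed
  finally have last: "last_gen ?y n = mvar (n - 2) * B (n - 2) + ?t" .
  have "last_gen ?y n \<in> ?J"
    using grad_gen_mem[of n n, where ?'a = 'k] by (simp add: grad_gen_def)
  then have "?z * last_gen ?y n - ?z * ?t \<in> ?J"
    by (intro mpoly_ideal_diff[OF J] mpoly_ideal_mult[OF J] tail k1 polys_closed polys_mvar) auto
  then have "\<kappa> * (?z * last_gen ?y n - ?z * ?t) \<in> ?J"
    by (rule mpoly_ideal_mult[OF J _ \<kappa>(1)])
  moreover have "mvar (n - 2) * (mvar (n - 2) ^ (n - 2) * B 0 - \<kappa> * (?z * B (n - 2))) \<in> ?J"
    by (rule mpoly_ideal_mult[OF J \<kappa>(2)]) simp
  ultimately have "mvar (n - 2) * (mvar (n - 2) ^ (n - 2) * B 0 - \<kappa> * (?z * B (n - 2))) + \<kappa> * (?z * last_gen ?y n - ?z * ?t) \<in> ?J"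
    by (intro mpoly_ideal_add[OF J])
  also have "mvar (n - 2) * (mvar (n - 2) ^ (n - 2) * B 0 - \<kappa> * (?z * B (n - 2))) + \<kappa> * (?z * last_gen ?y n - ?z * ?t)
      = mvar (n - 2) ^ Suc (n - 2) * B 0"
    unfolding last by (simp add: algebra_simps)
  also have "Suc (n - 2) = n - 1" using n by simp
  finally show "mvar (n - 2) ^ (n - 1) * mvar n ^ (n - 2) \<in> ?J"
    by (simp only: B0)
qed

text \<open>y_0^(n-2) is killed by y_0 and y_1, and so are its multiples by powers of y_2. The last
  such multiple outside J is killed by y_2 as well.\<close>

lemma element_killed_by_prime:
  assumes n: "n \<ge> 2"
  shows "\<exists>z d. z \<in> polys n \<and> homogeneous (int d) z \<and> z \<notin> (grad_ideal n :: 'k::field_char_0 mpol set)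
    \<and> (\<forall>i\<in>{n-2..n}. z * mvar i \<in> grad_ideal n)"
proof -
  let ?J = "grad_ideal n :: 'k mpol set"
  note J = ideal_grad_ideal[of n, where ?'a = 'k]
  define w where "w k = (mvar (n - 2) ^ k * mvar n ^ (n - 2) :: 'k mpol)" for k
  define K where "K = (LEAST k. w k \<in> ?J)"
  have "w (n - 1) \<in> ?J" unfolding w_def by (rule power_kills[OF n])
  then have K: "w K \<in> ?J" unfolding K_def by (rule LeastI)
  have "w 0 \<notin> ?J" using mvar_power_not_grad[OF n] by (simp add: w_def)
  then have "K \<noteq> 0" using K by metis
  then obtain k where k: "K = Suc k" by (cases K) auto
  have notin: "w k \<notin> ?J" using not_less_Least[of k "\<lambda>k. w k \<in> ?J"] k unfolding K_def by simp
  have pol: "mvar (n - 2) ^ k \<in> (polys n :: 'k mpol set)" by (intro polys_closed polys_mvar) simp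
  have "w k * mvar i \<in> ?J" if i: "i \<in> {n-2..n}" for i
  proof -
    have "i = n - 2 \<or> i = n - 1 \<or> i = n" using i by auto
    then consider "i = n - 2" | "i = n - 1" | "i = n" by blast
    then show ?thesis
    proof cases
      case 1
      then show ?thesis using K by (simp add: k w_def mult_ac)
    next
      case 2
      then show ?thesis using mpoly_ideal_mult[OF J power_kills(2)[OF n] pol] by (simp add: w_def mult_ac)
    next
      case 3
      then show ?thesis using mpoly_ideal_mult[OF J power_kills(1)[OF n] pol] by (simp add: w_def mult_ac)
    qed
  qed
  moreover have "homogeneous (int (k + (n - 2))) (w k)"
  proof -
    have "homogeneous (int k * 1 + int (n - 2) * 1) (w k)"
      unfolding w_def by (intro homogeneous_mult homogeneous_power homogeneous_mvar)
    then show ?thesis by simp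
  qed
  moreover have "w k \<in> polys n"
    unfolding w_def by (intro polys_closed polys_mvar) auto
  ultimately show ?thesis using notin by blast
qed

section \<open>The bound on the length of regular sequences\<close>

text \<open>The \<open>t\<close>-th power of the irrelevant ideal, described by the degrees of
  terms.\<close>

definition high_degree :: "nat \<Rightarrow> nat \<Rightarrow> 'k::field mpol set" where
  "high_degree n t = {p \<in> polys n. \<forall>m\<in>msupp p. t \<le> mon_deg m}"

lemma high_degree_mult:
  assumes "p \<in> high_degree n s" "q \<in> high_degree n t"
  shows "p * q \<in> high_degree n (s + t)"
  unfolding high_degree_def
proof (intro CollectI conjI ballI)
  show "p * q \<in> polys n" using assms by (simp add: high_degree_def)
  fix m assume "m \<in> msupp (p * q)"
  then obtain a b where "m = a + b" "a \<in> msupp p" "b \<in> msupp q"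
    using Poly_Mapping.keys_mult[of p q] by blast
  then show "s + t \<le> mon_deg m"
    using assms by (auto simp: high_degree_def mon_deg_add intro: add_mono)
qed

lemma ideal_high_degree: "ideal (high_degree n t :: 'k::field mpol set) (mpoly_ring n)"
proof (rule ideal_mpoly_ringI)
  fix a b :: "'k mpol" assume "a \<in> high_degree n t" "b \<in> high_degree n t"
  then show "a + b \<in> high_degree n t"
    using Poly_Mapping.keys_add[of a b] by (auto simp: high_degree_def)
next
  fix c a :: "'k mpol" assume "c \<in> polys n" and a: "a \<in> high_degree n t"
  then have "c \<in> high_degree n 0" by (simp add: high_degree_def)
  from high_degree_mult[OF this a] show "c * a \<in> high_degree n t" by simp
qed (auto simp: high_degree_def)

lemma high_degree_power:
  assumes "x \<in> irrelevant_ideal n"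
  shows "x ^ t \<in> high_degree n t"
proof (induction t)
  case 0
  then show ?case by (simp add: high_degree_def)
next
  case (Suc t)
  have "1 \<le> mon_deg m" if "m \<in> msupp x" for m
  proof -
    have "m \<noteq> 0" using that assms by (auto simp: irrelevant_ideal_iff in_keys_iff)
    then obtain i where "i \<in> msupp m" by fastforce
    then have "mcoeff m i \<le> mon_deg m" "mcoeff m i \<noteq> 0"
      unfolding mon_deg_def by (auto simp: in_keys_iff intro: member_le_sum)
    then show ?thesis by simp
  qed
  then have "x \<in> high_degree n 1"
    using assms by (simp add: high_degree_def irrelevant_ideal_iff)
  from high_degree_mult[OF this Suc] show ?case by simp
qed

lemma hcomp_high_degree:
  assumes "r \<in> high_degree n (Suc d)"
  shows "hcomp (int d) r = 0"
proof (rule poly_mapping_eqI)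
  fix m
  have "mcoeff r m = 0 \<or> Suc d \<le> mon_deg m"
    using assms by (auto simp: high_degree_def simp flip: not_in_keys_iff_lookup_eq_zero)
  then show "mcoeff (hcomp (int d) r) m = mcoeff 0 m"
    by (auto simp: hcomp_def lookup_mask)
qed

lemma weakly_regular_take: "weakly_regular n I xs \<Longrightarrow> weakly_regular n I (take k xs)"
proof (induction xs arbitrary: I k)
  case (Cons x xs)
  then show ?case by (cases k) auto
qed simp

text \<open>The submodule generated by the element \<open>z\<close> of \<open>element_killed_by_prime\<close> is a quotient of a polynomial ring in
  \<open>n - 2\<close> variables, so a polynomial relation between \<open>n - 1\<close> elements kills it; for a regular
  sequence this puts \<open>z\<close> into the ideal of the sequence.  Large powers of the
  sequence make that impossible for degree reasons.\<close>

lemma weakly_regular_length: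
  fixes xs :: "'k::field_char_0 mpol list"
  assumes n: "n \<ge> 2" and xs: "set xs \<subseteq> irrelevant_ideal n" and reg: "weakly_regular n (grad_ideal n) xs"
  shows "length xs \<le> n - 2"
proof (rule ccontr)
  assume "\<not> length xs \<le> n - 2"
  then have len: "n - 1 \<le> length xs" by simp
  let ?J = "grad_ideal n :: 'k mpol set"
  note J = ideal_grad_ideal[of n, where ?'a = 'k]
  obtain z d where z: "z \<in> polys n" "homogeneous (int d) z" "z \<notin> ?J"
    "\<And>i. i \<in> {n-2..n} \<Longrightarrow> z * mvar i \<in> ?J"
    using element_killed_by_prime[OF n, where ?'k = 'k] by blast
  \<comment> \<open>The exponent exceeds the degree \<open>d\<close> of \<open>z\<close>, so all
    these powers live in degrees above \<open>d\<close>. Exactly n - 1 of them are taken, one more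
    than the n - 2 variables that survive modulo x_(n-2), x_(n-1), x_n.\<close>
  define ys where "ys = map (\<lambda>x. x ^ Suc d) (take (n - 1) xs)"
  have leny: "length ys = n - 1" using len by (simp add: ys_def)
  have xsP: "set (take (n - 1) xs) \<subseteq> irrelevant_ideal n"
    using xs set_take_subset by fast
  then have xsP': "set (take (n - 1) xs) \<subseteq> polys n"
    by (auto simp: irrelevant_ideal_iff)
  have ysP: "set ys \<subseteq> polys n" using xsP' by (auto simp: ys_def)
  have regy: "weakly_regular n ?J ys"
    unfolding ys_def by (intro weakly_regular_powers J xsP' weakly_regular_take reg)
  let ?K = "\<lambda>i. foldl (adjoin n) ?J (take i ys)"
  have takeP: "set (take i ys) \<subseteq> polys n" for i using ysP set_take_subset by fast
  have K: "ideal (?K i) (mpoly_ring n)" for i by (rule ideal_foldl_adjoin[OF J takeP])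
  have KSuc: "?K (Suc i) = adjoin n (?K i) (ys ! i)" if "i < length ys" for i
    using that by (simp add: take_Suc_conv_app_nth)
  \<comment> \<open>These ideals contain x_(n-2), x_(n-1), x_n by the choice of \<open>z\<close>, so
    a relation modulo these variables lies in \<open>V 0\<close>. Being a nonzerodivisor modulo
    \<open>?K i\<close> passes to the colon ideal.\<close>
  define V where "V i = colon n (?K i) z" for i
  have V: "ideal (V i) (mpoly_ring n)" for i unfolding V_def by (rule ideal_colon[OF K z(1)])
  have "\<exists>E c. finite E \<and> E \<noteq> {} \<and> (\<forall>es\<in>E. length es = length (map (zap {n-2..n}) ys) \<and> c es \<noteq> 0) \<and>
      (\<Sum>es\<in>E. mterm 0 (c es) * monom_eval (map (zap {n-2..n}) ys) es) = 0"
  proof (rule algebraically_dependent[of "{..<n-2}"])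
    show "card {..<n-2} < length (map (zap {n-2..n}) ys)" using n leny by simp
    fix p m assume "p \<in> set (map (zap {n-2..n}) ys)" "m \<in> msupp p"
    then obtain u where u: "u \<in> set ys" "m \<in> msupp (zap {n-2..n} u)" by auto
    moreover from this have "u \<in> polys n" using ysP by blast
    ultimately have "msupp m \<subseteq> {..n}" "msupp m \<inter> {n-2..n} = {}"
      by (simp_all add: keys_zap polys_iff)
    then show "msupp m \<subseteq> {..<n-2}" by fastforce
  qed simp
  then obtain E c where E: "finite E" "E \<noteq> {}" "\<And>es. es \<in> E \<Longrightarrow> length es = length ys \<and> c es \<noteq> 0"
    "(\<Sum>es\<in>E. mterm 0 (c es) * monom_eval (map (zap {n-2..n}) ys) es) = 0" by auto
  have "1 \<in> V (length ys)"
  proof (rule lowest_coefficient_descent[OF _ _ _ _ ysP E(1-3)])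
    show "V i \<subseteq> V (Suc i)" if "i < length ys" for i
      unfolding V_def KSuc[OF that] using adjoin_superset(1)[OF K] by (auto simp: colon_def)
    show "ys ! i \<in> V (Suc i)" if "i < length ys" for i
    proof -
      have "ys ! i \<in> polys n" using ysP that by auto
      moreover have "z * ys ! i \<in> ?K (Suc i)"
        using mpoly_ideal_mult[OF K _ z(1), of "ys ! i" "Suc i"] adjoin_superset(2)[OF K] KSuc[OF that] by simp
      ultimately show ?thesis by (simp add: V_def colon_def)
    qed
    show "b \<in> V i" if "i < length ys" "b \<in> polys n" "ys ! i * b \<in> V i" for i b
    proof -
      have "ys ! i * (z * b) \<in> ?K i" using that(3) by (simp add: V_def colon_def mult.left_commute)
      then have "z * b \<in> ?K i"
        using regy that(1,2) z(1) unfolding weakly_regular_iff_nth by (meson polys_closed(7))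
      then show ?thesis using that(2) by (simp add: V_def colon_def)
    qed
    let ?Q = "\<Sum>es\<in>E. mterm 0 (c es) * monom_eval ys es"
    have "mterm 0 (c es) = zap {n-2..n} (mterm 0 (c es))" for es
      by (simp add: zap_def mask_single)
    then have "zap {n-2..n} ?Q = 0"
      using E(4) by (simp add: zap_sum zap_mult zap_monom_eval)
    moreover have "?Q - zap {n-2..n} ?Q \<in> V 0"
    proof (rule diff_zap_in_ideal[OF V])
      show "?Q \<in> polys n"
        by (intro polys_sum polys_closed polys_const monom_eval_polys ysP)
      show "mvar i \<in> V 0" if "i \<in> {n-2..n}" for i
        using z(4)[OF that] that by (simp add: V_def colon_def)
    qed
    ultimately show "?Q \<in> V 0" by simp
  qed (rule V)
  then have zK: "z \<in> foldl (adjoin n) ?J ys"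
    by (simp add: V_def colon_def)
  \<comment> \<open>J plus the power d + 1 of the irrelevant ideal. It contains \<open>z\<close>,
    and taking the component of degree \<open>d\<close> removes the second summand and puts
    \<open>z\<close> into the graded ideal J.\<close>
  let ?H = "{j + r | j r. j \<in> ?J \<and> r \<in> high_degree n (Suc d)}"
  note M = ideal_high_degree[of n "Suc d", where ?'k = 'k]
  have H: "ideal ?H (mpoly_ring n)"
  proof (rule ideal_mpoly_ringI)
    show "?H \<subseteq> polys n" using mpoly_ideal_subset[OF J] mpoly_ideal_subset[OF M] by auto
    show "0 \<in> ?H" using mpoly_ideal_zero[OF J] mpoly_ideal_zero[OF M] by force
  next
    fix a b :: "'k mpol" assume "a \<in> ?H" "b \<in> ?H"
    then obtain i j r s where "a = i + r" "b = j + s" "i \<in> ?J" "j \<in> ?J"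
      "r \<in> high_degree n (Suc d)" "s \<in> high_degree n (Suc d)" by blast
    then show "a + b \<in> ?H"
      using mpoly_ideal_add[OF J, of i j] mpoly_ideal_add[OF M, of r s]
      by (intro CollectI exI[of _ "i + j"] exI[of _ "r + s"]) (simp add: algebra_simps)
  next
    fix c a :: "'k mpol" assume "c \<in> polys n" "a \<in> ?H"
    then obtain i r where "c \<in> polys n" "a = i + r" "i \<in> ?J" "r \<in> high_degree n (Suc d)" by blast
    then show "c * a \<in> ?H"
      using mpoly_ideal_mult[OF J, of i c] mpoly_ideal_mult[OF M, of r c]
      by (intro CollectI exI[of _ "c * i"] exI[of _ "c * r"]) (simp add: algebra_simps)
  qed
  have "foldl (adjoin n) ?J ys \<subseteq> ?H"
  proof (rule foldl_adjoin_least[OF H])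
    show "?J \<subseteq> ?H" using mpoly_ideal_zero[OF M] by force
    have "set ys \<subseteq> high_degree n (Suc d)"
      using xsP high_degree_power by (auto simp: ys_def simp del: power_Suc)
    then show "set ys \<subseteq> ?H" using mpoly_ideal_zero[OF J] by force
  qed
  with zK obtain j r where jr: "z = j + r" "j \<in> ?J" "r \<in> high_degree n (Suc d)" by blast
  have "z = hcomp (int d) z" by (simp add: hcomp_id z)
  also have "\<dots> = hcomp (int d) j" using jr by (simp add: hcomp_add hcomp_high_degree)
  also have "\<dots> \<in> ?J" by (rule hcomp_grad_ideal[OF n jr(2)])
  finally show False using z(3) by simp
qed

lemma depth_upper:
  assumes n: "n \<ge> 2"
  shows "depth (mpoly_ring n Quot (grad_ideal n :: 'k::field_char_0 mpol set))
    ((+>\<^bsub>mpoly_ring n\<^esub>) (grad_ideal n) ` irrelevant_ideal n) \<le> enat (n - 2)"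
  unfolding depth_def
proof (rule Sup_least)
  let ?J = "grad_ideal n :: 'k mpol set"
  let ?c = "(+>\<^bsub>mpoly_ring n\<^esub>) ?J"
  note J = ideal_grad_ideal[of n, where ?'a = 'k]
  fix e assume "e \<in> {enat (length as) | as. set as \<subseteq> ?c ` irrelevant_ideal n \<and> regular_sequence (mpoly_ring n Quot ?J) as}"
  then obtain as where as: "e = enat (length as)" "set as \<subseteq> ?c ` irrelevant_ideal n"
    "regular_sequence (mpoly_ring n Quot ?J) as" by blast
  have "\<forall>a\<in>set as. \<exists>x. x \<in> irrelevant_ideal n \<and> ?c x = a" using as(2) by blast
  then obtain g where g: "\<And>a. a \<in> set as \<Longrightarrow> g a \<in> irrelevant_ideal n \<and> ?c (g a) = a" by metis
  define xs where "xs = map g as"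
  have xs: "set xs \<subseteq> irrelevant_ideal n" using g by (auto simp: xs_def)
  then have xsP: "set xs \<subseteq> polys n" by (auto simp: irrelevant_ideal_iff)
  have "map ?c xs = as" using g by (simp add: xs_def map_idI)
  then have "weakly_regular n ?J xs"
    using as(3) regular_sequence_quot[OF J xsP] by simp
  then have "length xs \<le> n - 2" by (rule weakly_regular_length[OF n xs])
  then show "e \<le> enat (n - 2)" by (simp add: as xs_def)
qed

lemma strictly_almost_CM_grad_ideal:
  assumes n: "n \<ge> 3"
  shows "strictly_almost_CM n (grad_ideal n :: 'k::field_char_0 mpol set)"
proof -
  have "n \<ge> 2" using n by simp
  then have "depth (mpoly_ring n Quot (grad_ideal n :: 'k mpol set))
      ((+>\<^bsub>mpoly_ring n\<^esub>) (grad_ideal n) ` irrelevant_ideal n) = enat (n - 2)"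
    by (intro antisym depth_upper depth_lower)
  moreover have "krull_dim (mpoly_ring n Quot (grad_ideal n :: 'k mpol set)) = enat (n - 1)"
    by (intro antisym krull_dim_upper krull_dim_lower n)
  moreover have "enat (n - 2) + 1 = enat (n - 1)"
    using n by (simp add: one_enat_def)
  ultimately show ?thesis
    unfolding strictly_almost_CM_def by simp
qed

text \<open>For n = 2 the partial derivatives span all linear forms, so R/J = k has depth and
  dimension 0; the last claim therefore starts at n = 3.\<close>

theorem proposition4p5:
  fixes n :: nat
    and f :: "'k::field_char_0 mpol"
    and J :: "'k mpol set"
  assumes n: "n \<ge> 2"
    and f: "f = det (sub_hankel n)"
    and J: "J = gradient_ideal n f"
  shows "(\<exists>d. minimal_graded_resolution n J
            [[0],
             replicate (n + 1) (n - 1),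
             replicate n n @ [2 * (n - 1)],
             [2 * n - 1]] d) \<and>
         (n \<ge> 3 \<longrightarrow> strictly_almost_CM n J)"
proof -
  have "J = grad_ideal n"
    unfolding J f by (rule gradient_ideal_sub_hankel[OF n])
  then show ?thesis
    using grad_resolution[OF n, where ?'k = 'k] strictly_almost_CM_grad_ideal[of n, where ?'k = 'k] by simp
qed

end
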